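(* Let $m\ge 2$ be a fixed integer, let $p,q\in(0,1)$ be fixed constants with $p>q$, let $t>0$ be a constant, and let $\alpha=\alpha_n=\frac{t\log n}{n^{m-1}}$. Define $$J_m(p,q)=\frac{2^{m+2}(m-2)!\,[mp-(m-2^{m})q]}{(p-q)^2}.$$ Let $A$ be generated from $\mathcal{H}_m(n,p,q,\alpha)$ with true label (row) vector $\sigma\in\{\pm1\}^n$, and let $Y=\sigma^T\sigma$. Let $G=[G_{ij}]$ be the weighted graph $$G_{ij}=\sum_{1\le i_3<\dots<i_m\le n}\widetilde A_{iji_3\cdots i_m},\qquad \widetilde A_{i_1\cdots i_m}=\mathbf 1[A_{i_1\cdots i_m}=1],$$ with $\widetilde A_{i_1\cdots i_m}=0$ whenever $i_1,\dots,i_m$ are not all distinct. Let $\widehat Y$ be the solution of the semidefinite program $$\max_{Z}\ \langle G,Z\rangle\quad\text{s.t.}\quad Z\succeq 0,\quad \langle Z,J\rangle=0,\quad Z_{ii}=1\ \ (i=1,\dots,n),$$ where $J$ is the $n\times n$ all-one matrix. If $t>J_m(p,q)$, then $$\mathbb{P}(\widehat Y=Y)=1-o(1)\qquad (n\to\infty).$$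
   Context: Model $\mathcal{H}_m(n,p,q,\alpha)$ (censored $m$-uniform hypergraph stochastic block model): the node set is $\{1,\dots,n\}$. Each node $i$ independently receives a label $\sigma_i$ with $\mathbb{P}(\sigma_i=+1)=\mathbb{P}(\sigma_i=-1)=\tfrac12$; $\sigma=(\sigma_1,\dots,\sigma_n)$ is the true label vector, and $I_+(\sigma)=\{i:\sigma_i=+1\}$, $I_-(\sigma)=\{i:\sigma_i=-1\}$ are the two communities. Given $\sigma$, independently over all $m$-element subsets of nodes, a subset is a hyperedge with probability $p$ if it is contained in $I_+(\sigma)$ or in $I_-(\sigma)$, and with probability $q$ otherwise. The status of each $m$-subset is revealed independently with probability $\alpha$. The observation $A$ assigns to each $m$-subset a value $A_{i_1\cdots i_m}\in\{1,0,*\}$ (symmetric in the indices): $1$ if revealed and present, $0$ if revealed and absent, $*$ if not revealed (censored). Notation: $\langle M,N\rangle=\sum_{i,j}M_{ij}N_{ij}$, and $M\succeq 0$ means that $M$ is symmetric positive semidefinite. For $m=2$, $G_{ij}=\widetilde A_{ij}$. Since $\sigma$ is a row vector, $\sigma^T\sigma$ is the $n\times n$ matrix with entries $\sigma_i\sigma_j$.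
   Formalization: The limit is proved for even n with the probability conditioned on the two communities having equal size; otherwise Y violates ⟨Z,J⟩=0, and with independent uniform labels P(Ŷ=Y) tends to 0, so the unconditioned claim fails. *)

theory Defs
  imports "HOL-Probability.Probability" "Jordan_Normal_Form.Matrix"
begin

text \<open>
  The nodes are \<open>0, \<dots>, n - 1\<close> rather than \<open>1, \<dots>, n\<close>, so that they coincide with the row and
  column indices of the matrices of \<^theory>\<open>Jordan_Normal_Form.Matrix\<close>.
\<close>

section \<open>The censored \<open>m\<close>-uniform hypergraph stochastic block model\<close>

definition label_pmf :: "nat \<Rightarrow> (nat \<Rightarrow> real) pmf" where
  "label_pmf n = Pi_pmf {..<n} 0 (\<lambda>_. pmf_of_set {1, -1})"

definition community_pos :: "nat \<Rightarrow> (nat \<Rightarrow> real) \<Rightarrow> nat set" where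
  "community_pos n \<sigma> = {i. i < n \<and> \<sigma> i = 1}"

definition community_neg :: "nat \<Rightarrow> (nat \<Rightarrow> real) \<Rightarrow> nat set" where
  "community_neg n \<sigma> = {i. i < n \<and> \<sigma> i = -1}"

datatype obs = Present | Absent | Censored

text \<open>\<^const>\<open>bernoulli_pmf\<close> truncates its parameter to \<open>[0, 1]\<close>; below, this only matters for the
  finitely many \<open>n\<close> for which the revelation rate \<open>t log n / n\<^sup>m\<^sup>-\<^sup>1\<close> exceeds \<open>1\<close>.\<close>

definition edge_pmf :: "nat \<Rightarrow> real \<Rightarrow> real \<Rightarrow> real \<Rightarrow> (nat \<Rightarrow> real) \<Rightarrow> nat set \<Rightarrow> obs pmf" where
  "edge_pmf n p q \<alpha> \<sigma> e = do {
     present \<leftarrow> bernoulli_pmf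
       (if e \<subseteq> community_pos n \<sigma> \<or> e \<subseteq> community_neg n \<sigma> then p else q);
     revealed \<leftarrow> bernoulli_pmf \<alpha>;
     return_pmf (if \<not> revealed then Censored else if present then Present else Absent)
   }"

definition observation_pmf ::
    "nat \<Rightarrow> nat \<Rightarrow> real \<Rightarrow> real \<Rightarrow> real \<Rightarrow> (nat \<Rightarrow> real) \<Rightarrow> (nat set \<Rightarrow> obs) pmf" where
  "observation_pmf m n p q \<alpha> \<sigma> =
     Pi_pmf {e. e \<subseteq> {..<n} \<and> card e = m} Censored (edge_pmf n p q \<alpha> \<sigma>)"

text \<open>The joint law of the true labels and the observation.\<close>

definition hsbm_pmf ::
    "nat \<Rightarrow> nat \<Rightarrow> real \<Rightarrow> real \<Rightarrow> real \<Rightarrow> ((nat \<Rightarrow> real) \<times> (nat set \<Rightarrow> obs)) pmf" where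
  "hsbm_pmf m n p q \<alpha> = do {
     \<sigma> \<leftarrow> label_pmf n;
     A \<leftarrow> observation_pmf m n p q \<alpha> \<sigma>;
     return_pmf (\<sigma>, A)
   }"

definition reveal_rate :: "nat \<Rightarrow> real \<Rightarrow> nat \<Rightarrow> real" where
  "reveal_rate m t n = t * ln (real n) / real n ^ (m - 1)"

section \<open>The weighted graph and the semidefinite program\<close>

text \<open>The array \<open>\<tilde>A\<close> is indexed by tuples of nodes, encoded as lists; the symmetric array \<open>A\<close> is
  a function of the underlying set.\<close>

definition obs_indicator :: "(nat set \<Rightarrow> obs) \<Rightarrow> nat list \<Rightarrow> real" where
  "obs_indicator A is = (if distinct is \<and> A (set is) = Present then 1 else 0)"

definition weighted_graph :: "nat \<Rightarrow> nat \<Rightarrow> (nat set \<Rightarrow> obs) \<Rightarrow> real mat" where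
  "weighted_graph m n A = Matrix.mat n n (\<lambda>(i, j).
     \<Sum>is | length is = m - 2 \<and> set is \<subseteq> {..<n} \<and> sorted_wrt (<) is.
       obs_indicator A (i # j # is))"

definition label_matrix :: "nat \<Rightarrow> (nat \<Rightarrow> real) \<Rightarrow> real mat" where
  "label_matrix n \<sigma> = Matrix.mat n n (\<lambda>(i, j). \<sigma> i * \<sigma> j)"

definition all_one_matrix :: "nat \<Rightarrow> real mat" where
  "all_one_matrix n = Matrix.mat n n (\<lambda>_. 1)"

definition frob_inner :: "real mat \<Rightarrow> real mat \<Rightarrow> real" where
  "frob_inner M N = (\<Sum>i<dim_row M. \<Sum>j<dim_col M. M $$ (i, j) * N $$ (i, j))"

definition psd_mat :: "nat \<Rightarrow> real mat \<Rightarrow> bool" where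
  "psd_mat n Z \<longleftrightarrow> Z \<in> carrier_mat n n \<and> transpose_mat Z = Z \<and>
     (\<forall>x \<in> carrier_vec n. scalar_prod x (Z *\<^sub>v x) \<ge> 0)"

definition sdp_feasible :: "nat \<Rightarrow> real mat set" where
  "sdp_feasible n = {Z. psd_mat n Z \<and> frob_inner Z (all_one_matrix n) = 0 \<and>
     (\<forall>i<n. Z $$ (i, i) = 1)}"

definition sdp_solutions :: "nat \<Rightarrow> real mat \<Rightarrow> real mat set" where
  "sdp_solutions n G = {Z \<in> sdp_feasible n. \<forall>Z' \<in> sdp_feasible n. frob_inner G Z' \<le> frob_inner G Z}"

section \<open>Recovery\<close>

definition J_threshold :: "nat \<Rightarrow> real \<Rightarrow> real \<Rightarrow> real" where
  "J_threshold m p q =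
     2 ^ (m + 2) * fact (m - 2) * (real m * p - (real m - 2 ^ m) * q) / (p - q)\<^sup>2"

text \<open>\<open>\<widehat>Y = Y\<close> is read as: \<open>Y\<close> is the one and only maximizer.\<close>

definition exact_recovery :: "nat \<Rightarrow> nat \<Rightarrow> (nat \<Rightarrow> real) \<Rightarrow> (nat set \<Rightarrow> obs) \<Rightarrow> bool" where
  "exact_recovery m n \<sigma> A \<longleftrightarrow> sdp_solutions n (weighted_graph m n A) = {label_matrix n \<sigma>}"

text \<open>The constraint \<open>\<langle>Z, J\<rangle> = 0\<close> presupposes communities of equal size: otherwise \<open>Y\<close> is not
  feasible (lemma \<open>label_matrix_feasible_iff\<close>) and \<open>\<widehat>Y = Y\<close> is impossible. Under independent
  uniform labels balance has probability \<open>0\<close> for odd \<open>n\<close> and \<open>O(n\<^sup>-\<^sup>1\<^sup>/\<^sup>2)\<close> for even \<open>n\<close>, so the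
  recovery probability is taken conditionally on balance, along even \<open>n\<close>.\<close>

definition balanced :: "nat \<Rightarrow> (nat \<Rightarrow> real) \<Rightarrow> bool" where
  "balanced n \<sigma> \<longleftrightarrow> card (community_pos n \<sigma>) = card (community_neg n \<sigma>)"

lemma sum_labels_eq:
  assumes "\<And>i. i < n \<Longrightarrow> \<sigma> i \<in> {1, -1}"
  shows "(\<Sum>i<n. \<sigma> i) = real (card (community_pos n \<sigma>)) - real (card (community_neg n \<sigma>))"
proof -
  have "{..<n} = community_pos n \<sigma> \<union> community_neg n \<sigma>"
    using assms by (auto simp: community_pos_def community_neg_def)
  moreover have "community_pos n \<sigma> \<inter> community_neg n \<sigma> = {}"
    by (auto simp: community_pos_def community_neg_def)
  moreover have "finite (community_pos n \<sigma>)" "finite (community_neg n \<sigma>)"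
    by (auto simp: community_pos_def community_neg_def)
  ultimately have "(\<Sum>i<n. \<sigma> i) = sum \<sigma> (community_pos n \<sigma>) + sum \<sigma> (community_neg n \<sigma>)"
    by (simp add: sum.union_disjoint)
  also have "sum \<sigma> (community_pos n \<sigma>) = (\<Sum>i\<in>community_pos n \<sigma>. 1)"
    by (intro sum.cong) (auto simp: community_pos_def)
  also have "sum \<sigma> (community_neg n \<sigma>) = (\<Sum>i\<in>community_neg n \<sigma>. -1)"
    by (intro sum.cong) (auto simp: community_neg_def)
  finally show ?thesis by simp
qed

lemma label_matrix_feasible_iff:
  assumes "\<And>i. i < n \<Longrightarrow> \<sigma> i \<in> {1, -1}"
  shows "label_matrix n \<sigma> \<in> sdp_feasible n \<longleftrightarrow> balanced n \<sigma>"
proof -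
  have "frob_inner (label_matrix n \<sigma>) (all_one_matrix n) = (\<Sum>i<n. \<sigma> i) ^ 2"
    by (simp add: frob_inner_def label_matrix_def all_one_matrix_def power2_eq_square sum_product)
  moreover have "psd_mat n (label_matrix n \<sigma>)"
    unfolding psd_mat_def
  proof (intro conjI ballI)
    show "label_matrix n \<sigma> \<in> carrier_mat n n"
      by (simp add: label_matrix_def)
    show "transpose_mat (label_matrix n \<sigma>) = label_matrix n \<sigma>"
      by (rule eq_matI) (auto simp: label_matrix_def)
    fix x :: "real Matrix.vec" assume x: "x \<in> carrier_vec n"
    have "scalar_prod x (label_matrix n \<sigma> *\<^sub>v x) =
        (\<Sum>i<n. vec_index x i * (\<Sum>j<n. \<sigma> i * \<sigma> j * vec_index x j))"
      using x by (auto simp: scalar_prod_def label_matrix_def atLeast0LessThan intro!: sum.cong)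
    also have "\<dots> = (\<Sum>i<n. \<sigma> i * vec_index x i) ^ 2"
      by (simp add: power2_eq_square sum_product sum_distrib_left mult_ac)
    finally show "scalar_prod x (label_matrix n \<sigma> *\<^sub>v x) \<ge> 0" by simp
  qed
  moreover have "\<forall>i<n. label_matrix n \<sigma> $$ (i, i) = 1"
    using assms by (force simp: label_matrix_def)
  ultimately show ?thesis
    by (simp add: sdp_feasible_def balanced_def sum_labels_eq[OF assms])
qed

end

theory Submission
  imports Defs "HOL-Real_Asymp.Real_Asymp"
begin

text \<open>
  Write \<open>G\<close> for the weighted graph and \<open>D i = (\<Sum>j. \<sigma> i * \<sigma> j * G i j)\<close>. Since the feasible \<open>Z\<close> are
  Gram matrices of vectors orthogonal to the all-one vector, \<open>Y\<close> is the unique maximizer as soon as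
  \<open>diag D - G\<close> is positive definite on the orthogonal complement of \<open>1\<close> and \<open>\<sigma>\<close>. There the mean of
  \<open>G\<close> acts as a nonpositive multiple of the identity, so it suffices that with high probability
  all \<open>D i\<close> exceed \<open>(ln n) / 2\<close> and the quadratic form of the noise \<open>G - E G\<close> is at most
  \<open>2 / 5 * ln n\<close> on unit vectors.

  The first property is a Chernoff bound, and this is where the threshold on \<open>t\<close> enters. For
  the second no matrix concentration inequality is needed: the noise has zero diagonal, so its
  quadratic form is largest at integer points of a ball, which are only exponentially many. Pairs
  with \<open>\<bar>z i * z j\<bar>\<close> at most a small multiple of \<open>ln n\<close> are handled by a union bound over these points.
  The remaining pairs either have coordinates of very different sizes, where a bound on the degrees
  suffices, or both coordinates are large, so that they lie in a set of \<open>O(n / ln n)\<close> nodes; such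
  sets span few hyperedges, simultaneously for all of them.
\<close>

section \<open>Quadratic forms on a lattice ball\<close>

text \<open>The obstacle is the union bound. There are about \<open>48 ^ n\<close> lattice points,
  so each needs failure probability exponentially small in \<open>n\<close>. For a deviation of
  order \<open>n * ln n\<close>, an exponential moment gives an exponent of the order of the
  deviation divided by the largest coefficient, and this is a large multiple of \<open>n\<close>
  only if no coefficient exceeds a small multiple of \<open>ln n\<close>. The cut at \<theta>
  enforces exactly this. On heavy pairs concentration is given up: the observed weights are bounded
  by degrees and by counts inside small sets, and the mean by its size alone. The noise only has to
  stay below a fixed multiple of \<open>ln n\<close>, so the constants in this part are generous.
  The Chernoff bound for \<open>D i\<close> needs no exact rate function either: replacing
  \<open>exp x\<close> by \<open>1 + x + x^2\<close> yields an exponent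
  \<open>mean^2 / (4 * variance)\<close>, and the threshold on \<open>t\<close> makes this about
  \<open>2 * ln n\<close>, twice what a union over the nodes needs. All estimates hold for fixed
  labels, with constants that do not depend on which balanced labelling it is; conditioning on
  balance is therefore harmless.\<close>

definition quad_form :: "nat \<Rightarrow> (nat \<Rightarrow> nat \<Rightarrow> real) \<Rightarrow> (nat \<Rightarrow> real) \<Rightarrow> real" where
  "quad_form n W x = (\<Sum>i<n. \<Sum>j<n. W i j * x i * x j)"

lemma affine_le_floor_or_ceiling:
  fixes a b x :: real
  shows "a + b * x \<le> a + b * of_int \<lfloor>x\<rfloor> \<or> a + b * x \<le> a + b * of_int \<lceil>x\<rceil>"
proof (cases "b \<ge> 0")
  case True
  then have "b * x \<le> b * of_int \<lceil>x\<rceil>" by (intro mult_left_mono) auto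
  then show ?thesis by simp
next
  case False
  then have "b * x \<le> b * of_int \<lfloor>x\<rfloor>" by (intro mult_left_mono_neg) auto
  then show ?thesis by simp
qed

lemma quad_form_affine:
  assumes "\<And>i. i < n \<Longrightarrow> W i i = 0" "k < n"
  shows "quad_form n W (x(k := s)) = quad_form n W (x(k := 0)) +
    ((\<Sum>j\<in>{..<n} - {k}. (W k j + W j k) * x j)) * s"
proof -
  have split: "quad_form n W y = (\<Sum>i\<in>{..<n} - {k}. \<Sum>j\<in>{..<n} - {k}. W i j * y i * y j)
     + (\<Sum>j\<in>{..<n} - {k}. (W k j + W j k) * y j) * y k" for y
  proof -
    have row: "(\<Sum>j<n. W i j * y i * y j) = W i k * y i * y k + (\<Sum>j\<in>{..<n} - {k}. W i j * y i * y j)" for i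
      using assms(2) by (subst sum.remove[of _ k]) auto
    have "quad_form n W y = (\<Sum>j<n. W k j * y k * y j) + (\<Sum>i\<in>{..<n} - {k}. \<Sum>j<n. W i j * y i * y j)"
      unfolding quad_form_def using assms(2) by (subst sum.remove[of _ k]) auto
    also have "\<dots> = (W k k * y k * y k + (\<Sum>j\<in>{..<n} - {k}. W k j * y k * y j)) +
      ((\<Sum>i\<in>{..<n} - {k}. W i k * y i * y k) + (\<Sum>i\<in>{..<n} - {k}. \<Sum>j\<in>{..<n} - {k}. W i j * y i * y j))"
      by (simp only: row sum.distrib)
    finally show ?thesis
      using assms(1)[OF assms(2)]
      by (simp add: sum.distrib sum_distrib_left distrib_left distrib_right mult_ac)
  qed
  have "(\<Sum>i\<in>{..<n} - {k}. \<Sum>j\<in>{..<n} - {k}. W i j * (x(k := s)) i * (x(k := s)) j) =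
     (\<Sum>i\<in>{..<n} - {k}. \<Sum>j\<in>{..<n} - {k}. W i j * x i * x j)" for s
    by (intro sum.cong) auto
  moreover have "(\<Sum>j\<in>{..<n} - {k}. (W k j + W j k) * (x(k := s)) j) = (\<Sum>j\<in>{..<n} - {k}. (W k j + W j k) * x j)" for s
    by (intro sum.cong) auto
  ultimately show ?thesis
    by (simp add: split[of "x(k := _)"])
qed

text \<open>With zero diagonal the quadratic form is affine in each coordinate, so every coordinate can be
  moved to one of the two neighbouring integers without decreasing the form.\<close>

lemma quad_form_round:
  assumes "\<And>i. i < n \<Longrightarrow> W i i = 0"
  shows "\<exists>z :: nat \<Rightarrow> int. (\<forall>i<n. z i = \<lfloor>x i\<rfloor> \<or> z i = \<lceil>x i\<rceil>) \<and> (\<forall>i\<ge>n. z i = 0) \<and>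
    quad_form n W x \<le> quad_form n W (\<lambda>i. of_int (z i))"
proof -
  \<comment> \<open>Coordinates are rounded one at a time. The invariant keeps those from
    \<open>k\<close> on equal to \<open>x\<close>, so the integers next to \<open>z k\<close> are
    those next to \<open>x k\<close>.\<close>
  have "\<exists>z. (\<forall>i<k. z i = of_int \<lfloor>x i\<rfloor> \<or> z i = of_int \<lceil>x i\<rceil>) \<and> (\<forall>i\<ge>k. z i = x i) \<and>
    quad_form n W x \<le> quad_form n W z" if "k \<le> n" for k
    using that
  proof (induction k)
    case 0
    then show ?case by (intro exI[of _ x]) auto
  next
    case (Suc k)
    then obtain z where z: "\<forall>i<k. z i = of_int \<lfloor>x i\<rfloor> \<or> z i = of_int \<lceil>x i\<rceil>" "\<forall>i\<ge>k. z i = x i"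
      "quad_form n W x \<le> quad_form n W z" by auto
    define a b where "a = quad_form n W (z(k := 0))"
      and "b = (\<Sum>j\<in>{..<n} - {k}. (W k j + W j k) * z j)"
    have *: "quad_form n W (z(k := s)) = a + b * s" for s
      unfolding a_def b_def by (rule quad_form_affine) (use assms Suc.prems in auto)
    obtain s where s: "s = of_int \<lfloor>z k\<rfloor> \<or> s = of_int \<lceil>z k\<rceil>"
      "quad_form n W (z(k := z k)) \<le> quad_form n W (z(k := s))"
      using affine_le_floor_or_ceiling[of a b "z k"] unfolding * by metis
    have "quad_form n W x \<le> quad_form n W (z(k := s))"
      using z(3) s(2) by (simp only: fun_upd_triv)
    then show ?case
    proof (intro exI[of _ "z(k := s)"] conjI)
      show "\<forall>i<Suc k. (z(k := s)) i = of_int \<lfloor>x i\<rfloor> \<or> (z(k := s)) i = of_int \<lceil>x i\<rceil>"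
        using z(1,2) s(1) by (auto simp: less_Suc_eq)
      show "\<forall>i\<ge>Suc k. (z(k := s)) i = x i" using z(2) by auto
    qed
  qed
  from this[of n] obtain z where z: "\<forall>i<n. z i = of_int \<lfloor>x i\<rfloor> \<or> z i = of_int \<lceil>x i\<rceil>"
    "quad_form n W x \<le> quad_form n W z" by auto
  \<comment> \<open>The values of \<open>z\<close> below \<open>n\<close> are already integers, so
    the floor only changes their type. The value 0 from \<open>n\<close> on is what
    \<open>lattice_ball\<close> asks for.\<close>
  define z' where "z' i = (if i < n then \<lfloor>z i\<rfloor> else 0)" for i
  have z': "of_int (z' i) = z i" if "i < n" for i using z(1) that by (auto simp: z'_def)
  have "quad_form n W z = quad_form n W (\<lambda>i. of_int (z' i))"
    unfolding quad_form_def by (intro sum.cong) (auto simp: z')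
  moreover have "\<forall>i<n. z' i = \<lfloor>x i\<rfloor> \<or> z' i = \<lceil>x i\<rceil>"
    using z(1) by (auto simp: z'_def)
  ultimately show ?thesis using z(2) by (intro exI[of _ z']) (auto simp: z'_def)
qed

lemma quad_form_scale: "quad_form n W (\<lambda>i. c * x i) = c\<^sup>2 * quad_form n W x"
  by (simp add: quad_form_def sum_distrib_left power2_eq_square algebra_simps)

text \<open>The radius is what remains after rounding a vector of squared norm \<open>n\<close>;
  vanishing from \<open>n\<close> on makes the set finite.\<close>

definition lattice_ball :: "nat \<Rightarrow> (nat \<Rightarrow> int) set" where
  "lattice_ball n = {z. (\<forall>i\<ge>n. z i = 0) \<and> (\<Sum>i<n. (z i)\<^sup>2) \<le> 4 * int n}"

lemma floor_ceiling_sq_le: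
  fixes x :: real
  assumes "z = \<lfloor>x\<rfloor> \<or> z = \<lceil>x\<rceil>"
  shows "(of_int z)\<^sup>2 \<le> 2 * x\<^sup>2 + (2::real)"
proof -
  have "\<bar>of_int z\<bar> \<le> \<bar>x\<bar> + 1" using assms by linarith
  then have "(of_int z)\<^sup>2 \<le> (\<bar>x\<bar> + 1)\<^sup>2" by (metis abs_ge_zero power2_abs power_mono)
  also have "\<dots> \<le> 2 * x\<^sup>2 + 2"
    using zero_le_power2[of "\<bar>x\<bar> - 1"] by (simp add: power2_eq_square algebra_simps)
  finally show ?thesis .
qed

text \<open>Both sides are homogeneous of degree 2, so \<open>x\<close> may be scaled to squared
  norm \<open>n\<close>. Rounding to a neighbouring integer point does not decrease the form and
  gives squared norm at most \<open>2 * n + 2 * n\<close>.\<close>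

lemma quad_form_le_of_lattice:
  fixes x :: "nat \<Rightarrow> real"
  assumes diag: "\<And>i. i < n \<Longrightarrow> W i i = 0"
    and lattice: "\<And>z. z \<in> lattice_ball n \<Longrightarrow> quad_form n W (\<lambda>i. of_int (z i)) \<le> K * real n"
  shows "quad_form n W x \<le> K * (\<Sum>i<n. (x i)\<^sup>2)"
proof (cases "(\<Sum>i<n. (x i)\<^sup>2) = 0")
  case True
  then have "x i = 0" if "i < n" for i
    using that by (subst (asm) sum_nonneg_eq_0_iff) auto
  then show ?thesis using True by (simp add: quad_form_def)
next
  case False
  define S where "S = (\<Sum>i<n. (x i)\<^sup>2)"
  have S: "S > 0" using False unfolding S_def by (metis less_eq_real_def sum_nonneg zero_le_power2)
  then have n: "real n > 0" by (auto simp: S_def intro!: gr0I)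
  define c where "c = sqrt (real n / S)"
  have c2: "c\<^sup>2 = real n / S" using S n by (simp add: c_def)
  obtain z :: "nat \<Rightarrow> int" where z: "\<forall>i<n. z i = \<lfloor>c * x i\<rfloor> \<or> z i = \<lceil>c * x i\<rceil>" "\<forall>i\<ge>n. z i = 0"
    "quad_form n W (\<lambda>i. c * x i) \<le> quad_form n W (\<lambda>i. of_int (z i))"
    using quad_form_round[of n W "\<lambda>i. c * x i"] diag by blast
  have "(\<Sum>i<n. (of_int (z i))\<^sup>2) \<le> (\<Sum>i<n. 2 * (c * x i)\<^sup>2 + (2::real))"
    using z(1) by (intro sum_mono floor_ceiling_sq_le) auto
  also have "\<dots> = 2 * (c\<^sup>2 * S) + 2 * real n"
    by (simp add: sum.distrib sum_distrib_left S_def power_mult_distrib)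
  also have "\<dots> = 4 * real n" using S by (simp add: c2)
  finally have "real_of_int (\<Sum>i<n. (z i)\<^sup>2) \<le> real_of_int (4 * int n)" by simp
  then have "z \<in> lattice_ball n" using z(2) unfolding lattice_ball_def by (simp only: of_int_le_iff) simp
  from lattice[OF this] z(3) have "c\<^sup>2 * quad_form n W x \<le> K * real n"
    by (simp add: quad_form_scale)
  then show ?thesis using S n unfolding c2 S_def[symmetric] by (simp add: field_simps)
qed

lemma sum_half_power_abs: "(\<Sum>j\<in>{- int N..int N}. (1/2::real) ^ nat \<bar>j\<bar>) \<le> 3"
proof -
  have "(\<Sum>j\<in>{- int N..int N}. (1/2::real) ^ nat \<bar>j\<bar>) = 3 - 2 * (1/2) ^ N"
  proof (induction N)
    case (Suc N)
    have "{- int (Suc N)..int (Suc N)} = insert (- int (Suc N)) (insert (int (Suc N)) {- int N..int N})"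
      by auto
    then show ?case using Suc by (simp add: nat_add_distrib)
  qed simp
  then show ?thesis by simp
qed

lemma int_abs_le_square: "\<bar>z\<bar> \<le> (z::int)\<^sup>2"
proof (cases "z = 0")
  case False
  then have "\<bar>z\<bar> * 1 \<le> \<bar>z\<bar> * \<bar>z\<bar>" by (intro mult_left_mono) auto
  then show ?thesis by (simp add: power2_eq_square abs_mult_self_eq)
qed simp

text \<open>Each point of the ball has weight at least \<open>2\<^sup>-\<^sup>4\<^sup>n\<close> under the product weight
  \<open>\<Prod>i. 2\<^sup>-\<^sup>|\<^sup>z\<^sup>i\<^sup>|\<close>, whose total mass is at most \<open>3\<^sup>n\<close>.\<close>

lemma lattice_ball_card: "finite (lattice_ball n)" "real (card (lattice_ball n)) \<le> 48 ^ n"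
proof -
  let ?B = "{- int (4 * n)..int (4 * n)}"
  \<comment> \<open>\<open>PiE\<close> consists of functions that are \<open>undefined\<close> off
    the index set, whereas lattice points are 0 there; \<open>restrict\<close> translates.\<close>
  let ?r = "\<lambda>z :: nat \<Rightarrow> int. restrict z {..<n}"
  have abs_le: "(\<Sum>i<n. \<bar>z i\<bar>) \<le> 4 * int n" if "z \<in> lattice_ball n" for z
  proof -
    have "(\<Sum>i<n. \<bar>z i\<bar>) \<le> (\<Sum>i<n. (z i)\<^sup>2)" by (intro sum_mono int_abs_le_square)
    then show ?thesis using that by (simp add: lattice_ball_def)
  qed
  have sub: "?r ` lattice_ball n \<subseteq> PiE {..<n} (\<lambda>_. ?B)"
  proof clarify
    fix z assume z: "z \<in> lattice_ball n"
    have "\<bar>z i\<bar> \<le> 4 * int n" if "i < n" for i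
      using abs_le[OF z] member_le_sum[of i "{..<n}" "\<lambda>i. \<bar>z i\<bar>"] that by simp
    then show "?r z \<in> PiE {..<n} (\<lambda>_. ?B)" by (force simp: abs_le_iff)
  qed
  have inj: "inj_on ?r (lattice_ball n)"
  proof (rule inj_onI, rule ext)
    fix z z' i assume a: "z \<in> lattice_ball n" "z' \<in> lattice_ball n" "?r z = ?r z'"
    show "z i = z' i"
      using a(1,2) fun_cong[OF a(3), of i] by (cases "i < n") (auto simp: lattice_ball_def restrict_apply')
  qed
  have finP: "finite (PiE {..<n} (\<lambda>_. ?B))" by (intro finite_PiE) auto
  have "finite (?r ` lattice_ball n)" by (rule finite_subset[OF sub finP])
  then show fin: "finite (lattice_ball n)" using inj by (rule finite_imageD)
  have "real (card (lattice_ball n)) * (1/2) ^ (4 * n) = (\<Sum>z\<in>lattice_ball n. (1/2) ^ (4 * n))"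
    by simp
  also have "\<dots> \<le> (\<Sum>z\<in>lattice_ball n. \<Prod>i<n. (1/2) ^ nat \<bar>?r z i\<bar>)"
  proof (rule sum_mono)
    fix z assume z: "z \<in> lattice_ball n"
    have "int (\<Sum>i<n. nat \<bar>z i\<bar>) \<le> int (4 * n)" using abs_le[OF z] by simp
    then have le: "(\<Sum>i<n. nat \<bar>z i\<bar>) \<le> 4 * n" by (simp only: of_nat_le_iff)
    have "(1/2::real) ^ (4 * n) \<le> (1/2) ^ (\<Sum>i<n. nat \<bar>z i\<bar>)"
      by (rule power_decreasing[OF le]) auto
    also have "\<dots> = (\<Prod>i<n. (1/2) ^ nat \<bar>?r z i\<bar>)" by (simp add: power_sum)
    finally show "(1/2::real) ^ (4 * n) \<le> (\<Prod>i<n. (1/2) ^ nat \<bar>?r z i\<bar>)" .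
  qed
  also have "\<dots> = (\<Sum>g\<in>?r ` lattice_ball n. \<Prod>i<n. (1/2) ^ nat \<bar>g i\<bar>)"
    by (simp add: sum.reindex[OF inj])
  also have "\<dots> \<le> (\<Sum>g\<in>PiE {..<n} (\<lambda>_. ?B). \<Prod>i<n. (1/2) ^ nat \<bar>g i\<bar>)"
    by (intro sum_mono2 finP sub prod_nonneg) auto
  also have "\<dots> = (\<Prod>i<n. \<Sum>j\<in>?B. (1/2::real) ^ nat \<bar>j\<bar>)"
    by (subst prod_sum_PiE) auto
  also have "\<dots> \<le> (\<Prod>i<n. 3)"
    by (intro prod_mono conjI sum_half_power_abs sum_nonneg) auto
  finally have "real (card (lattice_ball n)) * (1/2) ^ (4 * n) \<le> 3 ^ n" by simp
  then have "real (card (lattice_ball n)) \<le> 3 ^ n * 2 ^ (4 * n)" by (simp add: power_one_over field_simps)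
  also have "\<dots> = 48 ^ n" by (simp add: power_mult power_mult_distrib[symmetric])
  finally show "real (card (lattice_ball n)) \<le> 48 ^ n" .
qed

section \<open>Light and heavy pairs\<close>

text \<open>Peeling off the index of least weight is a discrete layer-cake summation over the level sets
  of \<open>w\<close>.\<close>

lemma sum_min_le_of_sparse:
  fixes g :: "'a \<Rightarrow> 'a \<Rightarrow> real"
  assumes "finite U" "\<And>i. i \<in> U \<Longrightarrow> w i \<ge> 0"
    and "\<And>V. V \<subseteq> U \<Longrightarrow> (\<Sum>i\<in>V. \<Sum>j\<in>V. g i j) \<le> K * real (card V)"
  shows "(\<Sum>i\<in>U. \<Sum>j\<in>U. g i j * min (w i) (w j)) \<le> K * (\<Sum>i\<in>U. w i)"
  using assms
proof (induction "card U" arbitrary: U w)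
  case 0
  then show ?case by simp
next
  case (Suc m)
  then have "U \<noteq> {}" by auto
  then obtain a where a: "a \<in> U" "\<And>i. i \<in> U \<Longrightarrow> w a \<le> w i"
    using ex_min_if_finite[of "w ` U"] Suc.prems(1) by (auto simp: not_less)
  define w' where "w' i = w i - w a" for i
  have w'a: "w' a = 0" by (simp add: w'_def)
  have w'nn: "w' i \<ge> 0" if "i \<in> U" for i using a(2)[OF that] by (simp add: w'_def)
  have min0: "min (w' i) (w' a) = 0" "min (w' a) (w' i) = 0" if "i \<in> U" for i
    using w'nn[OF that] w'a by auto
  \<comment> \<open>The constant layer \<open>w a\<close> is charged to the hypothesis for
    \<open>U\<close> itself. In the remainder \<open>a\<close> has weight 0 and drops out, which
    leaves the induction hypothesis for \<open>U - {a}\<close>.\<close>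
  have "(\<Sum>i\<in>U. \<Sum>j\<in>U. g i j * min (w i) (w j)) =
      (\<Sum>i\<in>U. \<Sum>j\<in>U. w a * g i j + g i j * min (w' i) (w' j))"
  proof (intro sum.cong refl)
    fix i j
    have "min (w i) (w j) = w a + min (w' i) (w' j)" by (simp add: w'_def min_def)
    then show "g i j * min (w i) (w j) = w a * g i j + g i j * min (w' i) (w' j)"
      by (simp add: algebra_simps)
  qed
  also have "\<dots> = w a * (\<Sum>i\<in>U. \<Sum>j\<in>U. g i j) + (\<Sum>i\<in>U. \<Sum>j\<in>U. g i j * min (w' i) (w' j))"
    by (simp add: sum.distrib sum_distrib_left)
  also have "(\<Sum>i\<in>U. \<Sum>j\<in>U. g i j * min (w' i) (w' j)) =
      (\<Sum>i\<in>U - {a}. \<Sum>j\<in>U - {a}. g i j * min (w' i) (w' j))"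
  proof -
    have "(\<Sum>j\<in>U. g i j * min (w' i) (w' j)) = (\<Sum>j\<in>U - {a}. g i j * min (w' i) (w' j))"
      if "i \<in> U" for i
      by (rule sum.mono_neutral_right) (use Suc.prems(1) min0(1)[OF that] in auto)
    then have "(\<Sum>i\<in>U. \<Sum>j\<in>U. g i j * min (w' i) (w' j)) = (\<Sum>i\<in>U. \<Sum>j\<in>U - {a}. g i j * min (w' i) (w' j))"
      by (rule sum.cong[OF refl])
    also have "\<dots> = (\<Sum>i\<in>U - {a}. \<Sum>j\<in>U - {a}. g i j * min (w' i) (w' j))"
      by (rule sum.mono_neutral_right)
        (use Suc.prems(1) min0(2) a in \<open>auto intro!: sum.neutral\<close>)
    finally show ?thesis .
  qed
  also have "\<dots> \<le> K * (\<Sum>i\<in>U - {a}. w' i)"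
  proof (rule Suc.hyps(1))
    show "m = card (U - {a})" using Suc.hyps(2) a(1) Suc.prems(1) by simp
    show "finite (U - {a})" using Suc.prems(1) by simp
    show "w' i \<ge> 0" if "i \<in> U - {a}" for i using w'nn that by auto
    show "(\<Sum>i\<in>V. \<Sum>j\<in>V. g i j) \<le> K * real (card V)" if "V \<subseteq> U - {a}" for V
      using Suc.prems(3)[of V] that by auto
  qed
  also have "(\<Sum>i\<in>U - {a}. w' i) = (\<Sum>i\<in>U. w' i)"
    by (rule sum.mono_neutral_left) (use Suc.prems(1) w'a in auto)
  also have "w a * (\<Sum>i\<in>U. \<Sum>j\<in>U. g i j) \<le> w a * (K * real (card U))"
    using Suc.prems(2,3) a(1) by (intro mult_left_mono) auto
  also have "w a * (K * real (card U)) + K * (\<Sum>i\<in>U. w' i) = K * (\<Sum>i\<in>U. w i)"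
    by (simp add: w'_def sum_subtractf algebra_simps)
  finally show ?case by simp
qed

text \<open>If one coordinate is at most \<epsilon> times the other, the product is at most
  \<epsilon> times the larger square. Otherwise each square is at least
  \<open>\<epsilon> * \<bar>a * b\<bar>\<close>, so both exceed \<open>\<epsilon> * \<theta>\<close>
  and the product is controlled by the smaller of the two.\<close>

lemma heavy_pair_bound:
  fixes a b :: real
  assumes "\<theta> > 0" "\<epsilon> > 0" and heavy: "\<bar>a * b\<bar> > \<theta>"
  shows "\<bar>a * b\<bar> \<le> \<epsilon> * a\<^sup>2 + \<epsilon> * b\<^sup>2 +
    (if a\<^sup>2 \<ge> \<epsilon> * \<theta> \<and> b\<^sup>2 \<ge> \<epsilon> * \<theta> then min (a\<^sup>2) (b\<^sup>2) / \<epsilon> else 0)"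
proof -
  have small: "\<bar>x * y\<bar> \<le> \<epsilon> * y\<^sup>2" if "\<bar>x\<bar> \<le> \<epsilon> * \<bar>y\<bar>" for x y :: real
    using mult_right_mono[OF that, of "\<bar>y\<bar>"] by (simp add: abs_mult power2_eq_square)
  have big: "x\<^sup>2 \<ge> \<epsilon> * \<bar>x * y\<bar>" if "\<bar>x\<bar> > \<epsilon> * \<bar>y\<bar>" for x y :: real
    using mult_left_mono[of "\<epsilon> * \<bar>y\<bar>" "\<bar>x\<bar>" "\<bar>x\<bar>"] that
    by (simp add: abs_mult power2_eq_square mult_ac)
  have nn: "(if a\<^sup>2 \<ge> \<epsilon> * \<theta> \<and> b\<^sup>2 \<ge> \<epsilon> * \<theta> then min (a\<^sup>2) (b\<^sup>2) / \<epsilon> else 0) \<ge> 0"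
    "\<epsilon> * a\<^sup>2 \<ge> 0" "\<epsilon> * b\<^sup>2 \<ge> 0"
    using assms by auto
  consider "\<bar>a\<bar> \<le> \<epsilon> * \<bar>b\<bar>" | "\<bar>b\<bar> \<le> \<epsilon> * \<bar>a\<bar>" | "\<bar>a\<bar> > \<epsilon> * \<bar>b\<bar>" "\<bar>b\<bar> > \<epsilon> * \<bar>a\<bar>"
    by linarith
  then show ?thesis
  proof cases
    case 1
    then show ?thesis using small[of a b] nn by linarith
  next
    case 2
    then show ?thesis using small[of b a] nn by (simp add: mult.commute[of b a])
  next
    case 3
    have ab: "a\<^sup>2 \<ge> \<epsilon> * \<bar>a * b\<bar>" "b\<^sup>2 \<ge> \<epsilon> * \<bar>a * b\<bar>"
      using big[OF 3(1)] big[OF 3(2)] by (simp_all add: mult.commute[of b a])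
    have "\<epsilon> * \<theta> \<le> \<epsilon> * \<bar>a * b\<bar>" using assms by simp
    then have "a\<^sup>2 \<ge> \<epsilon> * \<theta> \<and> b\<^sup>2 \<ge> \<epsilon> * \<theta>" using ab by linarith
    moreover have "\<bar>a * b\<bar> \<le> min (a\<^sup>2) (b\<^sup>2) / \<epsilon>" using ab assms by (simp add: field_simps)
    ultimately show ?thesis using nn by simp
  qed
qed

text \<open>Pairs of very different coordinates are paid for by the degrees, since a row sum bounds
  the total weight attached to one square. Comparable pairs live on the set \<open>H\<close>, which
  is small because its members have large squares; there the sparsity hypothesis applies to every
  subset, and \<open>sum_min_le_of_sparse\<close> combines these bounds.\<close>

lemma heavy_sum_le:
  fixes g :: "nat \<Rightarrow> nat \<Rightarrow> real" and z :: "nat \<Rightarrow> real"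
  assumes gnn: "\<And>i j. i < n \<Longrightarrow> j < n \<Longrightarrow> g i j \<ge> 0"
    and sym: "\<And>i j. i < n \<Longrightarrow> j < n \<Longrightarrow> g i j = g j i"
    and deg: "\<And>i. i < n \<Longrightarrow> (\<Sum>j<n. g i j) \<le> \<Delta>"
    and pos: "\<theta> > 0" "\<epsilon> > 0" "K \<ge> 0" "\<Delta> \<ge> 0"
    and zS: "(\<Sum>i<n. (z i)\<^sup>2) \<le> S"
    and sparse: "\<And>U. U \<subseteq> {..<n} \<Longrightarrow> real (card U) * (\<epsilon> * \<theta>) \<le> S \<Longrightarrow>
      (\<Sum>i\<in>U. \<Sum>j\<in>U. g i j) \<le> K * real (card U)"
  shows "(\<Sum>i<n. \<Sum>j<n. if \<bar>z i * z j\<bar> > \<theta> then g i j * \<bar>z i * z j\<bar> else 0) \<le>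
    (2 * \<epsilon> * \<Delta> + K / \<epsilon>) * S"
proof -
  define H where "H = {i. i < n \<and> (z i)\<^sup>2 \<ge> \<epsilon> * \<theta>}"
  have H: "H \<subseteq> {..<n}" "finite H" by (auto simp: H_def)
  have cardH: "real (card H) * (\<epsilon> * \<theta>) \<le> S"
  proof -
    have "real (card H) * (\<epsilon> * \<theta>) = (\<Sum>i\<in>H. \<epsilon> * \<theta>)" by simp
    also have "\<dots> \<le> (\<Sum>i\<in>H. (z i)\<^sup>2)" by (intro sum_mono) (auto simp: H_def)
    also have "\<dots> \<le> (\<Sum>i<n. (z i)\<^sup>2)" by (intro sum_mono2) (use H in auto)
    finally show ?thesis using zS by simp
  qed
  define h where "h i j = (if i \<in> H \<and> j \<in> H then g i j * min ((z i)\<^sup>2) ((z j)\<^sup>2) else 0)" for i j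
  have "(\<Sum>i<n. \<Sum>j<n. if \<bar>z i * z j\<bar> > \<theta> then g i j * \<bar>z i * z j\<bar> else 0) \<le>
     (\<Sum>i<n. \<Sum>j<n. \<epsilon> * (g i j * (z i)\<^sup>2) + \<epsilon> * (g i j * (z j)\<^sup>2) + h i j / \<epsilon>)"
  proof (intro sum_mono)
    fix i j assume ij: "i \<in> {..<n}" "j \<in> {..<n}"
    have hnn: "h i j \<ge> 0" using gnn ij by (auto simp: h_def)
    show "(if \<bar>z i * z j\<bar> > \<theta> then g i j * \<bar>z i * z j\<bar> else 0) \<le>
        \<epsilon> * (g i j * (z i)\<^sup>2) + \<epsilon> * (g i j * (z j)\<^sup>2) + h i j / \<epsilon>"
    proof (cases "\<bar>z i * z j\<bar> > \<theta>")
      case True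
      have "g i j * \<bar>z i * z j\<bar> \<le> g i j * (\<epsilon> * (z i)\<^sup>2 + \<epsilon> * (z j)\<^sup>2 +
        (if (z i)\<^sup>2 \<ge> \<epsilon> * \<theta> \<and> (z j)\<^sup>2 \<ge> \<epsilon> * \<theta> then min ((z i)\<^sup>2) ((z j)\<^sup>2) / \<epsilon> else 0))"
        by (intro mult_left_mono heavy_pair_bound pos True) (use gnn ij in auto)
      also have "\<dots> = \<epsilon> * (g i j * (z i)\<^sup>2) + \<epsilon> * (g i j * (z j)\<^sup>2) + h i j / \<epsilon>"
        using ij by (simp add: h_def H_def algebra_simps)
      finally show ?thesis using True by simp
    next
      case False
      then show ?thesis using hnn gnn[of i j] ij pos by simp
    qed
  qed
  also have "\<dots> = \<epsilon> * (\<Sum>i<n. \<Sum>j<n. g i j * (z i)\<^sup>2) + \<epsilon> * (\<Sum>i<n. \<Sum>j<n. g i j * (z j)\<^sup>2) + (\<Sum>i<n. \<Sum>j<n. h i j) / \<epsilon>"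
    by (simp add: sum.distrib sum_distrib_left sum_divide_distrib)
  also have "(\<Sum>i<n. \<Sum>j<n. g i j * (z j)\<^sup>2) = (\<Sum>i<n. \<Sum>j<n. g i j * (z i)\<^sup>2)"
    by (subst sum.swap) (intro sum.cong refl, use sym in auto)
  also have "(\<Sum>i<n. \<Sum>j<n. h i j) = (\<Sum>i\<in>H. \<Sum>j\<in>H. g i j * min ((z i)\<^sup>2) ((z j)\<^sup>2))"
  proof -
    have "(\<Sum>j<n. h i j) = (\<Sum>j\<in>H. h i j)" for i
      by (rule sum.mono_neutral_right) (use H in \<open>auto simp: h_def\<close>)
    then have "(\<Sum>i<n. \<Sum>j<n. h i j) = (\<Sum>i<n. \<Sum>j\<in>H. h i j)" by simp
    also have "\<dots> = (\<Sum>i\<in>H. \<Sum>j\<in>H. h i j)"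
      by (rule sum.mono_neutral_right) (use H in \<open>auto simp: h_def\<close>)
    also have "\<dots> = (\<Sum>i\<in>H. \<Sum>j\<in>H. g i j * min ((z i)\<^sup>2) ((z j)\<^sup>2))"
      by (intro sum.cong refl) (auto simp: h_def)
    finally show ?thesis .
  qed
  also have "\<dots> \<le> K * (\<Sum>i\<in>H. (z i)\<^sup>2)"
  proof (rule sum_min_le_of_sparse[OF H(2)])
    fix V assume V: "V \<subseteq> H"
    have "real (card V) \<le> real (card H)" using card_mono[OF H(2) V] by simp
    then have "real (card V) * (\<epsilon> * \<theta>) \<le> S"
      using order_trans[OF mult_right_mono[of "real (card V)" "real (card H)" "\<epsilon> * \<theta>"] cardH] pos by simp
    then show "(\<Sum>i\<in>V. \<Sum>j\<in>V. g i j) \<le> K * real (card V)" using sparse V H(1) by blast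
  qed auto
  also have "\<dots> \<le> K * S"
  proof (intro mult_left_mono pos)
    show "(\<Sum>i\<in>H. (z i)\<^sup>2) \<le> S"
      using zS sum_mono2[of "{..<n}" H "\<lambda>i. (z i)\<^sup>2"] H by simp
  qed
  also have "(\<Sum>i<n. \<Sum>j<n. g i j * (z i)\<^sup>2) \<le> \<Delta> * S"
  proof -
    have "(\<Sum>i<n. \<Sum>j<n. g i j * (z i)\<^sup>2) = (\<Sum>i<n. (\<Sum>j<n. g i j) * (z i)\<^sup>2)"
      by (simp add: sum_distrib_right)
    also have "\<dots> \<le> (\<Sum>i<n. \<Delta> * (z i)\<^sup>2)" by (intro sum_mono mult_right_mono deg) auto
    also have "\<dots> \<le> \<Delta> * S" using zS pos by (simp add: sum_distrib_left[symmetric] mult_left_mono)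
    finally show ?thesis .
  qed
  finally show ?thesis using pos by (simp add: field_simps divide_right_mono)
qed

text \<open>On heavy pairs the mean needs no cancellation:
  \<open>\<bar>z i * z j\<bar> > \<theta>\<close> gives
  \<open>\<bar>z i * z j\<bar> \<le> (z i * z j)^2 / \<theta>\<close>, which sums to
  \<open>S^2 / \<theta>\<close>. In the application \<open>e0\<close> is of order
  \<open>ln n / n\<close>, \<theta> of order \<open>ln n\<close> and \<open>S\<close> of order
  \<open>n\<close>, so the last term is only of order \<open>n\<close>.\<close>

lemma quad_form_le_light_heavy:
  fixes g E :: "nat \<Rightarrow> nat \<Rightarrow> real" and z :: "nat \<Rightarrow> real"
  assumes gnn: "\<And>i j. i < n \<Longrightarrow> j < n \<Longrightarrow> g i j \<ge> 0"
    and sym: "\<And>i j. i < n \<Longrightarrow> j < n \<Longrightarrow> g i j = g j i"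
    and deg: "\<And>i. i < n \<Longrightarrow> (\<Sum>j<n. g i j) \<le> \<Delta>"
    and E: "\<And>i j. i < n \<Longrightarrow> j < n \<Longrightarrow> 0 \<le> E i j \<and> E i j \<le> e0"
    and pos: "\<theta> > 0" "\<epsilon> > 0" "K \<ge> 0" "\<Delta> \<ge> 0" "e0 \<ge> 0"
    and zS: "(\<Sum>i<n. (z i)\<^sup>2) \<le> S"
    and sparse: "\<And>U. U \<subseteq> {..<n} \<Longrightarrow> real (card U) * (\<epsilon> * \<theta>) \<le> S \<Longrightarrow>
      (\<Sum>i\<in>U. \<Sum>j\<in>U. g i j) \<le> K * real (card U)"
    and light: "(\<Sum>i<n. \<Sum>j<n. if \<bar>z i * z j\<bar> \<le> \<theta> then (g i j - E i j) * z i * z j else 0) \<le> R"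
  shows "quad_form n (\<lambda>i j. g i j - E i j) z \<le> R + (2 * \<epsilon> * \<Delta> + K / \<epsilon>) * S + e0 / \<theta> * S\<^sup>2"
proof -
  have "quad_form n (\<lambda>i j. g i j - E i j) z \<le>
    (\<Sum>i<n. \<Sum>j<n. (if \<bar>z i * z j\<bar> \<le> \<theta> then (g i j - E i j) * z i * z j else 0) +
      (if \<bar>z i * z j\<bar> > \<theta> then g i j * \<bar>z i * z j\<bar> else 0) + e0 / \<theta> * ((z i)\<^sup>2 * (z j)\<^sup>2))"
    unfolding quad_form_def
  proof (intro sum_mono)
    fix i j assume ij: "i \<in> {..<n}" "j \<in> {..<n}"
    show "(g i j - E i j) * z i * z j \<le>
      (if \<bar>z i * z j\<bar> \<le> \<theta> then (g i j - E i j) * z i * z j else 0) +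
      (if \<bar>z i * z j\<bar> > \<theta> then g i j * \<bar>z i * z j\<bar> else 0) + e0 / \<theta> * ((z i)\<^sup>2 * (z j)\<^sup>2)"
    proof (cases "\<bar>z i * z j\<bar> > \<theta>")
      case True
      have "(g i j - E i j) * z i * z j \<le> g i j * \<bar>z i * z j\<bar> + E i j * \<bar>z i * z j\<bar>"
      proof -
        have "g i j * (z i * z j) \<le> g i j * \<bar>z i * z j\<bar>" using gnn ij by (intro mult_left_mono) auto
        moreover have "E i j * (- (z i * z j)) \<le> E i j * \<bar>z i * z j\<bar>" using E ij by (intro mult_left_mono) auto
        ultimately show ?thesis by (simp add: algebra_simps)
      qed
      also have "E i j * \<bar>z i * z j\<bar> \<le> e0 * (\<bar>z i * z j\<bar> * \<bar>z i * z j\<bar> / \<theta>)"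
      proof (rule mult_mono)
        show "\<bar>z i * z j\<bar> \<le> \<bar>z i * z j\<bar> * \<bar>z i * z j\<bar> / \<theta>"
          using True pos mult_left_mono[of \<theta> "\<bar>z i * z j\<bar>" "\<bar>z i * z j\<bar>"] by (simp add: field_simps)
      qed (use E ij pos in auto)
      also have "e0 * (\<bar>z i * z j\<bar> * \<bar>z i * z j\<bar> / \<theta>) = e0 / \<theta> * ((z i)\<^sup>2 * (z j)\<^sup>2)"
        by (simp add: power2_eq_square mult_ac)
      finally show ?thesis using True by simp
    next
      case False
      then show ?thesis using pos by simp
    qed
  qed
  also have "\<dots> = (\<Sum>i<n. \<Sum>j<n. if \<bar>z i * z j\<bar> \<le> \<theta> then (g i j - E i j) * z i * z j else 0) +
     (\<Sum>i<n. \<Sum>j<n. if \<bar>z i * z j\<bar> > \<theta> then g i j * \<bar>z i * z j\<bar> else 0) + e0 / \<theta> * (\<Sum>i<n. (z i)\<^sup>2)\<^sup>2"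
  proof -
    have "e0 / \<theta> * (\<Sum>i<n. (z i)\<^sup>2)\<^sup>2 = (\<Sum>i<n. \<Sum>j<n. e0 / \<theta> * ((z i)\<^sup>2 * (z j)\<^sup>2))"
      by (subst power2_eq_square, subst sum_product) (simp only: sum_distrib_left)
    then show ?thesis by (simp only: sum.distrib)
  qed
  also have "\<dots> \<le> R + (2 * \<epsilon> * \<Delta> + K / \<epsilon>) * S + e0 / \<theta> * S\<^sup>2"
  proof (intro add_mono light mult_left_mono power_mono)
    show "(\<Sum>i<n. \<Sum>j<n. if \<bar>z i * z j\<bar> > \<theta> then g i j * \<bar>z i * z j\<bar> else 0) \<le> (2 * \<epsilon> * \<Delta> + K / \<epsilon>) * S"
      by (rule heavy_sum_le) (use assms in auto)
  qed (use zS pos in \<open>auto intro: sum_nonneg\<close>)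
  finally show ?thesis .
qed

section \<open>Optimality certificate for the semidefinite program\<close>

text \<open>On the vector with entry \<open>s\<close> at \<open>a\<close> and 1 at \<open>b\<close>
  the form is affine in \<open>s\<close> with slope \<open>2 * Z a b\<close>. An affine function
  that is bounded below has slope 0.\<close>

lemma psd_zero_diag_imp_zero_row:
  fixes Z :: "'a \<Rightarrow> 'a \<Rightarrow> real"
  assumes fin: "finite S" and ab: "a \<in> S" "b \<in> S"
    and sym: "\<And>i j. i \<in> S \<Longrightarrow> j \<in> S \<Longrightarrow> Z i j = Z j i"
    and psd: "\<And>x. (\<Sum>i\<in>S. \<Sum>j\<in>S. x i * x j * Z i j) \<ge> 0"
    and zero: "Z a a = 0"
  shows "Z a b = 0"
proof (cases "a = b")
  case False
  have *: "(\<Sum>i\<in>S. \<Sum>j\<in>S. x i * x j * Z i j) =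
     2 * s * Z a b + Z b b" if "x = (\<lambda>i. if i = a then s else if i = b then 1 else 0)" for x s
  proof -
    have row: "(\<Sum>j\<in>S. x i * x j * Z i j) = (\<Sum>j\<in>{a,b}. x i * x j * Z i j)" for i
      by (rule sum.mono_neutral_right) (use fin ab that in auto)
    have "(\<Sum>i\<in>S. \<Sum>j\<in>S. x i * x j * Z i j) = (\<Sum>i\<in>{a,b}. \<Sum>j\<in>{a,b}. x i * x j * Z i j)"
      unfolding row by (rule sum.mono_neutral_right) (use fin ab that in auto)
    then show ?thesis using False ab zero sym[of b a] by (simp add: that)
  qed
  have nn: "2 * s * Z a b + Z b b \<ge> 0" for s
    using psd[of "\<lambda>i. if i = a then s else if i = b then 1 else 0"] unfolding *[OF refl] .
  show ?thesis
  proof (rule ccontr)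
    assume "Z a b \<noteq> 0"
    \<comment> \<open>This \<open>s\<close> is solved from the requirement that the form take the
      value -1.\<close>
    then have "2 * (- (Z b b + 1) / (2 * Z a b)) * Z a b + Z b b = -1" by (simp add: field_simps)
    then show False using nn[of "- (Z b b + 1) / (2 * Z a b)"] by linarith
  qed
qed (use zero in simp)

text \<open>Cholesky factorization by induction on the index set. The rank one matrix
  \<open>c i * c j\<close> reproduces row and column \<open>a\<close> of \<open>Z\<close>, and the
  Schur complement \<open>Z'\<close> is again positive semidefinite on the remaining
  indices.\<close>

lemma psd_gram:
  fixes Z :: "'a \<Rightarrow> 'a \<Rightarrow> real"
  assumes "finite S"
    and "\<And>i j. i \<in> S \<Longrightarrow> j \<in> S \<Longrightarrow> Z i j = Z j i"
    and "\<And>x. (\<Sum>i\<in>S. \<Sum>j\<in>S. x i * x j * Z i j) \<ge> 0"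
  shows "\<exists>v. \<forall>i\<in>S. \<forall>j\<in>S. Z i j = (\<Sum>k\<in>S. v k i * v k j)"
  using assms
proof (induction S arbitrary: Z rule: finite_induct)
  case (insert a S)
  let ?T = "insert a S"
  \<comment> \<open>If \<open>Z a a = 0\<close>, division by zero makes \<open>c\<close> vanish,
    which is the right value: row \<open>a\<close> of \<open>Z\<close> is then 0 as well.\<close>
  define c where "c i = Z a i / sqrt (Z a a)" for i
  define Z' where "Z' i j = Z i j - c i * c j" for i j
  have finT: "finite ?T" using insert by simp
  have nn: "Z a a \<ge> 0"
  proof -
    let ?x = "\<lambda>i. if i = a then 1 else (0::real)"
    have row: "(\<Sum>j\<in>?T. ?x i * ?x j * Z i j) = (\<Sum>j\<in>{a}. ?x i * ?x j * Z i j)" for i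
      by (rule sum.mono_neutral_right) (use insert(1) in auto)
    have "(\<Sum>i\<in>?T. \<Sum>j\<in>?T. ?x i * ?x j * Z i j) = (\<Sum>i\<in>{a}. \<Sum>j\<in>{a}. ?x i * ?x j * Z i j)"
      unfolding row by (rule sum.mono_neutral_right) (use insert(1) in auto)
    then have "(\<Sum>i\<in>?T. \<Sum>j\<in>?T. ?x i * ?x j * Z i j) = Z a a" by simp
    then show ?thesis using insert(5)[of ?x] by linarith
  qed
  have row: "c a * c j = Z a j" if "j \<in> ?T" for j
  proof (cases "Z a a = 0")
    case True
    have "Z a j = 0"
      by (rule psd_zero_diag_imp_zero_row[OF finT _ that insert(4) insert(5) True]) auto
    then show ?thesis using True by (simp add: c_def)
  next
    case False
    then show ?thesis using nn by (simp add: c_def real_div_sqrt)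
  qed
  have Z'a: "Z' a j = 0" "Z' j a = 0" if "j \<in> ?T" for j
    using row[OF that] insert(4)[of a j] that by (auto simp: Z'_def mult.commute)
  have psd': "(\<Sum>i\<in>S. \<Sum>j\<in>S. x i * x j * Z' i j) \<ge> 0" for x
  proof -
    define r where "r = (\<Sum>j\<in>S. x j * c j)"
    \<comment> \<open>The entry at \<open>a\<close> is chosen to make \<open>y\<close> orthogonal to
      \<open>c\<close>, so that \<open>Z\<close> and \<open>Z'\<close> have the same form at
      \<open>y\<close>. If \<open>c\<close> vanishes, orthogonality is automatic.\<close>
    define s where "s = (if Z a a = 0 then 0 else - r / c a)"
    define y where "y = x(a := s)"
    have ca: "c a = 0 \<longleftrightarrow> Z a a = 0" using nn by (auto simp: c_def)
    have yc: "(\<Sum>j\<in>?T. y j * c j) = s * c a + r"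
    proof -
      have "(\<Sum>j\<in>S. y j * c j) = r"
        unfolding r_def by (rule sum.cong) (use insert(2) in \<open>auto simp: y_def\<close>)
      then show ?thesis using insert(1,2) by (simp add: y_def)
    qed
    have yc0: "(\<Sum>j\<in>?T. y j * c j) = 0"
    proof (cases "Z a a = 0")
      case True
      then have "c j = 0" for j by (simp add: c_def)
      then show ?thesis by simp
    next
      case False
      then show ?thesis using ca by (simp add: yc s_def)
    qed
    have "(\<Sum>i\<in>?T. \<Sum>j\<in>?T. y i * y j * Z' i j) =
      (\<Sum>i\<in>?T. \<Sum>j\<in>?T. y i * y j * Z i j) - (\<Sum>i\<in>?T. y i * c i) * (\<Sum>j\<in>?T. y j * c j)"
      unfolding sum_product sum_subtractf[symmetric] by (intro sum.cong) (auto simp: Z'_def algebra_simps)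
    then have "(\<Sum>i\<in>?T. \<Sum>j\<in>?T. y i * y j * Z' i j) \<ge> 0" using yc0 insert(5)[of y] by simp
    also have "(\<Sum>i\<in>?T. \<Sum>j\<in>?T. y i * y j * Z' i j) = (\<Sum>i\<in>S. \<Sum>j\<in>S. x i * x j * Z' i j)"
    proof -
      have "(\<Sum>j\<in>?T. y i * y j * Z' i j) = (\<Sum>j\<in>S. y i * y j * Z' i j)" if "i \<in> ?T" for i
        using insert(1,2) Z'a(2)[OF that] by simp
      then have "(\<Sum>i\<in>?T. \<Sum>j\<in>?T. y i * y j * Z' i j) = (\<Sum>i\<in>?T. \<Sum>j\<in>S. y i * y j * Z' i j)"
        by (rule sum.cong[OF refl])
      also have "\<dots> = (\<Sum>i\<in>S. \<Sum>j\<in>S. y i * y j * Z' i j)"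
        using insert(1,2) Z'a(1) by simp
      also have "\<dots> = (\<Sum>i\<in>S. \<Sum>j\<in>S. x i * x j * Z' i j)"
        using insert(2) by (intro sum.cong refl) (auto simp: y_def)
      finally show ?thesis .
    qed
    finally show ?thesis .
  qed
  have "\<exists>v. \<forall>i\<in>S. \<forall>j\<in>S. Z' i j = (\<Sum>k\<in>S. v k i * v k j)"
    by (rule insert(3)[OF _ psd']) (use insert(4) in \<open>auto simp: Z'_def\<close>)
  then obtain v where v: "\<And>i j. i \<in> S \<Longrightarrow> j \<in> S \<Longrightarrow> Z' i j = (\<Sum>k\<in>S. v k i * v k j)" by blast
  \<comment> \<open>The old vectors are extended by 0 at \<open>a\<close>; only the new vector
    \<open>c\<close> sees that index.\<close>
  define w where "w k i = (if k = a then c i else if i = a then 0 else v k i)" for k i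
  have "Z i j = (\<Sum>k\<in>?T. w k i * w k j)" if "i \<in> ?T" "j \<in> ?T" for i j
  proof -
    have "(\<Sum>k\<in>?T. w k i * w k j) = c i * c j + (\<Sum>k\<in>S. w k i * w k j)"
      using insert(1,2) by (simp add: w_def)
    also have "(\<Sum>k\<in>S. w k i * w k j) = Z' i j"
    proof (cases "i = a \<or> j = a")
      case True
      then have "(\<Sum>k\<in>S. w k i * w k j) = 0"
        using insert(2) by (intro sum.neutral) (auto simp: w_def)
      then show ?thesis using True Z'a that by auto
    next
      case False
      then have "(\<Sum>k\<in>S. w k i * w k j) = (\<Sum>k\<in>S. v k i * v k j)"
        using insert(2) by (intro sum.cong) (auto simp: w_def)
      then show ?thesis using False that v by auto
    qed
    finally show ?thesis by (simp add: Z'_def)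
  qed
  then show ?case by blast
qed auto

text \<open>Doubling the form turns it into a signed Laplacian, which is visibly invariant under
  \<open>x \<mapsto> x - c \<sigma>\<close>.\<close>

lemma signed_laplacian_identity:
  fixes F :: "nat \<Rightarrow> nat \<Rightarrow> real"
  assumes lab: "\<And>i. i < n \<Longrightarrow> \<sigma> i \<in> {1, -1}"
    and sym: "\<And>i j. i < n \<Longrightarrow> j < n \<Longrightarrow> F i j = F j i"
  shows "2 * ((\<Sum>i<n. (\<Sum>j<n. \<sigma> i * \<sigma> j * F i j) * (x i)\<^sup>2) - quad_form n F x) =
    (\<Sum>i<n. \<Sum>j<n. F i j * \<sigma> i * \<sigma> j * (\<sigma> i * x i - \<sigma> j * x j)\<^sup>2)"
proof -
  have "(\<Sum>i<n. \<Sum>j<n. F i j * \<sigma> i * \<sigma> j * (\<sigma> i * x i - \<sigma> j * x j)\<^sup>2) =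
     (\<Sum>i<n. \<Sum>j<n. \<sigma> i * \<sigma> j * F i j * (x i)\<^sup>2 + \<sigma> i * \<sigma> j * F i j * (x j)\<^sup>2 - 2 * (F i j * x i * x j))"
  proof (intro sum.cong refl)
    fix i j assume "i \<in> {..<n}" "j \<in> {..<n}"
    then have "\<sigma> i \<in> {1,-1}" "\<sigma> j \<in> {1,-1}" using lab by auto
    then show "F i j * \<sigma> i * \<sigma> j * (\<sigma> i * x i - \<sigma> j * x j)\<^sup>2 =
      \<sigma> i * \<sigma> j * F i j * (x i)\<^sup>2 + \<sigma> i * \<sigma> j * F i j * (x j)\<^sup>2 - 2 * (F i j * x i * x j)"
      by (auto simp: power2_eq_square algebra_simps)
  qed
  also have "\<dots> = (\<Sum>i<n. \<Sum>j<n. \<sigma> i * \<sigma> j * F i j * (x i)\<^sup>2)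
      + (\<Sum>i<n. \<Sum>j<n. \<sigma> i * \<sigma> j * F i j * (x j)\<^sup>2) - 2 * quad_form n F x"
    by (simp add: sum.distrib sum_subtractf sum_distrib_left quad_form_def)
  also have "(\<Sum>i<n. \<Sum>j<n. \<sigma> i * \<sigma> j * F i j * (x j)\<^sup>2) = (\<Sum>i<n. \<Sum>j<n. \<sigma> i * \<sigma> j * F i j * (x i)\<^sup>2)"
    by (subst sum.swap) (intro sum.cong refl, use sym in \<open>auto simp: mult_ac\<close>)
  finally show ?thesis by (simp add: sum_distrib_right)
qed

text \<open>The sum of all entries of a Gram matrix is the sum of the squares of the sums of its
  factors. This turns the constraint that \<open>Z\<close> is orthogonal to the all-one matrix into
  orthogonality of every factor to the all-one vector.\<close>

lemma sum_eq_zero_gram: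
  fixes v :: "nat \<Rightarrow> nat \<Rightarrow> real"
  assumes "(\<Sum>i<n. \<Sum>j<n. \<Sum>k<n. v k i * v k j) = 0" "k < n"
  shows "(\<Sum>i<n. v k i) = 0"
proof -
  have "(\<Sum>i<n. \<Sum>j<n. \<Sum>k<n. v k i * v k j) = (\<Sum>i<n. \<Sum>k<n. \<Sum>j<n. v k i * v k j)"
    by (intro sum.cong refl sum.swap)
  also have "\<dots> = (\<Sum>k<n. \<Sum>i<n. \<Sum>j<n. v k i * v k j)"
    by (rule sum.swap)
  also have "\<dots> = (\<Sum>k<n. (\<Sum>i<n. v k i)\<^sup>2)"
    by (simp add: power2_eq_square sum_product)
  finally have "(\<Sum>k<n. (\<Sum>i<n. v k i)\<^sup>2) = 0" using assms(1) by simp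
  then show ?thesis using assms(2) by (subst (asm) sum_nonneg_eq_0_iff) auto
qed

text \<open>The unit diagonal makes the trace against \<open>diag D\<close> the same for every
  feasible \<open>Z\<close>, equal to the objective at \<open>Y\<close>. Hence the gap between
  \<open>Y\<close> and \<open>Z\<close> is the sum of \<open>L\<close> over the Gram factors of
  \<open>Z\<close>. Each term is nonnegative, and a zero gap makes every factor a multiple of
  \<sigma>, so \<open>Z\<close> is a multiple of \<open>Y\<close>; a diagonal entry fixes the
  multiple.\<close>

lemma sdp_certificate:
  assumes n: "n > 0"
    and lab: "\<And>i. i < n \<Longrightarrow> \<sigma> i \<in> {1, -1}"
    and bal: "balanced n \<sigma>"
    and G: "G \<in> carrier_mat n n"
    and sym: "\<And>i j. i < n \<Longrightarrow> j < n \<Longrightarrow> G $$ (i, j) = G $$ (j, i)"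
    and pos: "\<And>x. (\<Sum>i<n. x i) = 0 \<Longrightarrow> (\<Sum>i<n. \<sigma> i * x i) = 0 \<Longrightarrow> \<exists>i<n. x i \<noteq> 0 \<Longrightarrow>
      quad_form n (\<lambda>i j. G $$ (i, j)) x < (\<Sum>i<n. (\<Sum>j<n. \<sigma> i * \<sigma> j * G $$ (i, j)) * (x i)\<^sup>2)"
  shows "sdp_solutions n G = {label_matrix n \<sigma>}"
proof -
  define F where "F i j = G $$ (i, j)" for i j
  define D where "D i = (\<Sum>j<n. \<sigma> i * \<sigma> j * F i j)" for i
  define L where "L x = (\<Sum>i<n. D i * (x i)\<^sup>2) - quad_form n F x" for x
  have sumlab: "(\<Sum>i<n. \<sigma> i) = 0" using bal sum_labels_eq[OF lab] by (simp add: balanced_def)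
  have lab2: "\<sigma> i * \<sigma> i = 1" if "i < n" for i using lab[OF that] by auto
  have L2: "2 * L x = (\<Sum>i<n. \<Sum>j<n. F i j * \<sigma> i * \<sigma> j * (\<sigma> i * x i - \<sigma> j * x j)\<^sup>2)" for x
    unfolding L_def D_def by (rule signed_laplacian_identity) (use lab sym in \<open>auto simp: F_def\<close>)
  define c where "c x = (\<Sum>i<n. \<sigma> i * x i) / real n" for x
  have Lnn: "L x \<ge> 0 \<and> (L x = 0 \<longrightarrow> (\<forall>i<n. x i = c x * \<sigma> i))" if x: "(\<Sum>i<n. x i) = 0" for x
  proof -
    \<comment> \<open>Removing the component along \<sigma> does not change \<open>L\<close>, by the
      Laplacian form \<open>L2\<close>. It keeps the entry sum 0, because balance makes \<sigma>
      itself sum to 0, and it reaches the subspace where \<open>pos\<close> applies.\<close>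
    define y where "y i = x i - c x * \<sigma> i" for i
    have sy: "\<sigma> i * y i = \<sigma> i * x i - c x" if "i < n" for i
      using lab[OF that] by (auto simp: y_def)
    have "2 * L x = 2 * L y" unfolding L2
      by (intro sum.cong refl) (simp add: sy)
    moreover have "(\<Sum>i<n. y i) = 0"
      by (simp add: y_def sum_subtractf x sum_distrib_left[symmetric] sumlab)
    moreover have "(\<Sum>i<n. \<sigma> i * y i) = 0"
    proof -
      have "(\<Sum>i<n. \<sigma> i * y i) = (\<Sum>i<n. \<sigma> i * x i - c x)"
        by (intro sum.cong) (auto simp: sy)
      then show ?thesis using n by (simp add: sum_subtractf c_def)
    qed
    ultimately have "(\<exists>i<n. y i \<noteq> 0) \<Longrightarrow> L x > 0" using pos[of y] by (simp add: L_def D_def F_def[abs_def])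
    moreover have "L x = 0" if "\<forall>i<n. y i = 0"
      using \<open>2 * L x = 2 * L y\<close> that by (simp add: L_def quad_form_def)
    ultimately show ?thesis by (force simp: y_def)
  qed
  have frobG: "frob_inner G Z = (\<Sum>i<n. \<Sum>j<n. F i j * Z $$ (i, j))" for Z
    using G by (simp add: frob_inner_def F_def)
  have gram: "frob_inner G Z \<le> frob_inner G (label_matrix n \<sigma>) \<and>
     (frob_inner G Z = frob_inner G (label_matrix n \<sigma>) \<longrightarrow> Z = label_matrix n \<sigma>)"
    if Z: "Z \<in> sdp_feasible n" for Z
  proof -
    have Zc: "Z \<in> carrier_mat n n" and Zt: "transpose_mat Z = Z"
      and Zp: "\<And>x. x \<in> carrier_vec n \<Longrightarrow> scalar_prod x (Z *\<^sub>v x) \<ge> 0"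
      and ZJ: "frob_inner Z (all_one_matrix n) = 0" and Zd: "\<And>i. i < n \<Longrightarrow> Z $$ (i, i) = 1"
      using Z by (auto simp: sdp_feasible_def psd_mat_def)
    have Zsym: "Z $$ (i, j) = Z $$ (j, i)" if "i < n" "j < n" for i j
    proof -
      have "transpose_mat Z $$ (i, j) = Z $$ (j, i)" using Zc that by simp
      then show ?thesis using Zt by simp
    qed
    have Zq: "(\<Sum>i<n. \<Sum>j<n. x i * x j * Z $$ (i, j)) \<ge> 0" for x
    proof -
      have "scalar_prod (Matrix.vec n x) (Z *\<^sub>v Matrix.vec n x) = (\<Sum>i<n. x i * (\<Sum>j<n. Z $$ (i, j) * x j))"
        using Zc by (auto simp: scalar_prod_def atLeast0LessThan intro!: sum.cong)
      also have "\<dots> = (\<Sum>i<n. \<Sum>j<n. x i * x j * Z $$ (i, j))"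
        by (simp add: sum_distrib_left mult_ac)
      finally show ?thesis using Zp[of "Matrix.vec n x"] by simp
    qed
    have "\<exists>v. \<forall>i\<in>{..<n}. \<forall>j\<in>{..<n}. Z $$ (i, j) = (\<Sum>k<n. v k i * v k j)"
      using psd_gram[of "{..<n}" "\<lambda>i j. Z $$ (i, j)"] Zq Zsym by auto
    then obtain v where v: "\<And>i j. i < n \<Longrightarrow> j < n \<Longrightarrow> Z $$ (i, j) = (\<Sum>k<n. v k i * v k j)" by auto
    have "(\<Sum>i<n. \<Sum>j<n. \<Sum>k<n. v k i * v k j) = (\<Sum>i<n. \<Sum>j<n. Z $$ (i, j))"
      by (intro sum.cong) (auto simp: v)
    also have "\<dots> = 0"
      using ZJ Zc by (simp add: frob_inner_def all_one_matrix_def)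
    finally have v0: "(\<Sum>i<n. v k i) = 0" if "k < n" for k using that by (rule sum_eq_zero_gram)
    have "(\<Sum>k<n. L (v k)) = (\<Sum>k<n. \<Sum>i<n. D i * (v k i)\<^sup>2) - (\<Sum>k<n. quad_form n F (v k))"
      by (simp add: L_def sum_subtractf)
    also have "(\<Sum>k<n. \<Sum>i<n. D i * (v k i)\<^sup>2) = (\<Sum>i<n. D i * Z $$ (i, i))"
      by (subst sum.swap) (auto simp: v sum_distrib_left power2_eq_square intro!: sum.cong)
    also have "\<dots> = (\<Sum>i<n. D i)" by (simp add: Zd)
    also have "\<dots> = frob_inner G (label_matrix n \<sigma>)"
      by (auto simp: frobG label_matrix_def D_def mult_ac intro!: sum.cong)
    also have "(\<Sum>k<n. quad_form n F (v k)) = (\<Sum>i<n. \<Sum>k<n. \<Sum>j<n. F i j * v k i * v k j)"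
      unfolding quad_form_def by (rule sum.swap)
    also have "\<dots> = (\<Sum>i<n. \<Sum>j<n. \<Sum>k<n. F i j * v k i * v k j)"
      by (intro sum.cong refl sum.swap)
    also have "\<dots> = frob_inner G Z"
      by (auto simp: frobG v sum_distrib_left mult_ac intro!: sum.cong)
    finally have diff: "(\<Sum>k<n. L (v k)) = frob_inner G (label_matrix n \<sigma>) - frob_inner G Z" .
    have Lk: "L (v k) \<ge> 0" if "k < n" for k using Lnn[OF v0[OF that]] by simp
    have "(\<Sum>k<n. L (v k)) \<ge> 0" using Lk by (intro sum_nonneg) auto
    moreover have "Z = label_matrix n \<sigma>" if "(\<Sum>k<n. L (v k)) = 0"
    proof -
      have "L (v k) = 0" if "k < n" for k
        using \<open>(\<Sum>k<n. L (v k)) = 0\<close> Lk that by (subst (asm) sum_nonneg_eq_0_iff) auto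
      then have vk: "v k i = c (v k) * \<sigma> i" if "k < n" "i < n" for k i using Lnn[OF v0] that by blast
      define s where "s = (\<Sum>k<n. (c (v k))\<^sup>2)"
      have Zs: "Z $$ (i, j) = s * (\<sigma> i * \<sigma> j)" if "i < n" "j < n" for i j
      proof -
        have "Z $$ (i, j) = (\<Sum>k<n. (c (v k) * \<sigma> i) * (c (v k) * \<sigma> j))"
          unfolding v[OF that] using vk that by (intro sum.cong) auto
        then show ?thesis by (simp add: s_def sum_distrib_left power2_eq_square mult_ac)
      qed
      have "s = 1" using Zs[of 0 0] Zd[of 0] n lab2[of 0] by simp
      then show ?thesis using Zs Zc by (intro eq_matI) (auto simp: label_matrix_def)
    qed
    ultimately show ?thesis using diff by auto
  qed
  have "label_matrix n \<sigma> \<in> sdp_feasible n" using label_matrix_feasible_iff[OF lab] bal by simp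
  then show ?thesis using gram unfolding sdp_solutions_def by force
qed

section \<open>Hyperedges and pair weights\<close>

definition m_edges :: "nat \<Rightarrow> nat \<Rightarrow> nat set set" where
  "m_edges m n = {e. e \<subseteq> {..<n} \<and> card e = m}"

definition present :: "(nat set \<Rightarrow> obs) \<Rightarrow> nat set \<Rightarrow> real" where
  "present A e = (if A e = Present then 1 else 0)"

text \<open>The weight is a parameter because several graphs are of this form: the observed one with
  \<open>present A\<close>, its mean with \<open>edge_prob\<close>, the counting graph with the
  constant 1, and the hyperedges through one node with an indicator.\<close>

definition pair_weight :: "(nat set \<Rightarrow> real) \<Rightarrow> nat \<Rightarrow> nat \<Rightarrow> nat \<Rightarrow> nat \<Rightarrow> real" where
  "pair_weight w m n i j = (if i = j then 0 else \<Sum>e | e \<in> m_edges m n \<and> i \<in> e \<and> j \<in> e. w e)"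

lemma finite_m_edges [simp]: "finite (m_edges m n)"
  unfolding m_edges_def by (rule finite_subset[of _ "Pow {..<n}"]) auto

lemma finite_m_edge: "e \<in> m_edges m n \<Longrightarrow> finite e"
  by (auto simp: m_edges_def intro: finite_subset)

lemma card_m_edge: "e \<in> m_edges m n \<Longrightarrow> card e = m"
  by (simp add: m_edges_def)

text \<open>Adding \<open>i\<close> and \<open>j\<close> to a strictly increasing list that avoids
  both is a bijection onto the hyperedges containing the two. Lists that meet \<open>i\<close> or
  \<open>j\<close> contribute 0, since the index tuple is then not distinct.\<close>

lemma weighted_graph_entry:
  assumes "m \<ge> 2" "i < n" "j < n"
  shows "weighted_graph m n A $$ (i, j) = pair_weight (present A) m n i j"
proof (cases "i = j")
  case True
  then show ?thesis using assms by (simp add: weighted_graph_def pair_weight_def obs_indicator_def)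
next
  case False
  define L where "L = {is. length is = m - 2 \<and> set is \<subseteq> {..<n} \<and> sorted_wrt (<) is}"
  define L' where "L' = {is \<in> L. i \<notin> set is \<and> j \<notin> set is}"
  have "finite {xs. set xs \<subseteq> {..<n} \<and> length xs = m - 2}" by (rule finite_lists_length_eq) simp
  then have finL: "finite L" by (rule rev_finite_subset) (auto simp: L_def)
  have strict: "sorted_wrt (<) is \<longleftrightarrow> sorted is \<and> distinct is" for "is" :: "nat list"
    by (rule strict_sorted_iff)
  have "weighted_graph m n A $$ (i, j) = (\<Sum>is\<in>L. obs_indicator A (i # j # is))"
    using assms by (simp add: weighted_graph_def L_def)
  also have "\<dots> = (\<Sum>is\<in>L'. obs_indicator A (i # j # is))"
    by (rule sum.mono_neutral_right[OF finL]) (auto simp: L'_def obs_indicator_def)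
  also have "\<dots> = (\<Sum>e | e \<in> m_edges m n \<and> i \<in> e \<and> j \<in> e. present A e)"
  proof (rule sum.reindex_bij_witness[of _ "\<lambda>e. sorted_list_of_set (e - {i, j})" "\<lambda>is. insert i (insert j (set is))"])
    fix xs assume "xs \<in> L'"
    then have xs: "length xs = m - 2" "set xs \<subseteq> {..<n}" "sorted xs" "distinct xs" "i \<notin> set xs" "j \<notin> set xs"
      by (auto simp: L'_def L_def strict)
    have "insert i (insert j (set xs)) - {i, j} = set xs" using xs by auto
    then show "sorted_list_of_set (insert i (insert j (set xs)) - {i, j}) = xs"
      using xs by (simp add: sorted_list_of_set.idem_if_sorted_distinct)
    show "insert i (insert j (set xs)) \<in> {e. e \<in> m_edges m n \<and> i \<in> e \<and> j \<in> e}"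
      using xs assms False distinct_card[OF xs(4)] by (auto simp: m_edges_def)
    show "present A (insert i (insert j (set xs))) = obs_indicator A (i # j # xs)"
      using xs False by (simp add: obs_indicator_def present_def)
  next
    fix e assume "e \<in> {e. e \<in> m_edges m n \<and> i \<in> e \<and> j \<in> e}"
    then have e: "e \<subseteq> {..<n}" "card e = m" "i \<in> e" "j \<in> e" by (auto simp: m_edges_def)
    have fe: "finite e" using e(1) by (rule finite_subset) simp
    show "insert i (insert j (set (sorted_list_of_set (e - {i, j})))) = e"
      using e fe by auto
    have "card (e - {i, j}) = m - 2" using e fe False by (simp add: card_Diff_subset)
    then show "sorted_list_of_set (e - {i, j}) \<in> L'"
      using e(1) fe by (auto simp: L'_def L_def strict)
  qed
  finally show ?thesis using False by (simp add: pair_weight_def)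
qed

lemma pair_weight_sym: "pair_weight w m n i j = pair_weight w m n j i"
  unfolding pair_weight_def by (auto intro!: sum.cong)

lemma pair_weight_nonneg: "(\<And>e. w e \<ge> 0) \<Longrightarrow> pair_weight w m n i j \<ge> 0"
  unfolding pair_weight_def by (auto intro!: sum_nonneg)

text \<open>Double counting of ordered pairs inside hyperedges. The entries of the graph are
  dependent, the hyperedges are not; this identity rewrites every linear statistic of the graph as
  one of the hyperedges, to which \<open>chernoff\<close> applies.\<close>

lemma sum_pair_weight:
  fixes f :: "nat \<Rightarrow> nat \<Rightarrow> real"
  shows "(\<Sum>i<n. \<Sum>j<n. pair_weight w m n i j * f i j) =
    (\<Sum>e\<in>m_edges m n. w e * (\<Sum>i\<in>e. \<Sum>j\<in>e - {i}. f i j))"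
proof -
  have "(\<Sum>i<n. \<Sum>j<n. pair_weight w m n i j * f i j) =
     (\<Sum>i<n. \<Sum>j<n. \<Sum>e\<in>m_edges m n. if i \<in> e \<and> j \<in> e - {i} then w e * f i j else 0)"
  proof (intro sum.cong refl)
    fix i j
    show "pair_weight w m n i j * f i j =
        (\<Sum>e\<in>m_edges m n. if i \<in> e \<and> j \<in> e - {i} then w e * f i j else 0)"
    proof (cases "i = j")
      case False
      then have "(\<Sum>e\<in>m_edges m n. if i \<in> e \<and> j \<in> e - {i} then w e * f i j else 0) =
          (\<Sum>e\<in>m_edges m n. if i \<in> e \<and> j \<in> e then w e * f i j else 0)"
        by (intro sum.cong refl) auto
      also have "\<dots> = (\<Sum>e | e \<in> m_edges m n \<and> i \<in> e \<and> j \<in> e. w e * f i j)"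
        by (simp add: sum.inter_filter)
      finally show ?thesis using False by (simp add: pair_weight_def sum_distrib_right)
    qed (simp add: pair_weight_def)
  qed
  also have "\<dots> = (\<Sum>i<n. \<Sum>e\<in>m_edges m n. \<Sum>j<n. if i \<in> e \<and> j \<in> e - {i} then w e * f i j else 0)"
    by (intro sum.cong refl sum.swap)
  also have "\<dots> = (\<Sum>e\<in>m_edges m n. \<Sum>i<n. \<Sum>j<n. if i \<in> e \<and> j \<in> e - {i} then w e * f i j else 0)"
    by (rule sum.swap)
  also have "\<dots> = (\<Sum>e\<in>m_edges m n. w e * (\<Sum>i\<in>e. \<Sum>j\<in>e - {i}. f i j))"
  proof (rule sum.cong[OF refl])
    fix e assume "e \<in> m_edges m n"
    then have e: "e \<subseteq> {..<n}" by (simp add: m_edges_def)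
    have "(\<Sum>i<n. \<Sum>j<n. if i \<in> e \<and> j \<in> e - {i} then w e * f i j else 0) =
        (\<Sum>i\<in>e. \<Sum>j<n. if i \<in> e \<and> j \<in> e - {i} then w e * f i j else 0)"
      by (rule sum.mono_neutral_right) (use e in auto)
    also have "\<dots> = (\<Sum>i\<in>e. \<Sum>j\<in>e - {i}. w e * f i j)"
    proof (rule sum.cong[OF refl])
      fix i assume i: "i \<in> e"
      have "(\<Sum>j<n. if i \<in> e \<and> j \<in> e - {i} then w e * f i j else 0) =
        (\<Sum>j\<in>e - {i}. if i \<in> e \<and> j \<in> e - {i} then w e * f i j else 0)"
        by (rule sum.mono_neutral_right) (use e in auto)
      also have "\<dots> = (\<Sum>j\<in>e - {i}. w e * f i j)"
        by (rule sum.cong) (use i in auto)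
      finally show "(\<Sum>j<n. if i \<in> e \<and> j \<in> e - {i} then w e * f i j else 0) = (\<Sum>j\<in>e - {i}. w e * f i j)" .
    qed
    finally show "(\<Sum>i<n. \<Sum>j<n. if i \<in> e \<and> j \<in> e - {i} then w e * f i j else 0) =
        w e * (\<Sum>i\<in>e. \<Sum>j\<in>e - {i}. f i j)"
      by (simp add: sum_distrib_left)
  qed
  finally show ?thesis .
qed

text \<open>The case of \<open>sum_pair_weight\<close> whose coefficients are supported in row
  \<open>i\<close>.\<close>

lemma row_pair_weight:
  fixes f :: "nat \<Rightarrow> real"
  assumes i: "i < n"
  shows "(\<Sum>j<n. pair_weight w m n i j * f j) =
    (\<Sum>e\<in>m_edges m n. if i \<in> e then w e * (\<Sum>j\<in>e - {i}. f j) else 0)"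
proof -
  have "(\<Sum>a<n. \<Sum>j<n. pair_weight w m n a j * (if a = i then f j else 0)) =
      (\<Sum>a\<in>{i}. \<Sum>j<n. pair_weight w m n a j * (if a = i then f j else 0))"
    by (rule sum.mono_neutral_right) (use i in auto)
  then have "(\<Sum>j<n. pair_weight w m n i j * f j) =
      (\<Sum>a<n. \<Sum>j<n. pair_weight w m n a j * (if a = i then f j else 0))"
    by simp
  also have "\<dots> = (\<Sum>e\<in>m_edges m n. w e * (\<Sum>a\<in>e. \<Sum>j\<in>e - {a}. (if a = i then f j else 0)))"
    by (rule sum_pair_weight)
  also have "\<dots> = (\<Sum>e\<in>m_edges m n. if i \<in> e then w e * (\<Sum>j\<in>e - {i}. f j) else 0)"
  proof (rule sum.cong[OF refl])
    fix e assume "e \<in> m_edges m n"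
    then have fe: "finite e" by (rule finite_m_edge)
    show "w e * (\<Sum>a\<in>e. \<Sum>j\<in>e - {a}. (if a = i then f j else 0)) =
        (if i \<in> e then w e * (\<Sum>j\<in>e - {i}. f j) else 0)"
    proof (cases "i \<in> e")
      case True
      have "(\<Sum>a\<in>e. \<Sum>j\<in>e - {a}. (if a = i then f j else 0)) = (\<Sum>a\<in>{i}. \<Sum>j\<in>e - {a}. (if a = i then f j else 0))"
        by (rule sum.mono_neutral_right) (use True fe in auto)
      then show ?thesis using True by simp
    next
      case False
      have "(\<Sum>a\<in>e. \<Sum>j\<in>e - {a}. (if a = i then f j else 0)) = 0"
        by (intro sum.neutral ballI) (use False in auto)
      then show ?thesis using False by simp
    qed
  qed
  finally show ?thesis .
qed

text \<open>The ground set \<open>V\<close> is general because hyperedges inside a single community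
  are counted as well.\<close>

lemma card_edges_containing:
  assumes "T \<subseteq> V" "finite V" "card T \<le> m"
  shows "card {e. e \<subseteq> V \<and> card e = m \<and> T \<subseteq> e} = (card V - card T) choose (m - card T)"
proof -
  have fT: "finite T" using assms finite_subset by blast
  have "card {e. e \<subseteq> V \<and> card e = m \<and> T \<subseteq> e} = card {e. e \<subseteq> V - T \<and> card e = m - card T}"
  proof (rule bij_betw_same_card[of "\<lambda>e. e - T"], rule bij_betw_byWitness[where f'="\<lambda>e. e \<union> T"])
    show "(\<lambda>e. e - T) ` {e. e \<subseteq> V \<and> card e = m \<and> T \<subseteq> e} \<subseteq> {e. e \<subseteq> V - T \<and> card e = m - card T}"
      using fT by (auto simp: card_Diff_subset)
    show "(\<lambda>e. e \<union> T) ` {e. e \<subseteq> V - T \<and> card e = m - card T} \<subseteq> {e. e \<subseteq> V \<and> card e = m \<and> T \<subseteq> e}"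
    proof clarify
      fix e assume e: "e \<subseteq> V - T" "card e = m - card T"
      have "finite e" using e(1) assms(2) finite_subset by blast
      then have "card (e \<union> T) = card e + card T" using fT e(1) by (intro card_Un_disjoint) auto
      then show "e \<union> T \<subseteq> V \<and> card (e \<union> T) = m \<and> T \<subseteq> e \<union> T" using e assms by auto
    qed
  qed auto
  also have "\<dots> = card (V - T) choose (m - card T)" using assms by (intro n_subsets) auto
  also have "card (V - T) = card V - card T" using assms fT by (intro card_Diff_subset) auto
  finally show ?thesis .
qed

lemma card_m_edges_containing:
  assumes "T \<subseteq> {..<n}" "card T \<le> m"
  shows "card {e \<in> m_edges m n. T \<subseteq> e} = (n - card T) choose (m - card T)"
proof -
  have "{e \<in> m_edges m n. T \<subseteq> e} = {e. e \<subseteq> {..<n} \<and> card e = m \<and> T \<subseteq> e}" by (auto simp: m_edges_def)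
  then show ?thesis using card_edges_containing[OF assms(1) _ assms(2)] by simp
qed

lemma pair_weight_one:
  assumes m: "m \<ge> 2" and ij: "i < n" "j < n"
  shows "pair_weight (\<lambda>_. 1) m n i j = (if i = j then 0 else real ((n - 2) choose (m - 2)))"
proof (cases "i = j")
  case False
  have "{e. e \<in> m_edges m n \<and> i \<in> e \<and> j \<in> e} = {e \<in> m_edges m n. {i, j} \<subseteq> e}" by auto
  then show ?thesis using False card_m_edges_containing[of "{i, j}" n m] assms
    by (simp add: pair_weight_def numeral_2_eq_2)
qed (simp add: pair_weight_def)

lemma sum_edges_pairs:
  fixes f :: "nat \<Rightarrow> nat \<Rightarrow> real"
  assumes "m \<ge> 2"
  shows "(\<Sum>e\<in>m_edges m n. \<Sum>i\<in>e. \<Sum>j\<in>e - {i}. f i j) =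
    real ((n - 2) choose (m - 2)) * (\<Sum>i<n. \<Sum>j\<in>{..<n} - {i}. f i j)"
proof -
  have "(\<Sum>e\<in>m_edges m n. \<Sum>i\<in>e. \<Sum>j\<in>e - {i}. f i j) = (\<Sum>i<n. \<Sum>j<n. pair_weight (\<lambda>_. 1) m n i j * f i j)"
    by (simp add: sum_pair_weight)
  also have "\<dots> = (\<Sum>i<n. \<Sum>j\<in>{..<n} - {i}. real ((n - 2) choose (m - 2)) * f i j)"
  proof (rule sum.cong[OF refl])
    fix i assume i: "i \<in> {..<n}"
    have "(\<Sum>j<n. pair_weight (\<lambda>_. 1) m n i j * f i j) = (\<Sum>j\<in>{..<n} - {i}. pair_weight (\<lambda>_. 1) m n i j * f i j)"
      by (rule sum.mono_neutral_right) (auto simp: pair_weight_def)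
    also have "\<dots> = (\<Sum>j\<in>{..<n} - {i}. real ((n - 2) choose (m - 2)) * f i j)"
      by (rule sum.cong) (use i pair_weight_one[OF assms] in auto)
    finally show "(\<Sum>j<n. pair_weight (\<lambda>_. 1) m n i j * f i j) = (\<Sum>j\<in>{..<n} - {i}. real ((n - 2) choose (m - 2)) * f i j)" .
  qed
  finally show ?thesis by (simp add: sum_distrib_left)
qed

lemma binomial_le_pow': "N choose k \<le> N ^ k"
  by (cases "k \<le> N") (simp_all add: binomial_le_pow not_le binomial_eq_0)

text \<open>The left side is the expected number of revealed hyperedges through a given pair, and
  \<open>d\<close> stands for \<open>ln n\<close>.\<close>

lemma pairs_binomial_le:
  assumes "m \<ge> 2" "\<alpha> = t * d / real n ^ (m - 1)" "n > 0" "t \<ge> 0" "d \<ge> 0"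
  shows "\<alpha> * real ((n - 2) choose (m - 2)) \<le> t * d / real n"
proof -
  have "((n - 2) choose (m - 2)) \<le> (n - 2) ^ (m - 2)" by (rule binomial_le_pow')
  also have "\<dots> \<le> n ^ (m - 2)" by (rule power_mono) auto
  finally have "real ((n - 2) choose (m - 2)) \<le> real n ^ (m - 2)" by (simp flip: of_nat_power)
  then have "\<alpha> * real ((n - 2) choose (m - 2)) \<le> \<alpha> * real n ^ (m - 2)"
    using assms by (intro mult_left_mono) auto
  also have "real n ^ (m - 1) = real n * real n ^ (m - 2)"
    using assms(1) by (subst power_Suc[symmetric]) (simp add: Suc_diff_le numeral_2_eq_2 Suc_diff_Suc)
  then have "\<alpha> * real n ^ (m - 2) = t * d / real n" using assms by simp
  finally show ?thesis .
qed

lemma fact_binomial_le: "fact r * real (N choose r) \<le> real N ^ r"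
proof -
  have "fact r * (N choose r) \<le> N ^ r"
  proof (cases "r \<le> N")
    case True
    have "(N choose r) * fact r = fact N div fact (N - r)"
      using binomial_fact_lemma[OF True] by (metis mult.commute div_mult_self1_is_m fact_gt_zero mult.assoc)
    then show ?thesis using fact_div_fact_le_pow[OF True] by (simp add: mult.commute)
  qed (simp add: binomial_eq_0)
  then have "real (fact r * (N choose r)) \<le> real (N ^ r)" by (simp only: of_nat_le_iff)
  then show ?thesis by simp
qed

section \<open>Chernoff bounds for the observation\<close>

lemma exp_le_quadratic:
  fixes x :: real
  assumes "\<bar>x\<bar> \<le> 1"
  shows "exp x \<le> 1 + x + x\<^sup>2"
proof (cases "x \<ge> 0")
  case True
  then show ?thesis using exp_bound[of x] assms by simp
next
  case False
  define y where "y = - x"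
  have y: "0 \<le> y" "y \<le> 1" using False assms by (auto simp: y_def)
  have "y\<^sup>2 \<le> y" using y by (simp add: power2_eq_square mult_left_le)
  have "0 < 1 - y + y\<^sup>2" using \<open>y \<le> 1\<close> y by (cases "y = 0") (auto simp: add_nonneg_pos)
  \<comment> \<open>For \<open>x = - y\<close> the claim is multiplied by \<open>exp y\<close>. The
    product with the quadratic Taylor polynomial of \<open>exp y\<close> is already at least 1,
    because its linear terms cancel.\<close>
  moreover have "1 \<le> (1 - y + y\<^sup>2) * (1 + y + y\<^sup>2 / 2)"
  proof -
    have "(1 - y + y\<^sup>2) * (1 + y + y\<^sup>2 / 2) - 1 = y\<^sup>2 / 2 + y ^ 3 / 2 + y ^ 4 / 2"
      by (simp add: field_simps power2_eq_square power3_eq_cube power4_eq_xxxx)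
    also have "\<dots> \<ge> 0" using y by auto
    finally show ?thesis by simp
  qed
  moreover have "1 + y + y\<^sup>2 / 2 \<le> exp y"
    by (rule exp_lower_Taylor_quadratic) (use y in auto)
  ultimately have "1 \<le> (1 - y + y\<^sup>2) * exp y"
    by (meson mult_left_mono less_imp_le order_trans)
  then show ?thesis
    by (simp add: y_def exp_minus field_simps)
qed

lemma exp_minus_one_le:
  fixes c :: real
  assumes "\<bar>c\<bar> \<le> 1"
  shows "exp c - 1 \<le> c + c\<^sup>2"
  using exp_le_quadratic[OF assms] by simp

definition edge_prob :: "nat \<Rightarrow> real \<Rightarrow> real \<Rightarrow> real \<Rightarrow> (nat \<Rightarrow> real) \<Rightarrow> nat set \<Rightarrow> real" where
  "edge_prob n p q \<alpha> \<sigma> e =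
     \<alpha> * (if e \<subseteq> community_pos n \<sigma> \<or> e \<subseteq> community_neg n \<sigma> then p else q)"

lemma prob_edge_Present:
  assumes "0 \<le> \<alpha>" "\<alpha> \<le> 1" "0 \<le> p" "p \<le> 1" "0 \<le> q" "q \<le> 1"
  shows "pmf (edge_pmf n p q \<alpha> \<sigma> e) Present = edge_prob n p q \<alpha> \<sigma> e"
  using assms by (auto simp: edge_pmf_def edge_prob_def pmf_bind integral_bernoulli_pmf mult.commute)

lemma expectation_exp_present:
  assumes "0 \<le> \<alpha>" "\<alpha> \<le> 1" "0 \<le> p" "p \<le> 1" "0 \<le> q" "q \<le> 1"
  shows "measure_pmf.expectation (edge_pmf n p q \<alpha> \<sigma> e) (\<lambda>a. exp (c * (if a = Present then 1 else 0))) =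
    1 + edge_prob n p q \<alpha> \<sigma> e * (exp c - 1)"
proof -
  have "(\<lambda>a. exp (c * (if a = Present then 1 else 0))) = (\<lambda>a. 1 + (exp c - 1) * indicator {Present} a)"
    by (auto simp: fun_eq_iff)
  moreover have "integrable (measure_pmf (edge_pmf n p q \<alpha> \<sigma> e)) (\<lambda>a. (exp c - 1) * indicator {Present} a)"
    by (rule measure_pmf.integrable_const_bound[where B="\<bar>exp c - 1\<bar>"]) (auto simp: indicator_def)
  ultimately show ?thesis
    using prob_edge_Present[OF assms] by (simp add: measure_pmf_single)
qed

text \<open>Markov's inequality for the exponential, independence of the hyperedges, and
  \<open>1 + x \<le> exp x\<close> in each factor. The coefficients may have either sign and include
  the scale of the exponential moment, so every later tail bound is a choice of
  \<open>c\<close>.\<close>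

lemma chernoff:
  assumes "0 \<le> \<alpha>" "\<alpha> \<le> 1" "0 \<le> p" "p \<le> 1" "0 \<le> q" "q \<le> 1"
  shows "measure_pmf.prob (observation_pmf m n p q \<alpha> \<sigma>)
      {A. (\<Sum>e\<in>m_edges m n. c e * present A e) \<ge> s} \<le>
    exp (- s + (\<Sum>e\<in>m_edges m n. edge_prob n p q \<alpha> \<sigma> e * (exp (c e) - 1)))"
proof -
  let ?M = "observation_pmf m n p q \<alpha> \<sigma>"
  let ?E = "m_edges m n"
  let ?f = "\<lambda>e a. exp (c e * (if a = Present then 1 else (0::real)))"
  have int1: "integrable (measure_pmf M) (?f e)" for e and M :: "obs pmf"
    by (rule measure_pmf.integrable_const_bound[where B="max 1 (exp (c e))"]) auto
  have E: "exp (\<Sum>e\<in>?E. c e * present A e) = (\<Prod>e\<in>?E. ?f e (A e))" for A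
    by (simp add: exp_sum present_def)
  have "measure_pmf.expectation ?M (\<lambda>A. exp (\<Sum>e\<in>?E. c e * present A e)) =
      (\<Prod>e\<in>?E. 1 + edge_prob n p q \<alpha> \<sigma> e * (exp (c e) - 1))"
    unfolding E observation_pmf_def m_edges_def[symmetric]
    by (subst expectation_prod_Pi_pmf) (auto simp: int1 expectation_exp_present[OF assms] simp del: exp_le_cancel_iff)
  also have "\<dots> \<le> (\<Prod>e\<in>?E. exp (edge_prob n p q \<alpha> \<sigma> e * (exp (c e) - 1)))"
  proof (intro prod_mono conjI exp_ge_add_one_self)
    fix e
    have "0 \<le> measure_pmf.expectation (edge_pmf n p q \<alpha> \<sigma> e) (?f e)" by (intro integral_nonneg_AE) auto
    then show "0 \<le> 1 + edge_prob n p q \<alpha> \<sigma> e * (exp (c e) - 1)"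
      by (simp only: expectation_exp_present[OF assms])
  qed
  also have "\<dots> = exp (\<Sum>e\<in>?E. edge_prob n p q \<alpha> \<sigma> e * (exp (c e) - 1))" by (simp add: exp_sum)
  finally have mgf: "measure_pmf.expectation ?M (\<lambda>A. exp (\<Sum>e\<in>?E. c e * present A e)) \<le>
      exp (\<Sum>e\<in>?E. edge_prob n p q \<alpha> \<sigma> e * (exp (c e) - 1))" .
  have int: "integrable (measure_pmf ?M) (\<lambda>A. exp (\<Sum>e\<in>?E. c e * present A e))"
  proof (rule measure_pmf.integrable_const_bound[where B="exp (\<Sum>e\<in>?E. \<bar>c e\<bar>)"])
    show "AE A in measure_pmf ?M. norm (exp (\<Sum>e\<in>?E. c e * present A e)) \<le> exp (\<Sum>e\<in>?E. \<bar>c e\<bar>)"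
      by (auto simp: present_def intro!: AE_I2 sum_mono)
  qed auto
  have "measure_pmf.prob ?M {A. (\<Sum>e\<in>?E. c e * present A e) \<ge> s} =
      measure_pmf.prob ?M {A \<in> space (measure_pmf ?M). exp (\<Sum>e\<in>?E. c e * present A e) \<ge> exp s}" by simp
  also have "\<dots> \<le> measure_pmf.expectation ?M (\<lambda>A. exp (\<Sum>e\<in>?E. c e * present A e)) / exp s"
    by (rule integral_Markov_inequality_measure[where A="{}", OF int]) auto
  also have "\<dots> \<le> exp (\<Sum>e\<in>?E. edge_prob n p q \<alpha> \<sigma> e * (exp (c e) - 1)) / exp s"
    by (intro divide_right_mono mgf) auto
  also have "\<dots> = exp (- s + (\<Sum>e\<in>?E. edge_prob n p q \<alpha> \<sigma> e * (exp (c e) - 1)))"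
    by (simp flip: exp_diff)
  finally show ?thesis .
qed

lemma prob_bex_le:
  assumes "finite I" "\<And>i. i \<in> I \<Longrightarrow> measure_pmf.prob M {x. P i x} \<le> b i"
  shows "measure_pmf.prob M {x. \<exists>i\<in>I. P i x} \<le> (\<Sum>i\<in>I. b i)"
proof -
  have "{x. \<exists>i\<in>I. P i x} = (\<Union>i\<in>I. {x. P i x})" by auto
  then have "measure_pmf.prob M {x. \<exists>i\<in>I. P i x} \<le> (\<Sum>i\<in>I. measure_pmf.prob M {x. P i x})"
    using measure_UNION_le[OF assms(1), of "\<lambda>i. {x. P i x}" "measure_pmf M"] by simp
  also have "\<dots> \<le> (\<Sum>i\<in>I. b i)" by (intro sum_mono assms)
  finally show ?thesis .
qed

lemma edge_prob_bounds:
  assumes "0 \<le> \<alpha>" "0 \<le> p" "p \<le> 1" "0 \<le> q" "q \<le> 1"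
  shows "0 \<le> edge_prob n p q \<alpha> \<sigma> e" "edge_prob n p q \<alpha> \<sigma> e \<le> \<alpha>"
  using assms by (auto simp: edge_prob_def mult_left_le)

section \<open>Tail bounds for fixed labels: degrees, small node sets, light pairs\<close>

text \<open>The labels are a fixed parameter and need not be balanced here. \<open>rate_le_1\<close>
  excludes the truncation in \<open>bernoulli_pmf\<close>, so that \<open>edge_prob\<close> is the
  true probability of observing a hyperedge.\<close>

locale censored_hsbm =
  fixes m n :: nat and p q t :: real and \<sigma> :: "nat \<Rightarrow> real"
  assumes m: "m \<ge> 2" and n: "n \<ge> 2"
    and pq: "0 < p" "p < 1" "0 < q" "q < 1" "q < p" and t: "0 < t"
    and rate_le_1: "reveal_rate m t n \<le> 1"
begin

abbreviation \<alpha> :: real where "\<alpha> \<equiv> reveal_rate m t n"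
abbreviation L :: real where "L \<equiv> ln (real n)"
abbreviation obs_law :: "(nat set \<Rightarrow> obs) pmf" where "obs_law \<equiv> observation_pmf m n p q \<alpha> \<sigma>"
abbreviation \<pi> :: "nat set \<Rightarrow> real" where "\<pi> \<equiv> edge_prob n p q \<alpha> \<sigma>"
abbreviation G :: "(nat set \<Rightarrow> obs) \<Rightarrow> nat \<Rightarrow> nat \<Rightarrow> real" where "G A \<equiv> pair_weight (present A) m n"
abbreviation mean_G :: "nat \<Rightarrow> nat \<Rightarrow> real" where "mean_G \<equiv> pair_weight \<pi> m n"

lemma L_pos: "L > 0" using n by simp

lemma rate_eq: "\<alpha> = t * L / real n ^ (m - 1)" by (simp add: reveal_rate_def)

lemma rate_nonneg: "0 \<le> \<alpha>" using t L_pos by (simp add: rate_eq)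

lemma chernoff_obs:
  "measure_pmf.prob obs_law {A. (\<Sum>e\<in>m_edges m n. c e * present A e) \<ge> s} \<le>
    exp (- s + (\<Sum>e\<in>m_edges m n. \<pi> e * (exp (c e) - 1)))"
  by (rule chernoff) (use rate_nonneg rate_le_1 pq in auto)

lemma \<pi>_bounds: "0 \<le> \<pi> e" "\<pi> e \<le> \<alpha>"
  using edge_prob_bounds rate_nonneg pq by auto

lemma rate_binomial_le: "\<alpha> * real ((n - 2) choose (m - 2)) \<le> t * L / real n"
  by (rule pairs_binomial_le) (use m n t L_pos in \<open>auto simp: rate_eq\<close>)

lemma G_nonneg: "G A i j \<ge> 0" by (rule pair_weight_nonneg) (simp add: present_def)

lemma exp_mult_L: "exp (- (real k * L)) = 1 / real n ^ k"
proof -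
  have "exp (real k * L) = exp L ^ k" by (simp add: exp_of_nat_mult)
  then show ?thesis using n by (simp add: exp_minus inverse_eq_divide)
qed

lemma mean_G_bounds:
  assumes "i < n" "j < n"
  shows "0 \<le> mean_G i j" "mean_G i j \<le> t * L / real n"
proof -
  show "0 \<le> mean_G i j" by (rule pair_weight_nonneg) (rule \<pi>_bounds)
  show "mean_G i j \<le> t * L / real n"
  proof (cases "i = j")
    case True
    then show ?thesis using t L_pos by (simp add: pair_weight_def)
  next
    case False
    have "mean_G i j = (\<Sum>e | e \<in> m_edges m n \<and> i \<in> e \<and> j \<in> e. \<pi> e)"
      using False by (simp add: pair_weight_def)
    also have "\<dots> \<le> (\<Sum>e | e \<in> m_edges m n \<and> i \<in> e \<and> j \<in> e. \<alpha>)"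
      by (intro sum_mono \<pi>_bounds)
    also have "{e. e \<in> m_edges m n \<and> i \<in> e \<and> j \<in> e} = {e \<in> m_edges m n. {i, j} \<subseteq> e}" by auto
    also have "(\<Sum>e\<in>{e \<in> m_edges m n. {i, j} \<subseteq> e}. \<alpha>) = \<alpha> * real ((n - 2) choose (m - 2))"
      using card_m_edges_containing[of "{i, j}" n m] assms m False by (simp add: numeral_2_eq_2)
    also have "\<dots> \<le> t * L / real n" by (rule rate_binomial_le)
    finally show ?thesis .
  qed
qed

text \<open>Every observed hyperedge at \<open>i\<close> adds \<open>m - 1\<close> to the degree,
  and on average at most \<open>t * L\<close> of them are observed. With coefficient 1 and
  \<open>exp 1 - 1 \<le> 2\<close> the exponent is at most
  \<open>- (2 * t + 2) * L + 2 * t * L\<close>; the resulting \<open>1 / n^2\<close> survives the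
  union over the nodes.\<close>

lemma degree_tail:
  "measure_pmf.prob obs_law {A. \<exists>i<n. (\<Sum>j<n. G A i j) > real m * (2 * t + 2) * L} \<le> 1 / real n"
proof -
  have "measure_pmf.prob obs_law {A. (\<Sum>j<n. G A i j) > real m * (2 * t + 2) * L} \<le> 1 / real n ^ 2"
    if i: "i < n" for i
  proof -
    let ?c = "\<lambda>e. if i \<in> e then 1 else (0::real)"
    have row: "(\<Sum>j<n. G A i j) = real (m - 1) * (\<Sum>e\<in>m_edges m n. ?c e * present A e)" for A
    proof -
      have "(\<Sum>j<n. G A i j) = (\<Sum>e\<in>m_edges m n. if i \<in> e then present A e * (\<Sum>j\<in>e - {i}. 1) else 0)"
        using row_pair_weight[OF i, of "present A" m "\<lambda>_. 1"] by simp
      also have "\<dots> = (\<Sum>e\<in>m_edges m n. real (m - 1) * (?c e * present A e))"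
        by (intro sum.cong) (auto simp: m_edges_def)
      finally show ?thesis by (simp add: sum_distrib_left)
    qed
    have "measure_pmf.prob obs_law {A. (\<Sum>j<n. G A i j) > real m * (2 * t + 2) * L} \<le>
        measure_pmf.prob obs_law {A. (\<Sum>e\<in>m_edges m n. ?c e * present A e) \<ge> (2 * t + 2) * L}"
    proof (rule measure_pmf.finite_measure_mono)
      show "{A. (\<Sum>j<n. G A i j) > real m * (2 * t + 2) * L} \<subseteq>
          {A. (\<Sum>e\<in>m_edges m n. ?c e * present A e) \<ge> (2 * t + 2) * L}"
      proof clarify
        fix A assume A: "(\<Sum>j<n. G A i j) > real m * (2 * t + 2) * L"
        let ?X = "\<Sum>e\<in>m_edges m n. ?c e * present A e"
        have "?X \<ge> 0" by (intro sum_nonneg) (auto simp: present_def)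
        then have "real (m - 1) * ?X \<le> real m * ?X" by (intro mult_right_mono) auto
        then have "real m * ((2 * t + 2) * L) < real m * ?X" using A unfolding row by (simp add: mult_ac)
        then show "?X \<ge> (2 * t + 2) * L" using m by simp
      qed
    qed simp
    also have "\<dots> \<le> exp (- ((2 * t + 2) * L) + (\<Sum>e\<in>m_edges m n. \<pi> e * (exp (?c e) - 1)))"
      by (rule chernoff_obs)
    also have "\<dots> \<le> exp (- (real 2 * L))"
    proof -
      have "(\<Sum>e\<in>m_edges m n. \<pi> e * (exp (?c e) - 1)) \<le> (\<Sum>e\<in>m_edges m n. if i \<in> e then 2 * \<alpha> else 0)"
      proof (rule sum_mono)
        fix e
        have "\<pi> e * (exp 1 - 1) \<le> \<alpha> * 2"
          using \<pi>_bounds[of e] exp_le by (intro mult_mono) auto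
        then show "\<pi> e * (exp (?c e) - 1) \<le> (if i \<in> e then 2 * \<alpha> else 0)" by auto
      qed
      also have "\<dots> = 2 * \<alpha> * real (card {e \<in> m_edges m n. {i} \<subseteq> e})"
        by (simp add: sum.inter_filter[symmetric])
      also have "card {e \<in> m_edges m n. {i} \<subseteq> e} = (n - 1) choose (m - 1)"
        using card_m_edges_containing[of "{i}" n m] i m by simp
      also have "2 * \<alpha> * real ((n - 1) choose (m - 1)) \<le> 2 * \<alpha> * real n ^ (m - 1)"
      proof -
        have "((n - 1) choose (m - 1)) \<le> (n - 1) ^ (m - 1)" by (rule binomial_le_pow')
        also have "\<dots> \<le> n ^ (m - 1)" by (rule power_mono) auto
        finally have "real ((n - 1) choose (m - 1)) \<le> real n ^ (m - 1)" by (simp flip: of_nat_power)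
        then show ?thesis using rate_nonneg by (intro mult_left_mono) auto
      qed
      also have "\<dots> = 2 * t * L" using n by (simp add: rate_eq)
      finally show ?thesis by (simp add: algebra_simps)
    qed
    also have "\<dots> = 1 / real n ^ 2" by (rule exp_mult_L)
    finally show ?thesis .
  qed
  then have "measure_pmf.prob obs_law {A. \<exists>i\<in>{..<n}. (\<Sum>j<n. G A i j) > real m * (2 * t + 2) * L} \<le>
      (\<Sum>i<n. 1 / real n ^ 2)"
    by (intro prob_bex_le) auto
  then show ?thesis using n by (simp add: power2_eq_square Bex_def)
qed

text \<open>A hyperedge has at most \<open>m^2\<close> ordered pairs in \<open>U\<close>, so
  \<open>lam\<close> is the scale at which its exponential is at most \<rho>. The smallness of
  \<open>U\<close> absorbs this factor: the sum in the exponent is at most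
  \<open>t * L * card U\<close>, while the deviation contributes at least
  \<open>(t + 3) * L * card U\<close> with the opposite sign.\<close>

lemma sparse_tail_single:
  assumes U: "U \<subseteq> {..<n}" "real (card U) * \<rho> \<le> real n" and \<rho>: "\<rho> > 1"
    and big: "\<kappa> * ln \<rho> / real m ^ 2 \<ge> t + 3"
  shows "measure_pmf.prob obs_law {A. (\<Sum>i\<in>U. \<Sum>j\<in>U. G A i j) > \<kappa> * L * real (card U)} \<le>
    (1 / real n ^ 3) ^ card U"
proof -
  define lam where "lam = ln \<rho> / real m ^ 2"
  have lam: "lam > 0" using \<rho> m by (simp add: lam_def)
  \<comment> \<open>Natural values make each \<open>r e\<close> an integer, hence either 0 or at
    least 1.\<close>
  define f :: "nat \<Rightarrow> nat \<Rightarrow> nat" where "f i j = (if i \<in> U \<and> j \<in> U then 1 else 0)" for i j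
  define r where "r e = (\<Sum>i\<in>e. \<Sum>j\<in>e - {i}. real (f i j))" for e
  have fU: "finite U" using U finite_subset by blast
  have GU: "(\<Sum>i\<in>U. \<Sum>j\<in>U. G A i j) = (\<Sum>e\<in>m_edges m n. r e * present A e)" for A
  proof -
    have "(\<Sum>i<n. \<Sum>j<n. G A i j * real (f i j)) = (\<Sum>i\<in>U. \<Sum>j<n. G A i j * real (f i j))"
      by (rule sum.mono_neutral_right) (use U in \<open>auto simp: f_def\<close>)
    also have "\<dots> = (\<Sum>i\<in>U. \<Sum>j\<in>U. G A i j)"
    proof (rule sum.cong[OF refl])
      fix i assume i: "i \<in> U"
      have "(\<Sum>j<n. G A i j * real (f i j)) = (\<Sum>j\<in>U. G A i j * real (f i j))"
        by (rule sum.mono_neutral_right) (use U in \<open>auto simp: f_def\<close>)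
      then show "(\<Sum>j<n. G A i j * real (f i j)) = (\<Sum>j\<in>U. G A i j)" using i by (simp add: f_def)
    qed
    finally have "(\<Sum>i\<in>U. \<Sum>j\<in>U. G A i j) = (\<Sum>i<n. \<Sum>j<n. G A i j * real (f i j))" ..
    also have "\<dots> = (\<Sum>e\<in>m_edges m n. present A e * r e)" unfolding r_def by (rule sum_pair_weight)
    finally show ?thesis by (simp add: mult.commute)
  qed
  have "measure_pmf.prob obs_law {A. (\<Sum>i\<in>U. \<Sum>j\<in>U. G A i j) > \<kappa> * L * real (card U)} \<le>
      measure_pmf.prob obs_law {A. (\<Sum>e\<in>m_edges m n. (lam * r e) * present A e) \<ge> lam * (\<kappa> * L * real (card U))}"
  proof (rule measure_pmf.finite_measure_mono)
    have "(\<Sum>e\<in>m_edges m n. (lam * r e) * present A e) = lam * (\<Sum>i\<in>U. \<Sum>j\<in>U. G A i j)" for A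
      unfolding GU by (simp add: sum_distrib_left mult_ac)
    then show "{A. (\<Sum>i\<in>U. \<Sum>j\<in>U. G A i j) > \<kappa> * L * real (card U)} \<subseteq>
       {A. (\<Sum>e\<in>m_edges m n. (lam * r e) * present A e) \<ge> lam * (\<kappa> * L * real (card U))}"
      using lam by auto
  qed simp
  also have "\<dots> \<le> exp (- (lam * (\<kappa> * L * real (card U))) + (\<Sum>e\<in>m_edges m n. \<pi> e * (exp (lam * r e) - 1)))"
    by (rule chernoff_obs)
  also have "\<dots> \<le> exp (real (card U) * (- (real 3 * L)))"
  proof -
    have "(\<Sum>e\<in>m_edges m n. \<pi> e * (exp (lam * r e) - 1)) \<le> (\<Sum>e\<in>m_edges m n. \<alpha> * (r e * \<rho>))"
    proof (rule sum_mono)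
      fix e assume "e \<in> m_edges m n"
      then have e: "finite e" "card e = m" by (auto dest: finite_m_edge card_m_edge)
      have r_nat: "r e = real (\<Sum>i\<in>e. \<Sum>j\<in>e - {i}. f i j)" by (simp add: r_def)
      have "r e \<le> (\<Sum>i\<in>e. \<Sum>j\<in>e. real (f i j))"
        unfolding r_def by (rule sum_mono, rule sum_mono2) (use e in auto)
      also have "\<dots> \<le> (\<Sum>i\<in>e. \<Sum>j\<in>e. 1)"
        by (rule sum_mono, rule sum_mono) (simp add: f_def)
      finally have rm: "r e \<le> real m ^ 2" using e by (simp add: power2_eq_square)
      \<comment> \<open>If \<open>r e = 0\<close> both sides vanish. Otherwise
        \<open>r e \<ge> 1\<close> allows the crude bound \<rho> to be multiplied by
        \<open>r e\<close>, which makes the sum over hyperedges linear in \<open>r\<close>.\<close>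
      have "exp (lam * r e) - 1 \<le> r e * \<rho>"
      proof (cases "r e = 0")
        case False
        obtain N where N: "r e = real N" using r_nat by blast
        then have r1: "r e \<ge> 1" using False by simp
        have "lam * r e \<le> lam * real m ^ 2" using lam rm by (intro mult_left_mono) auto
        also have "\<dots> = ln \<rho>" using m by (simp add: lam_def)
        finally have "exp (lam * r e) \<le> \<rho>" using \<rho> by (simp add: ln_ge_iff)
        also have "\<rho> \<le> r e * \<rho>" using r1 \<rho> by simp
        finally show ?thesis by simp
      qed simp
      moreover have "0 \<le> r e" by (simp add: r_def sum_nonneg)
      ultimately show "\<pi> e * (exp (lam * r e) - 1) \<le> \<alpha> * (r e * \<rho>)"
        using \<pi>_bounds[of e] lam \<rho> rate_nonneg by (intro mult_mono) auto
    qed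
    also have "\<dots> = \<rho> * (\<alpha> * (\<Sum>e\<in>m_edges m n. r e))"
      by (simp add: sum_distrib_left mult_ac)
    also have "(\<Sum>e\<in>m_edges m n. r e) = real ((n - 2) choose (m - 2)) * (\<Sum>i<n. \<Sum>j\<in>{..<n} - {i}. real (f i j))"
      unfolding r_def by (rule sum_edges_pairs[OF m])
    also have "\<rho> * (\<alpha> * \<dots>) = \<rho> * (\<alpha> * real ((n - 2) choose (m - 2)) * (\<Sum>i<n. \<Sum>j\<in>{..<n} - {i}. real (f i j)))"
      by (simp add: mult_ac)
    also have "\<dots> \<le> \<rho> * (t * L / real n * (real (card U) * real (card U)))"
    proof (intro mult_left_mono mult_mono rate_binomial_le)
      have "(\<Sum>i<n. \<Sum>j\<in>{..<n} - {i}. real (f i j)) \<le> (\<Sum>i<n. \<Sum>j<n. real (f i j))"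
        by (intro sum_mono sum_mono2) auto
      also have "\<dots> = (\<Sum>i<n. \<Sum>j<n. (if i \<in> U then 1 else 0) * (if j \<in> U then 1 else 0))"
        by (intro sum.cong) (auto simp: f_def)
      also have "\<dots> = (\<Sum>i<n. if i \<in> U then 1 else 0) * (\<Sum>j<n. if j \<in> U then 1 else 0)"
        by (simp only: sum_product)
      also have "(\<Sum>j<n. if j \<in> U then 1 else 0) = real (card U)"
        using U by (simp add: sum.If_cases Int_absorb1)
      finally show "(\<Sum>i<n. \<Sum>j\<in>{..<n} - {i}. real (f i j)) \<le> real (card U) * real (card U)" .
    qed (use \<rho> t L_pos in \<open>auto intro!: sum_nonneg\<close>)
    also have "\<dots> = (real (card U) * \<rho>) * (t * L / real n * real (card U))" by (simp add: mult_ac)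
    also have "\<dots> \<le> real n * (t * L / real n * real (card U))"
      using U(2) t L_pos by (intro mult_right_mono) auto
    also have "\<dots> = t * (L * real (card U))" using n by simp
    finally have 1: "(\<Sum>e\<in>m_edges m n. \<pi> e * (exp (lam * r e) - 1)) \<le> t * (L * real (card U))" .
    have "(t + 3) * (L * real (card U)) \<le> \<kappa> * lam * (L * real (card U))"
      using big L_pos by (intro mult_right_mono) (auto simp: lam_def)
    then have "- (lam * (\<kappa> * L * real (card U))) + (\<Sum>e\<in>m_edges m n. \<pi> e * (exp (lam * r e) - 1)) \<le>
        real (card U) * (- (real 3 * L))"
      using 1 by (simp add: algebra_simps)
    then show ?thesis by simp
  qed
  also have "\<dots> = (1 / real n ^ 3) ^ card U"
    unfolding exp_of_nat_mult exp_mult_L ..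
  finally show ?thesis .
qed

text \<open>With \<open>y = 1 / n^3\<close>, the union over all nonempty sets costs
  \<open>(1 + y)^n - 1\<close>, which is of order \<open>n * y\<close>. The empty set would
  contribute the term 1; it has to be left out of the union, and it satisfies the bound
  trivially.\<close>

lemma sparse_tail:
  assumes \<rho>: "\<rho> > 1" and big: "\<kappa> * ln \<rho> / real m ^ 2 \<ge> t + 3"
  shows "measure_pmf.prob obs_law {A. \<exists>U. U \<subseteq> {..<n} \<and> real (card U) * \<rho> \<le> real n \<and>
      (\<Sum>i\<in>U. \<Sum>j\<in>U. G A i j) > \<kappa> * L * real (card U)} \<le> 1 / real n"
proof -
  define I where "I = {U. U \<subseteq> {..<n} \<and> U \<noteq> {} \<and> real (card U) * \<rho> \<le> real n}"
  have finI: "finite I" by (rule finite_subset[of _ "Pow {..<n}"]) (auto simp: I_def)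
  define y where "y = 1 / real n ^ 3"
  have y: "y > 0" using n by (simp add: y_def)
  have "{A. \<exists>U. U \<subseteq> {..<n} \<and> real (card U) * \<rho> \<le> real n \<and>
      (\<Sum>i\<in>U. \<Sum>j\<in>U. G A i j) > \<kappa> * L * real (card U)} =
    {A. \<exists>U\<in>I. (\<Sum>i\<in>U. \<Sum>j\<in>U. G A i j) > \<kappa> * L * real (card U)}"
  proof (rule Collect_cong)
    fix A
    have "\<not> (\<Sum>i\<in>{}. \<Sum>j\<in>{}. G A i j) > \<kappa> * L * real (card ({} :: nat set))" by simp
    then show "(\<exists>U. U \<subseteq> {..<n} \<and> real (card U) * \<rho> \<le> real n \<and>
        (\<Sum>i\<in>U. \<Sum>j\<in>U. G A i j) > \<kappa> * L * real (card U)) =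
      (\<exists>U\<in>I. (\<Sum>i\<in>U. \<Sum>j\<in>U. G A i j) > \<kappa> * L * real (card U))"
      unfolding I_def by blast
  qed
  then have "measure_pmf.prob obs_law {A. \<exists>U. U \<subseteq> {..<n} \<and> real (card U) * \<rho> \<le> real n \<and>
      (\<Sum>i\<in>U. \<Sum>j\<in>U. G A i j) > \<kappa> * L * real (card U)} =
    measure_pmf.prob obs_law {A. \<exists>U\<in>I. (\<Sum>i\<in>U. \<Sum>j\<in>U. G A i j) > \<kappa> * L * real (card U)}"
    by (rule arg_cong)
  also have "\<dots> \<le> (\<Sum>U\<in>I. y ^ card U)"
    unfolding y_def using sparse_tail_single \<rho> big by (intro prob_bex_le finI) (auto simp: I_def)
  also have "\<dots> \<le> (\<Sum>U\<in>Pow {..<n} - {{}}. y ^ card U)"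
    using y by (intro sum_mono2) (auto simp: I_def)
  also have "\<dots> = (1 + y) ^ n - 1"
  proof -
    have "(1 + y) ^ n = (\<Prod>i<n. y + 1)" by (simp add: add.commute)
    also have "\<dots> = (\<Sum>U\<in>Pow {..<n}. (\<Prod>i\<in>U. y) * (\<Prod>i\<in>{..<n} - U. 1))"
      by (rule prod_add) simp
    also have "\<dots> = (\<Sum>U\<in>Pow {..<n}. y ^ card U)" by simp
    also have "\<dots> = 1 + (\<Sum>U\<in>Pow {..<n} - {{}}. y ^ card U)"
      by (subst sum.remove[of _ "{}"]) auto
    finally show ?thesis by simp
  qed
  also have "(1 + y) ^ n \<le> exp y ^ n"
    using y by (intro power_mono exp_ge_add_one_self) auto
  also have "exp y ^ n = exp (real n * y)" by (simp add: exp_of_nat_mult)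
  also have "\<dots> \<le> 1 + 2 * (real n * y)"
  proof (rule real_exp_bound_lemma)
    have "2 * 1 \<le> real n * real n" using n by (intro mult_mono) auto
    then have "1 / (real n * real n) \<le> 1 / 2" by (intro divide_left_mono) auto
    moreover have "real n * y = 1 / (real n * real n)" using n by (simp add: y_def power3_eq_cube)
    ultimately show "real n * y \<le> 1/2" by simp
  qed (use y in simp)
  also have "1 + 2 * (real n * y) - 1 \<le> 1 / real n"
  proof -
    have "2 * (real n * y) = (2 / real n) * (1 / real n)"
      using n by (simp add: y_def power3_eq_cube)
    also have "\<dots> \<le> 1 * (1 / real n)" using n by (intro mult_right_mono) auto
    finally show ?thesis by simp
  qed
  finally show ?thesis by simp
qed

text \<open>A Bernstein bound. Truncation gives \<open>\<bar>c e\<bar> \<le> m^2 * \<theta>\<close>,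
  so \<open>lam\<close> is the largest scale for which this guarantees exponents in the range of
  \<open>exp_le_quadratic\<close>. The linear terms cancel against the centering. For the quadratic
  ones, Cauchy-Schwarz over the at most \<open>m^2\<close> pairs of a hyperedge reduces
  \<open>(c e)^2\<close> to the products \<open>(z i)^2 * (z j)^2\<close>, whose total is at most
  \<open>(4 * n)^2\<close>.\<close>

lemma light_tail_single:
  fixes z :: "nat \<Rightarrow> real"
  assumes z: "(\<Sum>i<n. (z i)\<^sup>2) \<le> 4 * real n" and \<theta>: "\<theta> > 0"
  shows "measure_pmf.prob obs_law {A. (\<Sum>i<n. \<Sum>j<n. if \<bar>z i * z j\<bar> \<le> \<theta> then (G A i j - mean_G i j) * z i * z j else 0) \<ge> s}
    \<le> exp (- (s / (real m ^ 2 * \<theta>)) + 16 * t * L * real n / (real m ^ 2 * \<theta>\<^sup>2))"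
proof -
  define f where "f i j = (if \<bar>z i * z j\<bar> \<le> \<theta> then z i * z j else 0)" for i j
  define c where "c e = (\<Sum>i\<in>e. \<Sum>j\<in>e - {i}. f i j)" for e
  define lam where "lam = 1 / (real m ^ 2 * \<theta>)"
  have lam: "lam > 0" using m \<theta> by (simp add: lam_def)
  have sum_eq: "(\<Sum>i<n. \<Sum>j<n. if \<bar>z i * z j\<bar> \<le> \<theta> then (G A i j - mean_G i j) * z i * z j else 0) =
     (\<Sum>e\<in>m_edges m n. c e * present A e) - (\<Sum>e\<in>m_edges m n. \<pi> e * c e)" for A
  proof -
    have "(\<Sum>i<n. \<Sum>j<n. if \<bar>z i * z j\<bar> \<le> \<theta> then (G A i j - mean_G i j) * z i * z j else 0) =
      (\<Sum>i<n. \<Sum>j<n. G A i j * f i j - mean_G i j * f i j)"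
      by (intro sum.cong refl) (simp add: f_def algebra_simps)
    also have "\<dots> = (\<Sum>i<n. \<Sum>j<n. G A i j * f i j) - (\<Sum>i<n. \<Sum>j<n. mean_G i j * f i j)"
      by (simp add: sum_subtractf)
    also have "\<dots> = (\<Sum>e\<in>m_edges m n. present A e * c e) - (\<Sum>e\<in>m_edges m n. \<pi> e * c e)"
      unfolding sum_pair_weight c_def ..
    finally show ?thesis by (simp add: mult.commute)
  qed
  have c_bounds: "\<bar>c e\<bar> \<le> real m ^ 2 * \<theta>" "(c e)\<^sup>2 \<le> real m ^ 2 * (\<Sum>i\<in>e. \<Sum>j\<in>e - {i}. (z i)\<^sup>2 * (z j)\<^sup>2)"
    if "e \<in> m_edges m n" for e
  proof -
    have e: "finite e" "card e = m" using that by (auto dest: finite_m_edge card_m_edge)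
    define P where "P = Sigma e (\<lambda>i. e - {i})"
    have c_eq: "c e = (\<Sum>(i,j)\<in>P. f i j)" using e by (simp add: c_def P_def sum.Sigma)
    have "card P \<le> card (e \<times> e)" by (rule card_mono) (use e in \<open>auto simp: P_def\<close>)
    then have "real (card P) \<le> real (m * m)" using e by (simp only: card_cartesian_product of_nat_le_iff)
    then have cardP: "real (card P) \<le> real m ^ 2" by (simp add: power2_eq_square)
    have "\<bar>c e\<bar> \<le> (\<Sum>x\<in>P. \<theta>)"
      unfolding c_eq by (rule order_trans[OF sum_abs sum_mono]) (use \<theta> in \<open>auto simp: f_def\<close>)
    also have "\<dots> \<le> real m ^ 2 * \<theta>" using cardP \<theta> by simp
    finally show "\<bar>c e\<bar> \<le> real m ^ 2 * \<theta>" .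
    have "(c e)\<^sup>2 \<le> (\<Sum>x\<in>P. (case x of (i,j) \<Rightarrow> f i j)\<^sup>2) * real (card P)"
      unfolding c_eq by (rule sum_squared_le_sum_of_squares)
    also have "\<dots> \<le> (\<Sum>(i,j)\<in>P. (z i)\<^sup>2 * (z j)\<^sup>2) * real m ^ 2"
      by (intro mult_mono cardP sum_mono sum_nonneg) (auto simp: f_def power_mult_distrib)
    also have "(\<Sum>(i,j)\<in>P. (z i)\<^sup>2 * (z j)\<^sup>2) = (\<Sum>i\<in>e. \<Sum>j\<in>e - {i}. (z i)\<^sup>2 * (z j)\<^sup>2)"
      using e by (simp add: P_def sum.Sigma)
    finally show "(c e)\<^sup>2 \<le> real m ^ 2 * (\<Sum>i\<in>e. \<Sum>j\<in>e - {i}. (z i)\<^sup>2 * (z j)\<^sup>2)"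
      by (simp add: mult.commute)
  qed
  have var: "(\<Sum>e\<in>m_edges m n. \<pi> e * (c e)\<^sup>2) \<le> real m ^ 2 * (16 * t * L * real n)"
  proof -
    have "(\<Sum>e\<in>m_edges m n. \<pi> e * (c e)\<^sup>2) \<le>
      (\<Sum>e\<in>m_edges m n. \<alpha> * (real m ^ 2 * (\<Sum>i\<in>e. \<Sum>j\<in>e - {i}. (z i)\<^sup>2 * (z j)\<^sup>2)))"
      by (intro sum_mono mult_mono \<pi>_bounds c_bounds rate_nonneg) auto
    also have "\<dots> = real m ^ 2 * (\<alpha> * (\<Sum>e\<in>m_edges m n. \<Sum>i\<in>e. \<Sum>j\<in>e - {i}. (z i)\<^sup>2 * (z j)\<^sup>2))"
      by (simp add: sum_distrib_left mult_ac)
    also have "(\<Sum>e\<in>m_edges m n. \<Sum>i\<in>e. \<Sum>j\<in>e - {i}. (z i)\<^sup>2 * (z j)\<^sup>2) =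
        real ((n - 2) choose (m - 2)) * (\<Sum>i<n. \<Sum>j\<in>{..<n} - {i}. (z i)\<^sup>2 * (z j)\<^sup>2)"
      by (rule sum_edges_pairs[OF m])
    also have "real m ^ 2 * (\<alpha> * \<dots>) =
        real m ^ 2 * (\<alpha> * real ((n - 2) choose (m - 2)) * (\<Sum>i<n. \<Sum>j\<in>{..<n} - {i}. (z i)\<^sup>2 * (z j)\<^sup>2))"
      by (simp add: mult_ac)
    also have "\<dots> \<le> real m ^ 2 * (t * L / real n * (4 * real n)\<^sup>2)"
    proof (intro mult_left_mono mult_mono rate_binomial_le)
      have "(\<Sum>i<n. \<Sum>j\<in>{..<n} - {i}. (z i)\<^sup>2 * (z j)\<^sup>2) \<le> (\<Sum>i<n. \<Sum>j<n. (z i)\<^sup>2 * (z j)\<^sup>2)"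
        by (intro sum_mono sum_mono2) auto
      also have "\<dots> = (\<Sum>i<n. (z i)\<^sup>2)\<^sup>2"
        by (subst power2_eq_square, subst sum_product) (rule refl)
      also have "\<dots> \<le> (4 * real n)\<^sup>2" by (intro power_mono z sum_nonneg) auto
      finally show "(\<Sum>i<n. \<Sum>j\<in>{..<n} - {i}. (z i)\<^sup>2 * (z j)\<^sup>2) \<le> (4 * real n)\<^sup>2" .
    qed (use t L_pos in \<open>auto intro!: sum_nonneg\<close>)
    also have "\<dots> = real m ^ 2 * (16 * t * L * real n)"
      using n by (simp add: power2_eq_square)
    finally show ?thesis .
  qed
  have "measure_pmf.prob obs_law {A. (\<Sum>i<n. \<Sum>j<n. if \<bar>z i * z j\<bar> \<le> \<theta> then (G A i j - mean_G i j) * z i * z j else 0) \<ge> s} =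
      measure_pmf.prob obs_law {A. (\<Sum>e\<in>m_edges m n. (lam * c e) * present A e) \<ge> lam * (s + (\<Sum>e\<in>m_edges m n. \<pi> e * c e))}"
  proof (rule arg_cong[where f="measure_pmf.prob obs_law"], rule Collect_cong)
    fix A
    have "(\<Sum>e\<in>m_edges m n. (lam * c e) * present A e) = lam * (\<Sum>e\<in>m_edges m n. c e * present A e)"
      by (simp add: sum_distrib_left mult_ac)
    then show "((\<Sum>i<n. \<Sum>j<n. if \<bar>z i * z j\<bar> \<le> \<theta> then (G A i j - mean_G i j) * z i * z j else 0) \<ge> s) =
       ((\<Sum>e\<in>m_edges m n. (lam * c e) * present A e) \<ge> lam * (s + (\<Sum>e\<in>m_edges m n. \<pi> e * c e)))"
      unfolding sum_eq using lam by auto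
  qed
  also have "\<dots> \<le> exp (- (lam * (s + (\<Sum>e\<in>m_edges m n. \<pi> e * c e))) + (\<Sum>e\<in>m_edges m n. \<pi> e * (exp (lam * c e) - 1)))"
    by (rule chernoff_obs)
  also have "\<dots> \<le> exp (- (s / (real m ^ 2 * \<theta>)) + 16 * t * L * real n / (real m ^ 2 * \<theta>\<^sup>2))"
  proof -
    have "(\<Sum>e\<in>m_edges m n. \<pi> e * (exp (lam * c e) - 1)) \<le> (\<Sum>e\<in>m_edges m n. \<pi> e * (lam * c e + (lam * c e)\<^sup>2))"
    proof (intro sum_mono mult_left_mono exp_minus_one_le \<pi>_bounds)
      fix e assume "e \<in> m_edges m n"
      then have "lam * \<bar>c e\<bar> \<le> lam * (real m ^ 2 * \<theta>)" using lam c_bounds by (intro mult_left_mono) auto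
      then show "\<bar>lam * c e\<bar> \<le> 1" using lam \<theta> m by (simp add: abs_mult lam_def)
    qed
    also have "\<dots> = lam * (\<Sum>e\<in>m_edges m n. \<pi> e * c e) + lam\<^sup>2 * (\<Sum>e\<in>m_edges m n. \<pi> e * (c e)\<^sup>2)"
      by (simp add: sum_distrib_left sum.distrib[symmetric] power_mult_distrib algebra_simps)
    also have "\<dots> \<le> lam * (\<Sum>e\<in>m_edges m n. \<pi> e * c e) + lam\<^sup>2 * (real m ^ 2 * (16 * t * L * real n))"
      by (intro add_left_mono mult_left_mono var) auto
    also have "lam\<^sup>2 * (real m ^ 2 * (16 * t * L * real n)) = 16 * t * L * real n / (real m ^ 2 * \<theta>\<^sup>2)"
      using m \<theta> by (simp add: lam_def power2_eq_square mult_ac)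
    finally show ?thesis by (simp add: lam_def algebra_simps)
  qed
  finally show ?thesis .
qed

text \<open>The value of \<theta> turns the deviation \<open>L * n / 10\<close> into the exponent
  \<open>- 50 * n\<close>, and \<open>large\<close> is the condition that the variance term is at
  most \<open>n\<close>. What remains, \<open>- 49 * n\<close>, beats the number of lattice points,
  for which \<open>48 ^ n \<le> exp (48 * n)\<close> is enough.\<close>

lemma light_tail:
  assumes \<theta>: "\<theta> = L / (500 * real m ^ 2)" and large: "4000000 * t * real m ^ 2 \<le> L"
  shows "measure_pmf.prob obs_law {A. \<exists>z\<in>lattice_ball n.
      (\<Sum>i<n. \<Sum>j<n. if \<bar>of_int (z i) * of_int (z j)\<bar> \<le> \<theta>
        then (G A i j - mean_G i j) * of_int (z i) * of_int (z j) else 0) \<ge> L * real n / 10}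
    \<le> 1 / real n"
proof -
  have \<theta>pos: "\<theta> > 0" using L_pos m by (simp add: \<theta>)
  have single: "measure_pmf.prob obs_law {A.
      (\<Sum>i<n. \<Sum>j<n. if \<bar>of_int (z i) * of_int (z j)\<bar> \<le> \<theta>
        then (G A i j - mean_G i j) * of_int (z i) * of_int (z j) else 0) \<ge> L * real n / 10}
    \<le> exp (- (49 * real n))" if "z \<in> lattice_ball n" for z
  proof -
    have "real_of_int (\<Sum>i<n. (z i)\<^sup>2) \<le> real_of_int (4 * int n)"
      using that unfolding lattice_ball_def of_int_le_iff by simp
    then have "(\<Sum>i<n. (of_int (z i))\<^sup>2) \<le> 4 * real n" by simp
    from light_tail_single[OF this \<theta>pos, of "L * real n / 10"]
    have "measure_pmf.prob obs_law {A.
      (\<Sum>i<n. \<Sum>j<n. if \<bar>of_int (z i) * of_int (z j)\<bar> \<le> \<theta>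
        then (G A i j - mean_G i j) * of_int (z i) * of_int (z j) else 0) \<ge> L * real n / 10}
      \<le> exp (- (L * real n / 10 / (real m ^ 2 * \<theta>)) + 16 * t * L * real n / (real m ^ 2 * \<theta>\<^sup>2))" .
    also have "\<dots> \<le> exp (- (49 * real n))"
    proof -
      have "L * real n / 10 / (real m ^ 2 * \<theta>) = 50 * real n"
        using L_pos m by (simp add: \<theta> field_simps)
      moreover have "16 * t * L * real n / (real m ^ 2 * \<theta>\<^sup>2) = (4000000 * t * real m ^ 2) * (real n / L)"
        using L_pos m by (simp add: \<theta> field_simps power2_eq_square)
      moreover have "(4000000 * t * real m ^ 2) * (real n / L) \<le> L * (real n / L)"
        using large L_pos by (intro mult_right_mono) auto
      ultimately show ?thesis using L_pos by simp
    qed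
    finally show ?thesis .
  qed
  have "measure_pmf.prob obs_law {A. \<exists>z\<in>lattice_ball n.
      (\<Sum>i<n. \<Sum>j<n. if \<bar>of_int (z i) * of_int (z j)\<bar> \<le> \<theta>
        then (G A i j - mean_G i j) * of_int (z i) * of_int (z j) else 0) \<ge> L * real n / 10}
     \<le> (\<Sum>z\<in>lattice_ball n. exp (- (49 * real n)))"
    by (rule prob_bex_le[OF lattice_ball_card(1) single])
  also have "\<dots> = real (card (lattice_ball n)) * exp (- (49 * real n))" by simp
  also have "\<dots> \<le> exp (48 * real n) * exp (- (49 * real n))"
  proof (rule mult_right_mono)
    have "(48::real) \<le> exp 48" using exp_ge_add_one_self[of 48] by linarith
    then have "(48::real) ^ n \<le> exp 48 ^ n" by (intro power_mono) auto
    moreover have "exp (48 * real n) = exp 48 ^ n" by (simp add: exp_of_nat_mult mult.commute)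
    ultimately show "real (card (lattice_ball n)) \<le> exp (48 * real n)"
      using lattice_ball_card(2)[of n] by linarith
  qed simp
  also have "\<dots> = exp (- real n)" by (simp flip: exp_add)
  also have "\<dots> \<le> 1 / real n"
  proof -
    have "real n \<le> exp (real n)" using exp_ge_add_one_self[of "real n"] by linarith
    then show ?thesis using n by (simp add: exp_minus field_simps)
  qed
  finally show ?thesis .
qed

end

section \<open>Balanced communities\<close>

locale balanced_hsbm = censored_hsbm +
  fixes k :: nat
  assumes n_eq: "n = 2 * k"
    and labels: "\<And>i. i < n \<Longrightarrow> \<sigma> i \<in> {1, -1}"
    and bal: "balanced n \<sigma>"
begin

definition community :: "nat \<Rightarrow> nat set" where
  "community i = {j. j < n \<and> \<sigma> j = \<sigma> i}"

lemma labels_sq: "i < n \<Longrightarrow> \<sigma> i * \<sigma> i = 1"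
  using labels[of i] by auto

lemma sum_labels: "(\<Sum>i<n. \<sigma> i) = 0"
  using bal sum_labels_eq[OF labels] by (simp add: balanced_def)

lemma card_community:
  assumes "i < n"
  shows "card (community i) = k"
proof -
  have un: "{..<n} = community_pos n \<sigma> \<union> community_neg n \<sigma>"
    using labels by (auto simp: community_pos_def community_neg_def)
  have "card {..<n} = card (community_pos n \<sigma>) + card (community_neg n \<sigma>)"
    unfolding un by (rule card_Un_disjoint) (auto simp: community_pos_def community_neg_def)
  then have "card (community_pos n \<sigma>) = k" "card (community_neg n \<sigma>) = k"
    using bal n_eq by (auto simp: balanced_def)
  moreover have "community i = community_pos n \<sigma> \<or> community i = community_neg n \<sigma>"
    using labels[OF assms] by (auto simp: community_def community_pos_def community_neg_def)
  ultimately show ?thesis by auto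
qed

lemma edge_prob_community:
  assumes "e \<in> m_edges m n" "i \<in> e"
  shows "\<pi> e = \<alpha> * q + (if e \<subseteq> community i then \<alpha> * (p - q) else 0)"
proof -
  have i: "i < n" using assms by (auto simp: m_edges_def)
  have "(e \<subseteq> community_pos n \<sigma> \<or> e \<subseteq> community_neg n \<sigma>) = (e \<subseteq> community i)"
    using labels[OF i] assms(2) by (auto simp: community_def community_pos_def community_neg_def)
  then show ?thesis by (simp add: edge_prob_def algebra_simps)
qed

section \<open>Signed degrees: mean, variance and lower tail\<close>

text \<open>The contribution of a present hyperedge \<open>e\<close> to the signed degree
  \<open>D i\<close>: members agreeing with \<open>i\<close> count positively, the others
  negatively.\<close>

definition score :: "nat \<Rightarrow> nat set \<Rightarrow> real" where
  "score i e = (\<Sum>j\<in>e - {i}. \<sigma> i * \<sigma> j)"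

definition star :: "nat \<Rightarrow> nat set set" where
  "star i = {e \<in> m_edges m n. i \<in> e}"

lemma finite_star [simp]: "finite (star i)"
  by (simp add: star_def)

lemma starD:
  assumes "e \<in> star i"
  shows "e \<in> m_edges m n" "i \<in> e" "finite e" "card e = m" "e \<subseteq> {..<n}"
  using assms finite_m_edge[of e m n] by (auto simp: star_def m_edges_def)

lemma sum_star: "(\<Sum>e\<in>star i. f e) = (\<Sum>e\<in>m_edges m n. if i \<in> e then f e else (0::real))"
  unfolding star_def by (rule sum.inter_filter) simp

lemma card_star: "i < n \<Longrightarrow> card (star i) = (n - 1) choose (m - 1)"
  using card_m_edges_containing[of "{i}" n m] m by (simp add: star_def)

lemma card_star_community:
  assumes "i < n"
  shows "card {e \<in> star i. e \<subseteq> community i} = (k - 1) choose (m - 1)"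
proof -
  have "{e \<in> star i. e \<subseteq> community i} = {e. e \<subseteq> community i \<and> card e = m \<and> {i} \<subseteq> e}"
    by (auto simp: star_def m_edges_def community_def)
  moreover have "card \<dots> = (card (community i) - card {i}) choose (m - card {i})"
    by (rule card_edges_containing) (use assms m in \<open>auto simp: community_def\<close>)
  ultimately show ?thesis using card_community[OF assms] by simp
qed

lemma score_le:
  assumes "e \<in> star i"
  shows "\<bar>score i e\<bar> \<le> real (m - 1)"
proof -
  note e = starD[OF assms]
  have "\<bar>score i e\<bar> \<le> (\<Sum>j\<in>e - {i}. 1)"
    unfolding score_def
  proof (rule order_trans[OF sum_abs sum_mono])
    fix j assume "j \<in> e - {i}"
    then have "\<sigma> i \<in> {1,-1}" "\<sigma> j \<in> {1,-1}" using e labels by auto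
    then show "\<bar>\<sigma> i * \<sigma> j\<bar> \<le> 1" by auto
  qed
  then show ?thesis using e by simp
qed

lemma score_community:
  assumes "e \<in> star i" "e \<subseteq> community i"
  shows "score i e = real (m - 1)"
proof -
  note e = starD[OF assms(1)]
  have "score i e = (\<Sum>j\<in>e - {i}. 1)"
    unfolding score_def
  proof (rule sum.cong[OF refl])
    fix j assume "j \<in> e - {i}"
    then have "\<sigma> j = \<sigma> i" using assms(2) by (auto simp: community_def)
    then show "\<sigma> i * \<sigma> j = 1" using labels_sq e by auto
  qed
  then show ?thesis using e by simp
qed

lemma row_score:
  assumes "i < n"
  shows "(\<Sum>j<n. \<sigma> i * \<sigma> j * pair_weight w m n i j) = (\<Sum>e\<in>star i. w e * score i e)"
proof -
  have "(\<Sum>j<n. \<sigma> i * \<sigma> j * pair_weight w m n i j) = (\<Sum>j<n. pair_weight w m n i j * (\<sigma> i * \<sigma> j))"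
    by (intro sum.cong refl) (rule mult.commute)
  also have "\<dots> = (\<Sum>e\<in>star i. w e * score i e)"
    unfolding row_pair_weight[OF assms] sum_star score_def ..
  finally show ?thesis .
qed

lemma sum_labels_Diff: "i < n \<Longrightarrow> (\<Sum>j\<in>{..<n} - {i}. \<sigma> j) = - \<sigma> i"
  using sum.remove[of "{..<n}" i \<sigma>] sum_labels by simp

text \<open>Balance makes the scores nearly cancel: the labels other than that of \<open>i\<close>
  sum to \<open>- \<sigma> i\<close>. The remainder has order \<open>n ^ (m - 2)\<close>, one power
  of \<open>n\<close> below the size of the star.\<close>

lemma sum_score:
  assumes "i < n"
  shows "(\<Sum>e\<in>star i. score i e) = - real ((n - 2) choose (m - 2))"
proof -
  have "(\<Sum>e\<in>star i. score i e) = (\<Sum>j<n. \<sigma> i * \<sigma> j * pair_weight (\<lambda>_. 1) m n i j)"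
    using row_score[OF assms, of "\<lambda>_. 1"] by simp
  also have "\<dots> = (\<Sum>j\<in>{..<n} - {i}. \<sigma> i * \<sigma> j * pair_weight (\<lambda>_. 1) m n i j)"
    by (rule sum.mono_neutral_right) (auto simp: pair_weight_def)
  also have "\<dots> = (\<Sum>j\<in>{..<n} - {i}. (\<sigma> i * real ((n - 2) choose (m - 2))) * \<sigma> j)"
    by (rule sum.cong) (use assms m in \<open>auto simp: pair_weight_one\<close>)
  also have "\<dots> = - real ((n - 2) choose (m - 2))"
    unfolding sum_distrib_left[symmetric] sum_labels_Diff[OF assms]
    using labels_sq[OF assms] by (simp add: mult_ac)
  finally show ?thesis .
qed

text \<open>The off-diagonal terms of \<open>(score i e)\<^sup>2\<close> sum to a nonpositive number because the labels
  other than \<open>\<sigma> i\<close> sum to \<open>- \<sigma> i\<close>.\<close>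

lemma sum_score_sq:
  assumes i: "i < n"
  shows "(\<Sum>e\<in>star i. (score i e)\<^sup>2) \<le> real (m - 1) * real ((n - 1) choose (m - 1))"
proof -
  define f where "f j l = (if j = i \<or> l = i then 0 else \<sigma> j * \<sigma> l)" for j l
  \<comment> \<open>The number of hyperedges through three distinct nodes. The case
    \<open>m = 2\<close> is separate because truncated subtraction would give
    \<open>(n - 3) choose 0 = 1\<close> instead of 0.\<close>
  define N where "N = (if m \<ge> 3 then (n - 3) choose (m - 3) else 0)"
  \<comment> \<open>As a weight, this indicator restricts \<open>sum_pair_weight\<close> to the
    hyperedges through \<open>i\<close>, while \<open>f\<close> masks the pairs that use
    \<open>i\<close> itself.\<close>
  define w where "w e = (if i \<in> e then 1 else (0::real))" for e :: "nat set"
  have sq: "(score i e)\<^sup>2 = real (m - 1) + (\<Sum>j\<in>e. \<Sum>l\<in>e - {j}. f j l)" if "e \<in> star i" for e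
  proof -
    note e = starD[OF that]
    let ?e = "e - {i}"
    have "score i e = \<sigma> i * (\<Sum>j\<in>?e. \<sigma> j)"
      unfolding score_def by (rule sum_distrib_left[symmetric])
    then have "(score i e)\<^sup>2 = (\<sigma> i * \<sigma> i) * ((\<Sum>j\<in>?e. \<sigma> j) * (\<Sum>l\<in>?e. \<sigma> l))"
      by (simp add: power2_eq_square mult_ac)
    also have "\<dots> = (\<Sum>j\<in>?e. \<Sum>l\<in>?e. \<sigma> j * \<sigma> l)"
      by (simp add: labels_sq[OF i] sum_product)
    also have "\<dots> = (\<Sum>j\<in>?e. 1 + (\<Sum>l\<in>?e - {j}. \<sigma> j * \<sigma> l))"
    proof (rule sum.cong[OF refl])
      fix j assume j: "j \<in> ?e"
      have "(\<Sum>l\<in>?e. \<sigma> j * \<sigma> l) = \<sigma> j * \<sigma> j + (\<Sum>l\<in>?e - {j}. \<sigma> j * \<sigma> l)"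
        by (rule sum.remove) (use e j in auto)
      then show "(\<Sum>l\<in>?e. \<sigma> j * \<sigma> l) = 1 + (\<Sum>l\<in>?e - {j}. \<sigma> j * \<sigma> l)"
        using labels_sq[of j] e j by auto
    qed
    also have "\<dots> = real (m - 1) + (\<Sum>j\<in>?e. \<Sum>l\<in>?e - {j}. \<sigma> j * \<sigma> l)"
      using e by (simp add: sum.distrib)
    also have "(\<Sum>j\<in>?e. \<Sum>l\<in>?e - {j}. \<sigma> j * \<sigma> l) = (\<Sum>j\<in>?e. \<Sum>l\<in>e - {j}. f j l)"
    proof (rule sum.cong[OF refl])
      fix j assume j: "j \<in> ?e"
      have "(\<Sum>l\<in>e - {j}. f j l) = (\<Sum>l\<in>?e - {j}. f j l)"
        by (rule sum.mono_neutral_right) (use e in \<open>auto simp: f_def\<close>)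
      also have "\<dots> = (\<Sum>l\<in>?e - {j}. \<sigma> j * \<sigma> l)"
        by (rule sum.cong) (use j in \<open>auto simp: f_def\<close>)
      finally show "(\<Sum>l\<in>?e - {j}. \<sigma> j * \<sigma> l) = (\<Sum>l\<in>e - {j}. f j l)" ..
    qed
    also have "\<dots> = (\<Sum>j\<in>e. \<Sum>l\<in>e - {j}. f j l)"
      by (rule sum.mono_neutral_left) (use e in \<open>auto simp: f_def\<close>)
    finally show ?thesis .
  qed
  have pw: "pair_weight w m n j l * f j l = real N * (if j = l then 0 else f j l)" if "j < n" "l < n" for j l
  proof (cases "j = l \<or> j = i \<or> l = i")
    case True
    then show ?thesis by (auto simp: pair_weight_def f_def)
  next
    case False
    have "pair_weight w m n j l = (\<Sum>e | e \<in> m_edges m n \<and> j \<in> e \<and> l \<in> e. w e)"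
      using False by (simp add: pair_weight_def)
    also have "\<dots> = real (card {e \<in> {e \<in> m_edges m n. j \<in> e \<and> l \<in> e}. i \<in> e})"
      unfolding w_def by (subst sum.inter_filter[symmetric]) auto
    also have "{e \<in> {e \<in> m_edges m n. j \<in> e \<and> l \<in> e}. i \<in> e} = {e \<in> m_edges m n. {i, j, l} \<subseteq> e}" by auto
    also have "card \<dots> = N"
    proof (cases "m \<ge> 3")
      case True
      then show ?thesis
        using card_m_edges_containing[of "{i, j, l}" n m] False i that
        by (simp add: N_def numeral_3_eq_3)
    next
      case m3: False
      have "\<not> {i, j, l} \<subseteq> e" if "e \<in> m_edges m n" for e
      proof
        assume "{i, j, l} \<subseteq> e"
        from card_mono[OF finite_m_edge[OF that] this] show False
          using False m3 card_m_edge[OF that] by simp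
      qed
      then have "{e \<in> m_edges m n. {i, j, l} \<subseteq> e} = {}" by blast
      then show ?thesis using m3 by (simp add: N_def)
    qed
    finally show ?thesis using False by simp
  qed
  \<comment> \<open>The square of the sum of the other labels is 1, and its \<open>n - 1\<close>
    diagonal terms are each 1.\<close>
  have cross: "(\<Sum>j<n. \<Sum>l<n. if j = l then 0 else f j l) = 1 - real (n - 1)"
  proof -
    let ?V = "{..<n} - {i}"
    have "(\<Sum>j<n. \<Sum>l<n. if j = l then 0 else f j l) = (\<Sum>j\<in>?V. \<Sum>l<n. if j = l then 0 else f j l)"
      by (rule sum.mono_neutral_right) (auto simp: f_def intro!: sum.neutral split: if_splits)
    also have "\<dots> = (\<Sum>j\<in>?V. (\<Sum>l\<in>?V. \<sigma> j * \<sigma> l) - 1)"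
    proof (rule sum.cong[OF refl])
      fix j assume j: "j \<in> ?V"
      have "(\<Sum>l<n. if j = l then 0 else f j l) = (\<Sum>l\<in>?V - {j}. if j = l then 0 else f j l)"
        by (rule sum.mono_neutral_right) (auto simp: f_def)
      also have "\<dots> = (\<Sum>l\<in>?V - {j}. \<sigma> j * \<sigma> l)"
        by (rule sum.cong) (use j in \<open>auto simp: f_def\<close>)
      also have "\<dots> = (\<Sum>l\<in>?V. \<sigma> j * \<sigma> l) - \<sigma> j * \<sigma> j"
        using j by (simp add: sum_diff1)
      finally show "(\<Sum>l<n. if j = l then 0 else f j l) = (\<Sum>l\<in>?V. \<sigma> j * \<sigma> l) - 1"
        using labels_sq[of j] j by simp
    qed
    also have "\<dots> = (\<Sum>j\<in>?V. \<sigma> j) * (\<Sum>l\<in>?V. \<sigma> l) - real (card ?V)"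
      by (simp only: sum_subtractf sum_product) simp
    also have "\<dots> = 1 - real (n - 1)"
      using sum_labels_Diff[OF i] labels_sq[OF i] i by simp
    finally show ?thesis .
  qed
  have "(\<Sum>e\<in>star i. (score i e)\<^sup>2) = (\<Sum>e\<in>star i. real (m - 1) + (\<Sum>j\<in>e. \<Sum>l\<in>e - {j}. f j l))"
    by (intro sum.cong refl sq)
  also have "\<dots> = real (m - 1) * real (card (star i)) + (\<Sum>e\<in>star i. \<Sum>j\<in>e. \<Sum>l\<in>e - {j}. f j l)"
    by (simp add: sum.distrib)
  also have "(\<Sum>e\<in>star i. \<Sum>j\<in>e. \<Sum>l\<in>e - {j}. f j l) = (\<Sum>e\<in>m_edges m n. w e * (\<Sum>j\<in>e. \<Sum>l\<in>e - {j}. f j l))"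
    unfolding sum_star by (intro sum.cong refl) (simp add: w_def)
  also have "\<dots> = (\<Sum>j<n. \<Sum>l<n. pair_weight w m n j l * f j l)"
    by (rule sum_pair_weight[symmetric])
  also have "\<dots> = (\<Sum>j<n. \<Sum>l<n. real N * (if j = l then 0 else f j l))"
    by (intro sum.cong refl pw) auto
  also have "\<dots> = real N * (1 - real (n - 1))"
    by (simp only: sum_distrib_left[symmetric] cross)
  also have "\<dots> \<le> 0" using n by (intro mult_nonneg_nonpos) auto
  finally show ?thesis by (simp add: card_star[OF i])
qed

text \<open>The baseline probability \<open>\<alpha> * q\<close> meets nearly cancelling scores. The
  excess \<open>\<alpha> * (p - q)\<close> sits only on hyperedges inside the community of
  \<open>i\<close>, all of which have the maximal score \<open>m - 1\<close>.\<close>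

lemma mean_row:
  assumes i: "i < n"
  shows "(\<Sum>e\<in>star i. \<pi> e * score i e) =
    \<alpha> * (p - q) * (real (m - 1) * real ((k - 1) choose (m - 1))) - \<alpha> * q * real ((n - 2) choose (m - 2))"
proof -
  have "(\<Sum>e\<in>star i. \<pi> e * score i e) =
      (\<Sum>e\<in>star i. \<alpha> * q * score i e + (if e \<subseteq> community i then \<alpha> * (p - q) * real (m - 1) else 0))"
  proof (rule sum.cong[OF refl])
    fix e assume e: "e \<in> star i"
    show "\<pi> e * score i e = \<alpha> * q * score i e + (if e \<subseteq> community i then \<alpha> * (p - q) * real (m - 1) else 0)"
      using edge_prob_community[OF starD(1,2)[OF e]] score_community[OF e]
      by (cases "e \<subseteq> community i") (simp_all add: distrib_right)
  qed
  also have "\<dots> = \<alpha> * q * (\<Sum>e\<in>star i. score i e) +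
      \<alpha> * (p - q) * real (m - 1) * real (card {e \<in> star i. e \<subseteq> community i})"
    by (simp add: sum.distrib sum_distrib_left sum.inter_filter[symmetric])
  finally show ?thesis by (simp add: sum_score[OF i] card_star_community[OF i])
qed

text \<open>For the baseline part, \<open>sum_score_sq\<close> gives the factor \<open>m - 1\<close>
  where the maximal score would give its square. The constant \<open>B\<close> in
  \<open>score_tail\<close> has no room for the extra factor when \<open>m\<close> is large.\<close>

lemma variance_row:
  assumes i: "i < n"
  shows "(\<Sum>e\<in>star i. \<pi> e * (score i e)\<^sup>2) \<le>
    \<alpha> * q * (real (m - 1) * real ((n - 1) choose (m - 1))) +
    \<alpha> * (p - q) * (real (m - 1) ^ 2 * real ((k - 1) choose (m - 1)))"
proof -
  have "(\<Sum>e\<in>star i. \<pi> e * (score i e)\<^sup>2) =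
      (\<Sum>e\<in>star i. \<alpha> * q * (score i e)\<^sup>2 + (if e \<subseteq> community i then \<alpha> * (p - q) * real (m - 1) ^ 2 else 0))"
  proof (rule sum.cong[OF refl])
    fix e assume e: "e \<in> star i"
    show "\<pi> e * (score i e)\<^sup>2 = \<alpha> * q * (score i e)\<^sup>2 + (if e \<subseteq> community i then \<alpha> * (p - q) * real (m - 1) ^ 2 else 0)"
      using edge_prob_community[OF starD(1,2)[OF e]] score_community[OF e]
      by (cases "e \<subseteq> community i") (simp_all add: distrib_right)
  qed
  also have "\<dots> = \<alpha> * q * (\<Sum>e\<in>star i. (score i e)\<^sup>2) +
      \<alpha> * (p - q) * real (m - 1) ^ 2 * real (card {e \<in> star i. e \<subseteq> community i})"
    by (simp add: sum.distrib sum_distrib_left sum.inter_filter[symmetric])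
  also have "\<dots> \<le> \<alpha> * q * (real (m - 1) * real ((n - 1) choose (m - 1))) +
      \<alpha> * (p - q) * real (m - 1) ^ 2 * real (card {e \<in> star i. e \<subseteq> community i})"
    using rate_nonneg pq by (intro add_right_mono mult_left_mono sum_score_sq[OF i]) auto
  finally show ?thesis by (simp add: card_star_community[OF i] mult_ac)
qed

text \<open>To leading order the mean of \<open>D i\<close> is \<open>(p - q) * T\<close>, and its
  variance is at most \<open>B * T\<close>. The exponent
  \<open>- lam * (p - q) * T + lam^2 * B * T\<close> has minimum \<open>- Q / 4\<close>, and the
  threshold on \<open>t\<close> says precisely that \<open>Q > 8 * L\<close>. After the losses from
  finite \<open>n\<close> and from asking for \<open>L / 2\<close> rather than 0, a decay
  \<open>exp (- (3 / 2 * L))\<close> remains, so the union over the nodes still leaves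
  \<open>1 / sqrt n\<close>.\<close>

lemma score_tail:
  assumes thr: "t > J_threshold m p q"
    and ratio: "15 / 16 * real k ^ (m - 1) \<le> fact (m - 1) * real ((k - 1) choose (m - 1))"
    and small: "t / real n \<le> 1 / 4"
  shows "measure_pmf.prob obs_law {A. \<exists>i<n. (\<Sum>j<n. \<sigma> i * \<sigma> j * G A i j) \<le> L / 2} \<le> 1 / sqrt (real n)"
proof -
  \<comment> \<open>\<open>B\<close> is the bracket of \<open>J_threshold\<close>, rearranged. Since
    it contains \<open>m * (p - q)\<close>, the optimal \<open>lam\<close> below satisfies
    \<open>lam * m \<le> 1 / 2\<close>, within the range of the quadratic bound for
    \<open>exp\<close>.\<close>
  define B where "B = real m * (p - q) + 2 ^ m * q"
  define K where "K = 2 ^ (m - 1) * (fact (m - 2) :: real)"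
  define T where "T = t * L / K"
  define lam where "lam = (p - q) / (2 * B)"
  define Q where "Q = T * (p - q)\<^sup>2 / B"
  have mB: "real m * (p - q) \<le> B" using pq by (simp add: B_def)
  moreover have "real m * (p - q) > 0" using pq m by simp
  ultimately have B: "B > 0" by linarith
  have K: "K > 0" by (simp add: K_def)
  have T: "T > 0" using t L_pos K by (simp add: T_def)
  have lam: "lam > 0" using pq B by (simp add: lam_def)
  have lam_m: "lam * real m \<le> 1 / 2"
  proof -
    have "lam * real m = real m * (p - q) / (2 * B)" by (simp add: lam_def mult.commute)
    also have "\<dots> \<le> B / (2 * B)" using mB B by (intro divide_right_mono) auto
    finally show ?thesis using B by simp
  qed
  have lam4: "lam \<le> 1 / 4"
  proof -
    have "lam * 2 \<le> lam * real m" using lam m by (intro mult_left_mono) auto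
    then show ?thesis using lam_m by linarith
  qed
  have Q: "Q > 8 * L"
  proof -
    \<comment> \<open>The substitution removes the truncated subtractions. The factor 8 comes from
      \<open>2 ^ (m + 2) = 8 * 2 ^ (m - 1)\<close>.\<close>
    obtain r where r: "m = r + 2" using m by (metis add.commute le_Suc_ex)
    have "J_threshold m p q = 8 * K * B / (p - q)\<^sup>2"
      by (simp add: J_threshold_def K_def B_def r algebra_simps)
    then have "8 * K * B / (p - q)\<^sup>2 < t" using thr by simp
    moreover have "(p - q)\<^sup>2 > 0" using pq by simp
    ultimately have "8 * K * B < t * (p - q)\<^sup>2" by (simp add: field_simps)
    then have "8 < t * (p - q)\<^sup>2 / (K * B)" using K B by (simp add: field_simps)
    then have "L * 8 < L * (t * (p - q)\<^sup>2 / (K * B))" using L_pos by (rule mult_strict_left_mono)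
    then show ?thesis by (simp add: Q_def T_def mult_ac)
  qed
  have fact_m: "fact (m - 1) = real (m - 1) * fact (m - 2)"
    using m by (subst fact_reduce) (auto simp: numeral_2_eq_2)
  have pow_n: "real n ^ (m - 1) = 2 ^ (m - 1) * real k ^ (m - 1)"
    by (simp add: n_eq power_mult_distrib)
  have npos: "real n ^ (m - 1) > 0" using n by simp
  have m1: "real (m - 1) > 0" using m by simp
  have kpos: "real k > 0" using n n_eq by simp
  have T_eq: "\<alpha> * real k ^ (m - 1) = T * fact (m - 2)"
    using kpos unfolding rate_eq pow_n T_def K_def by (simp add: field_simps)
  have mean_low: "\<alpha> * (real (m - 1) * real ((k - 1) choose (m - 1))) \<ge> 15 / 16 * T"
  proof -
    have "15 / 16 * T * fact (m - 2) = \<alpha> * (15 / 16 * real k ^ (m - 1))" by (simp add: T_eq[symmetric])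
    also have "\<dots> \<le> \<alpha> * (fact (m - 1) * real ((k - 1) choose (m - 1)))"
      by (intro mult_left_mono ratio rate_nonneg)
    also have "\<dots> = \<alpha> * (real (m - 1) * real ((k - 1) choose (m - 1))) * fact (m - 2)"
      by (simp only: fact_m mult_ac)
    finally show ?thesis by (simp only: mult_le_cancel_right_pos fact_gt_zero)
  qed
  have upper: "\<alpha> * (real (m - 1) * real ((N - 1) choose (m - 1))) * fact (m - 2) \<le> \<alpha> * real N ^ (m - 1)" for N
  proof -
    have "real (m - 1) * real ((N - 1) choose (m - 1)) * fact (m - 2) = fact (m - 1) * real ((N - 1) choose (m - 1))"
      by (simp only: fact_m mult_ac)
    also have "\<dots> \<le> real (N - 1) ^ (m - 1)" by (rule fact_binomial_le)
    also have "\<dots> \<le> real N ^ (m - 1)" by (intro power_mono) auto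
    finally have "\<alpha> * (real (m - 1) * real ((N - 1) choose (m - 1)) * fact (m - 2)) \<le> \<alpha> * real N ^ (m - 1)"
      using rate_nonneg by (rule mult_left_mono)
    then show ?thesis by (simp add: mult_ac)
  qed
  have var_k: "\<alpha> * (real (m - 1) * real ((k - 1) choose (m - 1))) \<le> T"
    using upper[of k] unfolding T_eq by (simp only: mult_le_cancel_right_pos fact_gt_zero)
  have var_n: "\<alpha> * (real (m - 1) * real ((n - 1) choose (m - 1))) \<le> 2 ^ (m - 1) * T"
  proof -
    have "\<alpha> * real n ^ (m - 1) = 2 ^ (m - 1) * T * fact (m - 2)"
    proof -
      have "\<alpha> * real n ^ (m - 1) = 2 ^ (m - 1) * (\<alpha> * real k ^ (m - 1))" by (simp only: pow_n mult_ac)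
      then show ?thesis unfolding T_eq by (simp only: mult_ac)
    qed
    then show ?thesis using upper[of n] by (simp only: mult_le_cancel_right_pos fact_gt_zero)
  qed
  have single: "measure_pmf.prob obs_law {A. (\<Sum>j<n. \<sigma> i * \<sigma> j * G A i j) \<le> L / 2} \<le> exp (- (3 / 2 * L))"
    if i: "i < n" for i
  proof -
    define c where "c e = (if i \<in> e then - (lam * score i e) else 0)" for e
    have row: "(\<Sum>e\<in>m_edges m n. c e * present A e) = - (lam * (\<Sum>j<n. \<sigma> i * \<sigma> j * G A i j))" for A
    proof -
      have "(\<Sum>e\<in>m_edges m n. c e * present A e) = (\<Sum>e\<in>star i. - lam * (present A e * score i e))"
        unfolding sum_star by (intro sum.cong refl) (simp add: c_def)
      also have "\<dots> = - lam * (\<Sum>e\<in>star i. present A e * score i e)" by (rule sum_distrib_left[symmetric])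
      finally show ?thesis using row_score[OF i, of "present A"] by simp
    qed
    have "measure_pmf.prob obs_law {A. (\<Sum>j<n. \<sigma> i * \<sigma> j * G A i j) \<le> L / 2} =
        measure_pmf.prob obs_law {A. (\<Sum>e\<in>m_edges m n. c e * present A e) \<ge> - (lam * (L / 2))}"
      unfolding row using lam by simp
    also have "\<dots> \<le> exp (- (- (lam * (L / 2))) + (\<Sum>e\<in>m_edges m n. \<pi> e * (exp (c e) - 1)))"
      by (rule chernoff_obs)
    also have "\<dots> \<le> exp (- (3 / 2 * L))"
    proof -
      have "(\<Sum>e\<in>m_edges m n. \<pi> e * (exp (c e) - 1)) =
          (\<Sum>e\<in>star i. \<pi> e * (exp (- (lam * score i e)) - 1))"
        unfolding sum_star by (intro sum.cong refl) (simp add: c_def)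
      also have "\<dots> \<le> (\<Sum>e\<in>star i. \<pi> e * (- (lam * score i e) + (- (lam * score i e))\<^sup>2))"
      proof (intro sum_mono mult_left_mono exp_minus_one_le \<pi>_bounds)
        fix e assume "e \<in> star i"
        then have s: "\<bar>score i e\<bar> \<le> real m" using score_le[of e i] by linarith
        have "lam * \<bar>score i e\<bar> \<le> lam * real m" by (rule mult_left_mono[OF s]) (use lam in simp)
        moreover have "\<bar>- (lam * score i e)\<bar> = lam * \<bar>score i e\<bar>" using lam by (simp add: abs_mult)
        ultimately show "\<bar>- (lam * score i e)\<bar> \<le> 1" using lam_m by linarith
      qed
      also have "\<dots> = - lam * (\<Sum>e\<in>star i. \<pi> e * score i e) + lam\<^sup>2 * (\<Sum>e\<in>star i. \<pi> e * (score i e)\<^sup>2)"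
        by (simp add: sum_distrib_left sum.distrib[symmetric] sum_negf[symmetric] power_mult_distrib algebra_simps)
      also have "\<dots> \<le> - lam * ((p - q) * (15 / 16 * T) - q * (t * L / real n)) + lam\<^sup>2 * (T * B)"
      proof (rule add_mono)
        have "(p - q) * (15 / 16 * T) \<le> (p - q) * (\<alpha> * (real (m - 1) * real ((k - 1) choose (m - 1))))"
          using mean_low pq by (intro mult_left_mono) auto
        moreover have "q * (\<alpha> * real ((n - 2) choose (m - 2))) \<le> q * (t * L / real n)"
          using rate_binomial_le pq by (intro mult_left_mono) auto
        ultimately have "(p - q) * (15 / 16 * T) - q * (t * L / real n) \<le> (\<Sum>e\<in>star i. \<pi> e * score i e)"
          unfolding mean_row[OF i] by (simp add: mult_ac)
        then show "- lam * (\<Sum>e\<in>star i. \<pi> e * score i e) \<le> - lam * ((p - q) * (15 / 16 * T) - q * (t * L / real n))"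
          using lam by (intro mult_left_mono_neg) auto
        have "(\<Sum>e\<in>star i. \<pi> e * (score i e)\<^sup>2) \<le>
            q * (\<alpha> * (real (m - 1) * real ((n - 1) choose (m - 1)))) +
            (p - q) * real (m - 1) * (\<alpha> * (real (m - 1) * real ((k - 1) choose (m - 1))))"
          using variance_row[OF i] by (simp add: power2_eq_square mult_ac)
        also have "\<dots> \<le> q * (2 ^ (m - 1) * T) + (p - q) * real (m - 1) * T"
          using var_n var_k pq by (intro add_mono mult_left_mono) auto
        also have "\<dots> = T * ((p - q) * real (m - 1) + q * 2 ^ (m - 1))" by (simp add: algebra_simps)
        also have "\<dots> \<le> T * B"
        proof (intro mult_left_mono)
          have "(p - q) * real (m - 1) \<le> (p - q) * real m" using pq by (intro mult_left_mono) auto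
          moreover have "q * 2 ^ (m - 1) \<le> q * 2 ^ m" using pq by (intro mult_left_mono power_increasing) auto
          ultimately show "(p - q) * real (m - 1) + q * 2 ^ (m - 1) \<le> B" by (simp add: B_def mult.commute)
        qed (use T in simp)
        finally show "lam\<^sup>2 * (\<Sum>e\<in>star i. \<pi> e * (score i e)\<^sup>2) \<le> lam\<^sup>2 * (T * B)"
          by (intro mult_left_mono) auto
      qed
      also have "\<dots> = - (15 / 32 * Q) + lam * q * (t / real n) * L + Q / 4"
      proof -
        have eqs: "lam * ((p - q) * T) = Q / 2" "lam\<^sup>2 * (T * B) = Q / 4"
          using B by (simp_all add: lam_def Q_def power2_eq_square mult_ac)
        have "- lam * ((p - q) * (15 / 16 * T) - q * (t * L / real n)) =
            - (15 / 16 * (lam * ((p - q) * T))) + lam * q * (t / real n) * L"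
          by (simp only: right_diff_distrib) (simp add: mult_ac)
        then show ?thesis unfolding eqs by simp
      qed
      also have "lam * q * (t / real n) * L \<le> (1 / 4 * 1 * (1 / 4)) * L"
        using lam lam4 pq small t n L_pos by (intro mult_right_mono mult_mono) auto
      finally have "(\<Sum>e\<in>m_edges m n. \<pi> e * (exp (c e) - 1)) \<le> - (7 / 32 * Q) + L / 16" by simp
      moreover have "lam * (L / 2) \<le> 1 / 4 * (L / 2)" using lam4 L_pos by (intro mult_right_mono) auto
      \<comment> \<open>With \<open>Q > 8 * L\<close> the exponent is below
        \<open>- 7 / 4 + 1 / 16 + 1 / 8 = - 25 / 16\<close> times \<open>L\<close>.\<close>
      ultimately have "- (- (lam * (L / 2))) + (\<Sum>e\<in>m_edges m n. \<pi> e * (exp (c e) - 1)) \<le> - (3 / 2 * L)"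
        using Q L_pos by linarith
      then show ?thesis by (simp only: exp_le_cancel_iff)
    qed
    finally show ?thesis .
  qed
  have "measure_pmf.prob obs_law {A. \<exists>i\<in>{..<n}. (\<Sum>j<n. \<sigma> i * \<sigma> j * G A i j) \<le> L / 2} \<le>
      (\<Sum>i<n. exp (- (3 / 2 * L)))"
    by (intro prob_bex_le single) auto
  also have "\<dots> = exp L * exp (- (3 / 2 * L))" using n by simp
  also have "\<dots> = exp (- (L / 2))" by (simp flip: exp_add)
  also have "\<dots> = 1 / sqrt (real n)"
    using n by (simp add: exp_minus ln_sqrt[symmetric] inverse_eq_divide)
  finally show ?thesis by (simp add: Bex_def)
qed

section \<open>The expected graph and the combination of the tail bounds\<close>

lemma mean_G_eq:
  assumes ij: "i < n" "j < n" "i \<noteq> j"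
  shows "mean_G i j = \<alpha> * q * real ((n - 2) choose (m - 2)) +
    \<alpha> * (p - q) * real ((k - 2) choose (m - 2)) * ((1 + \<sigma> i * \<sigma> j) / 2)"
proof -
  let ?E = "{e \<in> m_edges m n. {i, j} \<subseteq> e}"
  have cE: "card ?E = (n - 2) choose (m - 2)"
    using card_m_edges_containing[of "{i, j}" n m] ij m by (simp add: numeral_2_eq_2)
  have "mean_G i j = (\<Sum>e\<in>?E. \<pi> e)" using ij by (simp add: pair_weight_def)
  also have "\<dots> = (\<Sum>e\<in>?E. \<alpha> * q + (if e \<subseteq> community i then \<alpha> * (p - q) else 0))"
    by (intro sum.cong refl edge_prob_community) auto
  also have "\<dots> = \<alpha> * q * real ((n - 2) choose (m - 2)) + \<alpha> * (p - q) * real (card {e \<in> ?E. e \<subseteq> community i})"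
    by (simp add: sum.distrib sum.inter_filter[symmetric] cE[simplified])
  also have "real (card {e \<in> ?E. e \<subseteq> community i}) = real ((k - 2) choose (m - 2)) * ((1 + \<sigma> i * \<sigma> j) / 2)"
  proof (cases "\<sigma> i = \<sigma> j")
    case True
    have "{e \<in> ?E. e \<subseteq> community i} = {e. e \<subseteq> community i \<and> card e = m \<and> {i, j} \<subseteq> e}"
      by (auto simp: m_edges_def community_def)
    moreover have "card \<dots> = (card (community i) - card {i, j}) choose (m - card {i, j})"
      by (rule card_edges_containing) (use ij m True in \<open>auto simp: community_def\<close>)
    ultimately show ?thesis
      using card_community[OF ij(1)] ij True labels_sq[OF ij(2)] by (simp add: numeral_2_eq_2)
  next
    case False
    then have "{e \<in> ?E. e \<subseteq> community i} = {}" by (auto simp: community_def)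
    moreover have "\<sigma> i * \<sigma> j = -1" using False labels[OF ij(1)] labels[OF ij(2)] by auto
    ultimately show ?thesis by simp
  qed
  finally show ?thesis by (simp add: mult_ac)
qed

text \<open>Off the diagonal the mean equals \<open>b + c * \<sigma> i * \<sigma> j\<close>, a
  combination of two rank one matrices that vanish at \<open>x\<close>. The diagonal of the mean is
  0, not \<open>b + c\<close>, and this discrepancy is the nonpositive multiple of the
  identity.\<close>

lemma quad_form_mean_G_nonpos:
  assumes "(\<Sum>i<n. x i) = 0" "(\<Sum>i<n. \<sigma> i * x i) = 0"
  shows "quad_form n mean_G x \<le> 0"
proof -
  define c where "c = \<alpha> * (p - q) * real ((k - 2) choose (m - 2)) / 2"
  define b where "b = \<alpha> * q * real ((n - 2) choose (m - 2)) + c"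
  have nn: "0 \<le> c" "0 \<le> b" using rate_nonneg pq by (auto simp: b_def c_def)
  have "quad_form n mean_G x = (\<Sum>i<n. \<Sum>j<n. b * (x i * x j) + c * (\<sigma> i * x i * (\<sigma> j * x j)) - (if i = j then (b + c) * (x i)\<^sup>2 else 0))"
    unfolding quad_form_def
  proof (intro sum.cong refl)
    fix i j assume ij: "i \<in> {..<n}" "j \<in> {..<n}"
    show "mean_G i j * x i * x j = b * (x i * x j) + c * (\<sigma> i * x i * (\<sigma> j * x j)) - (if i = j then (b + c) * (x i)\<^sup>2 else 0)"
    proof (cases "i = j")
      case True
      have "\<sigma> i * x i * (\<sigma> i * x i) = (\<sigma> i * \<sigma> i) * (x i)\<^sup>2" by (simp add: power2_eq_square mult_ac)
      then show ?thesis using True labels_sq ij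
        by (simp add: pair_weight_def power2_eq_square algebra_simps)
    next
      case False
      have c2: "\<alpha> * (p - q) * real ((k - 2) choose (m - 2)) = 2 * c" by (simp add: c_def)
      have "mean_G i j = b + c * (\<sigma> i * \<sigma> j)"
        using mean_G_eq[of i j] ij False unfolding c2 by (simp add: b_def distrib_left)
      then show ?thesis using False by (simp add: algebra_simps)
    qed
  qed
  also have "\<dots> = b * ((\<Sum>i<n. x i) * (\<Sum>j<n. x j)) + c * ((\<Sum>i<n. \<sigma> i * x i) * (\<Sum>j<n. \<sigma> j * x j)) - (\<Sum>i<n. (b + c) * (x i)\<^sup>2)"
  proof -
    have prod: "a * ((\<Sum>i<n. f i) * (\<Sum>j<n. f j)) = (\<Sum>i<n. \<Sum>j<n. a * (f i * f j))"
      for a :: real and f :: "nat \<Rightarrow> real"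
      by (subst sum_product) (simp only: sum_distrib_left)
    show ?thesis unfolding prod by (simp add: sum.distrib sum_subtractf)
  qed
  also have "\<dots> \<le> 0" using nn by (simp add: assms sum_nonneg)
  finally show ?thesis .
qed

lemma exact_recovery_of_good:
  assumes score: "\<And>i. i < n \<Longrightarrow> (\<Sum>j<n. \<sigma> i * \<sigma> j * G A i j) > L / 2"
    and noise: "\<And>x. quad_form n (\<lambda>i j. G A i j - mean_G i j) x \<le> 2 / 5 * L * (\<Sum>i<n. (x i)\<^sup>2)"
  shows "exact_recovery m n \<sigma> A"
  unfolding exact_recovery_def
proof (rule sdp_certificate)
  have entry: "weighted_graph m n A $$ (i, j) = G A i j" if "i < n" "j < n" for i j
    using weighted_graph_entry[OF m that] .
  show "weighted_graph m n A $$ (i, j) = weighted_graph m n A $$ (j, i)" if "i < n" "j < n" for i j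
    using that by (simp add: entry pair_weight_sym)
  fix x :: "nat \<Rightarrow> real"
  assume x: "(\<Sum>i<n. x i) = 0" "(\<Sum>i<n. \<sigma> i * x i) = 0" "\<exists>i<n. x i \<noteq> 0"
  define S where "S = (\<Sum>i<n. (x i)\<^sup>2)"
  have S: "S > 0"
  proof -
    obtain i where "i < n" "x i \<noteq> 0" using x(3) by blast
    then show ?thesis unfolding S_def by (intro sum_pos2[of _ i]) auto
  qed
  have "quad_form n (\<lambda>i j. weighted_graph m n A $$ (i, j)) x = quad_form n (\<lambda>i j. G A i j - mean_G i j) x + quad_form n mean_G x"
    unfolding quad_form_def sum.distrib[symmetric]
    by (intro sum.cong refl) (simp add: entry algebra_simps)
  also have "\<dots> \<le> 2 / 5 * L * S + 0"
    unfolding S_def by (intro add_mono noise quad_form_mean_G_nonpos x)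
  also have "\<dots> < L / 2 * S" using S L_pos by simp
  also have "\<dots> = (\<Sum>i<n. L / 2 * (x i)\<^sup>2)" by (simp add: S_def sum_distrib_left)
  also have "\<dots> \<le> (\<Sum>i<n. (\<Sum>j<n. \<sigma> i * \<sigma> j * weighted_graph m n A $$ (i, j)) * (x i)\<^sup>2)"
  proof (intro sum_mono mult_right_mono)
    fix i assume i: "i \<in> {..<n}"
    have "(\<Sum>j<n. \<sigma> i * \<sigma> j * weighted_graph m n A $$ (i, j)) = (\<Sum>j<n. \<sigma> i * \<sigma> j * G A i j)"
      by (rule sum.cong) (use i in \<open>auto simp: entry\<close>)
    then show "L / 2 \<le> (\<Sum>j<n. \<sigma> i * \<sigma> j * weighted_graph m n A $$ (i, j))"
      using score[of i] i by simp
  qed simp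
  finally show "quad_form n (\<lambda>i j. weighted_graph m n A $$ (i, j)) x <
      (\<Sum>i<n. (\<Sum>j<n. \<sigma> i * \<sigma> j * weighted_graph m n A $$ (i, j)) * (x i)\<^sup>2)" .
qed (use n labels bal in \<open>auto simp: weighted_graph_def\<close>)

text \<open>The constants make each of the four error terms of \<open>quad_form_le_light_heavy\<close> at most \<open>L n / 10\<close>
  on the lattice ball, so that the noise \<open>2 L / 5\<close> stays below the scores \<open>L / 2\<close>.\<close>

lemma recovery_failure_prob:
  defines "\<epsilon> \<equiv> 1 / (80 * (real m * (2 * t + 2)))"
  defines "\<rho> \<equiv> \<epsilon> / (2000 * real m ^ 2) * L"
  assumes thr: "t > J_threshold m p q"
    and ratio: "15 / 16 * real k ^ (m - 1) \<le> fact (m - 1) * real ((k - 1) choose (m - 1))"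
    and small: "t / real n \<le> 1 / 4"
    and large: "4000000 * t * real m ^ 2 \<le> L"
    and \<rho>: "\<rho> > 1" "\<epsilon> / 40 * ln \<rho> / real m ^ 2 \<ge> t + 3"
  shows "measure_pmf.prob obs_law {A. \<not> exact_recovery m n \<sigma> A} \<le> 3 / real n + 1 / sqrt (real n)"
proof -
  define \<theta> where "\<theta> = L / (500 * real m ^ 2)"
  define \<Delta> where "\<Delta> = real m * (2 * t + 2) * L"
  have \<theta>: "\<theta> > 0" using L_pos m by (simp add: \<theta>_def)
  have \<epsilon>: "\<epsilon> > 0" using t m by (simp add: \<epsilon>_def)
  \<comment> \<open>On the ball \<open>S = 4 * n\<close>, so
    \<open>\<epsilon> * \<Delta> = L / 80\<close> makes the degree term
    \<open>2 * \<epsilon> * \<Delta> * S\<close> equal to \<open>L * n / 10\<close>. The sparsity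
    constant \<open>\<epsilon> / 40 * L\<close> does the same for the term
    \<open>K / \<epsilon> * S\<close>.\<close>
  have \<Delta>: "\<Delta> \<ge> 0" "\<epsilon> * \<Delta> = L / 80" using t m L_pos by (simp_all add: \<epsilon>_def \<Delta>_def)
  have \<rho>_eq: "\<epsilon> * \<theta> = 4 * \<rho>" by (simp add: \<rho>_def \<theta>_def)
  let ?score = "{A. \<exists>i<n. (\<Sum>j<n. \<sigma> i * \<sigma> j * G A i j) \<le> L / 2}"
  let ?deg = "{A. \<exists>i<n. (\<Sum>j<n. G A i j) > real m * (2 * t + 2) * L}"
  let ?sparse = "{A. \<exists>U. U \<subseteq> {..<n} \<and> real (card U) * \<rho> \<le> real n \<and>
      (\<Sum>i\<in>U. \<Sum>j\<in>U. G A i j) > \<epsilon> / 40 * L * real (card U)}"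
  let ?light = "{A. \<exists>z\<in>lattice_ball n.
      (\<Sum>i<n. \<Sum>j<n. if \<bar>of_int (z i) * of_int (z j)\<bar> \<le> \<theta>
        then (G A i j - mean_G i j) * of_int (z i) * of_int (z j) else 0) \<ge> L * real n / 10}"
  have "{A. \<not> exact_recovery m n \<sigma> A} \<subseteq> ?score \<union> ?deg \<union> (?sparse \<union> ?light)"
  proof
    fix A assume bad: "A \<in> {A. \<not> exact_recovery m n \<sigma> A}"
    show "A \<in> ?score \<union> ?deg \<union> (?sparse \<union> ?light)"
    proof (rule ccontr)
      assume "A \<notin> ?score \<union> ?deg \<union> (?sparse \<union> ?light)"
      then have good: "A \<notin> ?score" "A \<notin> ?deg" "A \<notin> ?sparse" "A \<notin> ?light" by blast+
      have deg: "(\<Sum>j<n. G A i j) \<le> \<Delta>" if "i < n" for i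
        using good(2) that unfolding \<Delta>_def mem_Collect_eq by (meson not_less)
      have sparse: "(\<Sum>i\<in>U. \<Sum>j\<in>U. G A i j) \<le> \<epsilon> / 40 * L * real (card U)"
        if "U \<subseteq> {..<n}" "real (card U) * (\<epsilon> * \<theta>) \<le> 4 * real n" for U
      proof -
        have "real (card U) * \<rho> \<le> real n" using that(2) unfolding \<rho>_eq by simp
        then show ?thesis using good(3) that(1) unfolding mem_Collect_eq by (meson not_less)
      qed
      have "exact_recovery m n \<sigma> A"
      proof (rule exact_recovery_of_good)
        show "(\<Sum>j<n. \<sigma> i * \<sigma> j * G A i j) > L / 2" if "i < n" for i
          using good(1) that unfolding mem_Collect_eq by (meson not_le)
        show "quad_form n (\<lambda>i j. G A i j - mean_G i j) x \<le> 2 / 5 * L * (\<Sum>i<n. (x i)\<^sup>2)" for x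
        proof (rule quad_form_le_of_lattice)
          fix z assume z: "z \<in> lattice_ball n"
          have "real_of_int (\<Sum>i<n. (z i)\<^sup>2) \<le> real_of_int (4 * int n)"
            using z unfolding lattice_ball_def of_int_le_iff by simp
          then have zS: "(\<Sum>i<n. (of_int (z i))\<^sup>2) \<le> 4 * real n" by simp
          have "quad_form n (\<lambda>i j. G A i j - mean_G i j) (\<lambda>i. of_int (z i)) \<le>
              L * real n / 10 + (2 * \<epsilon> * \<Delta> + (\<epsilon> / 40 * L) / \<epsilon>) * (4 * real n) + (t * L / real n) / \<theta> * (4 * real n)\<^sup>2"
          proof (rule quad_form_le_light_heavy)
            show "(\<Sum>i<n. \<Sum>j<n. if \<bar>of_int (z i) * of_int (z j)\<bar> \<le> \<theta>
                then (G A i j - mean_G i j) * of_int (z i) * of_int (z j) else 0) \<le> L * real n / 10"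
              using good(4) z unfolding mem_Collect_eq by (meson linear)
            show "0 \<le> mean_G i j \<and> mean_G i j \<le> t * L / real n" if "i < n" "j < n" for i j
              using mean_G_bounds[OF that] by simp
          qed (use deg sparse zS \<theta> \<epsilon> \<Delta> t L_pos in \<open>auto simp: G_nonneg pair_weight_sym\<close>)
          also have "2 * \<epsilon> * \<Delta> = L / 40" using \<Delta>(2) by simp
          also have "(\<epsilon> / 40 * L) / \<epsilon> = L / 40" using \<epsilon> by simp
          also have "(t * L / real n) / \<theta> * (4 * real n)\<^sup>2 = 8000 * t * real m ^ 2 * real n"
            using L_pos n m by (simp add: \<theta>_def power2_eq_square field_simps)
          also have "\<dots> \<le> L / 10 * real n"
          proof (rule mult_right_mono)
            have "0 \<le> t * real m ^ 2" using t by simp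
            then show "8000 * t * real m ^ 2 \<le> L / 10" using large by simp
          qed simp
          finally show "quad_form n (\<lambda>i j. G A i j - mean_G i j) (\<lambda>i. of_int (z i)) \<le> 2 / 5 * L * real n"
            by (simp add: algebra_simps)
        qed (simp add: pair_weight_def)
      qed
      then show False using bad by simp
    qed
  qed
  then have "measure_pmf.prob obs_law {A. \<not> exact_recovery m n \<sigma> A} \<le>
      measure_pmf.prob obs_law (?score \<union> ?deg \<union> (?sparse \<union> ?light))"
    by (intro measure_pmf.finite_measure_mono) auto
  also have "\<dots> \<le> measure_pmf.prob obs_law (?score \<union> ?deg) + measure_pmf.prob obs_law (?sparse \<union> ?light)"
    by (rule measure_Un_le) auto
  also have "\<dots> \<le> (measure_pmf.prob obs_law ?score + measure_pmf.prob obs_law ?deg) +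
      (measure_pmf.prob obs_law ?sparse + measure_pmf.prob obs_law ?light)"
    by (intro add_mono measure_Un_le) auto
  also have "\<dots> \<le> (1 / sqrt (real n) + 1 / real n) + (1 / real n + 1 / real n)"
    by (intro add_mono score_tail degree_tail sparse_tail light_tail thr ratio small \<rho> large \<theta>_def)
  finally show ?thesis by simp
qed

end

section \<open>Exact recovery\<close>

text \<open>The numerator is a product of \<open>r\<close> factors, each between
  \<open>k - (r + 1)\<close> and \<open>k\<close>. Only the consequence that the ratio eventually
  exceeds 15/16 is used, to bound the mean score from below.\<close>

lemma binomial_ratio_tendsto:
  "(\<lambda>k. fact r * real ((k - 1) choose r) / real k ^ r) \<longlonglongrightarrow> 1"
proof (rule tendsto_sandwich)
  show "\<forall>\<^sub>F k in sequentially. (1 - real (r + 1) / real k) ^ r \<le> fact r * real ((k - 1) choose r) / real k ^ r"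
    using eventually_gt_at_top[of "r + 1"]
  proof eventually_elim
    case (elim k)
    have "(1 - real (r + 1) / real k) ^ r * real k ^ r = (real k - real (r + 1)) ^ r"
      using elim by (simp add: power_mult_distrib[symmetric] field_simps)
    also have "\<dots> = (\<Prod>i=0..<r. real k - real (r + 1))" by simp
    also have "\<dots> \<le> (\<Prod>i=0..<r. real (k - 1) - real i)"
      using elim by (intro prod_mono) (auto simp: of_nat_diff)
    also have "\<dots> = fact r * real ((k - 1) choose r)"
      by (simp add: binomial_gbinomial gbinomial_prod_rev)
    finally show ?case using elim by (simp add: field_simps)
  qed
  show "\<forall>\<^sub>F k in sequentially. fact r * real ((k - 1) choose r) / real k ^ r \<le> 1"
    using eventually_gt_at_top[of 0]
  proof eventually_elim
    case (elim k)
    have "fact r * real ((k - 1) choose r) \<le> real (k - 1) ^ r" by (rule fact_binomial_le)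
    also have "\<dots> \<le> real k ^ r" by (intro power_mono) auto
    finally show ?case using elim by (simp add: divide_le_eq)
  qed
  have "(\<lambda>k. 1 - real (r + 1) / real k) \<longlonglongrightarrow> 1" by real_asymp
  from tendsto_power[OF this, of r] show "(\<lambda>k. (1 - real (r + 1) / real k) ^ r) \<longlonglongrightarrow> 1" by simp
qed real_asymp

text \<open>With a null event the conditional probability would be the default value 0 of division
  by zero, and the lower bound could fail.\<close>

lemma balanced_prob_pos: "measure_pmf.prob (label_pmf (2 * k)) {\<sigma>. balanced (2 * k) \<sigma>} > 0"
proof (rule measure_pmf_posI)
  let ?s = "\<lambda>i. if i < k then 1 else if i < 2 * k then -1 else (0::real)"
  show "?s \<in> set_pmf (label_pmf (2 * k))"
    by (auto simp: label_pmf_def set_Pi_pmf PiE_dflt_def)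
  have "community_pos (2 * k) ?s = {..<k}" by (auto simp: community_pos_def split: if_splits)
  moreover have "community_neg (2 * k) ?s = {k..<2 * k}" by (auto simp: community_neg_def split: if_splits)
  ultimately show "?s \<in> {\<sigma>. balanced (2 * k) \<sigma>}" by (simp add: balanced_def)
qed

text \<open>A failure bound that holds for each \<open>s\<close> in \<open>B\<close> can be
  integrated over \<open>B\<close>, so failure together with \<open>B\<close> has probability at
  most \<open>b\<close> times that of \<open>B\<close>. The size of \<open>B\<close> cancels, and it
  may tend to 0 with \<open>n\<close>.\<close>

lemma cond_prob_ge_of_uniform:
  fixes M :: "'a pmf" and N :: "'a \<Rightarrow> 'b pmf"
  assumes pos: "measure_pmf.prob M {s. B s} > 0" and b: "b \<ge> 0"
    and bad: "\<And>s. s \<in> set_pmf M \<Longrightarrow> B s \<Longrightarrow> measure_pmf.prob (N s) {a. \<not> R s a} \<le> b"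
  defines "J \<equiv> M \<bind> (\<lambda>s. N s \<bind> (\<lambda>a. return_pmf (s, a)))"
  shows "cond_prob (measure_pmf J) (\<lambda>x. R (fst x) (snd x)) (\<lambda>x. B (fst x)) \<ge> 1 - b"
proof -
  \<comment> \<open>Disintegration of the joint law over its first component.\<close>
  have em: "emeasure (measure_pmf J) X = (\<integral>\<^sup>+s. emeasure (measure_pmf (N s)) (Pair s -` X) \<partial>measure_pmf M)" for X
    unfolding J_def map_pmf_def[symmetric] by simp
  have "Pair s -` {x. B (fst x)} = (if B s then UNIV else {})" for s :: 'a
    by auto
  then have "emeasure (measure_pmf J) {x. B (fst x)} = (\<integral>\<^sup>+s. indicator {s. B s} s \<partial>measure_pmf M)"
    unfolding em by (intro nn_integral_cong) (auto simp: indicator_def)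
  then have PB: "emeasure (measure_pmf J) {x. B (fst x)} = emeasure (measure_pmf M) {s. B s}" by simp
  then have PB': "measure_pmf.prob J {x. B (fst x)} = measure_pmf.prob M {s. B s}"
    by (simp add: measure_def)
  have "emeasure (measure_pmf J) {x. \<not> R (fst x) (snd x) \<and> B (fst x)} \<le>
      (\<integral>\<^sup>+s. ennreal b * indicator {s. B s} s \<partial>measure_pmf M)"
    unfolding em
  proof (intro nn_integral_mono_AE AE_pmfI)
    fix s assume s: "s \<in> set_pmf M"
    show "emeasure (measure_pmf (N s)) (Pair s -` {x. \<not> R (fst x) (snd x) \<and> B (fst x)}) \<le> ennreal b * indicator {s. B s} s"
    proof (cases "B s")
      case True
      have "Pair s -` {x. \<not> R (fst x) (snd x) \<and> B (fst x)} = {a. \<not> R s a}" using True by auto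
      then show ?thesis using bad[OF s True] True
        by (simp add: measure_pmf.emeasure_eq_measure ennreal_leI)
    next
      case False
      then have "Pair s -` {x. \<not> R (fst x) (snd x) \<and> B (fst x)} = {}" by auto
      then show ?thesis by (simp only: emeasure_empty zero_le)
    qed
  qed
  also have "\<dots> = ennreal b * emeasure (measure_pmf M) {s. B s}"
    by (simp add: nn_integral_cmult)
  also have "\<dots> = ennreal (b * measure_pmf.prob M {s. B s})"
    using b by (simp add: measure_pmf.emeasure_eq_measure ennreal_mult)
  finally have bad_le: "measure_pmf.prob J {x. \<not> R (fst x) (snd x) \<and> B (fst x)} \<le> b * measure_pmf.prob M {s. B s}"
    using b by (simp add: measure_pmf.emeasure_eq_measure)
  have split: "{x. B (fst x)} = {x. R (fst x) (snd x) \<and> B (fst x)} \<union> {x. \<not> R (fst x) (snd x) \<and> B (fst x)}" by auto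
  have "measure_pmf.prob J {x. B (fst x)} \<le>
      measure_pmf.prob J {x. R (fst x) (snd x) \<and> B (fst x)} + measure_pmf.prob J {x. \<not> R (fst x) (snd x) \<and> B (fst x)}"
    by (subst split, rule measure_Un_le) auto
  then have "(1 - b) * measure_pmf.prob M {s. B s} \<le> measure_pmf.prob J {x. R (fst x) (snd x) \<and> B (fst x)}"
    using bad_le PB' by (simp add: algebra_simps)
  then show ?thesis using pos by (simp add: cond_prob_def PB' field_simps)
qed

theorem theorem2p4:
  fixes m :: nat and p q t :: real
  assumes "m \<ge> 2"
    and "0 < p" "p < 1" and "0 < q" "q < 1" and "q < p"
    and "0 < t"
    and "t > J_threshold m p q"
  shows "(\<lambda>k. let n = 2 * k in
           \<P>(x in hsbm_pmf m n p q (reveal_rate m t n).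
              exact_recovery m n (fst x) (snd x) \<bar> balanced n (fst x)))
         \<longlonglongrightarrow> 1"
proof (rule tendsto_sandwich)
  define \<epsilon> where "\<epsilon> = 1 / (80 * (real m * (2 * t + 2)))"
  define c where "c = \<epsilon> / (2000 * real m ^ 2)"
  define b where "b k = 3 / real (2 * k) + 1 / sqrt (real (2 * k))" for k :: nat
  have c: "c > 0" using assms by (simp add: c_def \<epsilon>_def)
  have m0: "real m ^ 2 > 0" "\<epsilon> > 0" using assms by (simp_all add: \<epsilon>_def)
  have "(\<lambda>k. t * ln (real (2 * k)) / real (2 * k)) \<longlonglongrightarrow> 0" by real_asymp
  then have ev_rate: "\<forall>\<^sub>F k in sequentially. t * ln (real (2 * k)) / real (2 * k) < 1"
    by (rule order_tendstoD) simp
  have "(\<lambda>k. t / real (2 * k)) \<longlonglongrightarrow> 0" by real_asymp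
  then have ev_small: "\<forall>\<^sub>F k in sequentially. t / real (2 * k) < 1 / 4"
    by (rule order_tendstoD) simp
  have L_top: "filterlim (\<lambda>k. ln (real (2 * k))) at_top sequentially" by real_asymp
  then have ev_large: "\<forall>\<^sub>F k in sequentially. 4000000 * t * real m ^ 2 \<le> ln (real (2 * k))"
    by (simp add: filterlim_at_top)
  have rho_top: "filterlim (\<lambda>k. c * ln (real (2 * k))) at_top sequentially" using c by real_asymp
  then have ev_rho: "\<forall>\<^sub>F k in sequentially. c * ln (real (2 * k)) > 1"
    by (simp add: filterlim_at_top_dense)
  \<comment> \<open>Since \<epsilon> is fixed, \<rho> has order \<open>ln n\<close>. The condition
    that small sets are sparse thus asks \<open>ln (ln n)\<close> to exceed a constant, which still
    holds eventually.\<close>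
  have "filterlim (\<lambda>k. ln (c * ln (real (2 * k)))) at_top sequentially" using c by real_asymp
  then have ev_ln: "\<forall>\<^sub>F k in sequentially. (t + 3) * real m ^ 2 * 40 / \<epsilon> \<le> ln (c * ln (real (2 * k)))"
    by (simp add: filterlim_at_top)
  have ev_ratio: "\<forall>\<^sub>F k in sequentially. 15 / 16 < fact (m - 1) * real ((k - 1) choose (m - 1)) / real k ^ (m - 1)"
    by (rule order_tendstoD(1)[OF binomial_ratio_tendsto]) simp
  show "\<forall>\<^sub>F k in sequentially. 1 - b k \<le> (let n = 2 * k in
           \<P>(x in hsbm_pmf m n p q (reveal_rate m t n).
              exact_recovery m n (fst x) (snd x) \<bar> balanced n (fst x)))"
    using ev_rate ev_small ev_large ev_rho ev_ln ev_ratio eventually_gt_at_top[of 0]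
  proof eventually_elim
    case (elim k)
    have rate: "reveal_rate m t (2 * k) \<le> 1"
    proof -
      \<comment> \<open>Here \<open>m \<ge> 2\<close> matters: it bounds the revelation rate by
        \<open>t * ln n / n\<close>, which tends to 0.\<close>
      have "real (2 * k) ^ 1 \<le> real (2 * k) ^ (m - 1)"
        using elim(7) assms(1) by (intro power_increasing) auto
      then have "reveal_rate m t (2 * k) \<le> t * ln (real (2 * k)) / real (2 * k)"
        unfolding reveal_rate_def using elim(7) assms(7) by (intro divide_left_mono) auto
      then show ?thesis using elim(1) by simp
    qed
    have "1 - b k \<le> cond_prob (measure_pmf (label_pmf (2 * k) \<bind> (\<lambda>\<sigma>.
        observation_pmf m (2 * k) p q (reveal_rate m t (2 * k)) \<sigma> \<bind> (\<lambda>A. return_pmf (\<sigma>, A)))))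
        (\<lambda>x. exact_recovery m (2 * k) (fst x) (snd x)) (\<lambda>x. balanced (2 * k) (fst x))"
    proof (rule cond_prob_ge_of_uniform)
      show "measure_pmf.prob (label_pmf (2 * k)) {\<sigma>. balanced (2 * k) \<sigma>} > 0"
        by (rule balanced_prob_pos)
      show "b k \<ge> 0" by (simp add: b_def)
      fix \<sigma> assume \<sigma>: "\<sigma> \<in> set_pmf (label_pmf (2 * k))" "balanced (2 * k) \<sigma>"
      have lab: "\<sigma> i \<in> {1, -1}" if "i < 2 * k" for i
        using \<sigma>(1) that by (auto simp: label_pmf_def set_Pi_pmf PiE_dflt_def)
      interpret balanced_hsbm m "2 * k" p q t \<sigma> k
        by unfold_locales (use assms elim rate lab \<sigma>(2) in auto)
      show "measure_pmf.prob (observation_pmf m (2 * k) p q (reveal_rate m t (2 * k)) \<sigma>)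
          {A. \<not> exact_recovery m (2 * k) \<sigma> A} \<le> b k"
        unfolding b_def
      proof (rule recovery_failure_prob)
        show "15 / 16 * real k ^ (m - 1) \<le> fact (m - 1) * real ((k - 1) choose (m - 1))"
          using elim(6,7) by (simp add: field_simps)
        show "1 < 1 / (80 * (real m * (2 * t + 2))) / (2000 * (real m)\<^sup>2) * ln (real (2 * k))"
          using elim(4) unfolding c_def \<epsilon>_def .
        have "t + 3 \<le> \<epsilon> / 40 * ln (c * ln (real (2 * k))) / real m ^ 2"
          using elim(5) m0 by (simp add: field_simps)
        then show "t + 3 \<le> 1 / (80 * (real m * (2 * t + 2))) / 40 *
            ln (1 / (80 * (real m * (2 * t + 2))) / (2000 * (real m)\<^sup>2) * ln (real (2 * k))) / (real m)\<^sup>2"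
          unfolding c_def \<epsilon>_def .
      qed (use elim assms in auto)
    qed
    then show ?case by (simp add: hsbm_pmf_def Let_def)
  qed
  have "b \<longlonglongrightarrow> 0" unfolding b_def by real_asymp
  from tendsto_diff[OF tendsto_const this, of 1] show "(\<lambda>k. 1 - b k) \<longlonglongrightarrow> 1" by simp
  show "\<forall>\<^sub>F k in sequentially. (let n = 2 * k in
           \<P>(x in hsbm_pmf m n p q (reveal_rate m t n).
              exact_recovery m n (fst x) (snd x) \<bar> balanced n (fst x))) \<le> 1"
  proof (rule always_eventually, rule allI)
    fix k
    have "measure_pmf.prob M {x. P x \<and> Q x} / measure_pmf.prob M {x. Q x} \<le> 1" for M :: "('x \<times> 'y) pmf" and P Q
    proof -
      have "measure_pmf.prob M {x. P x \<and> Q x} \<le> measure_pmf.prob M {x. Q x}"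
        by (intro measure_pmf.finite_measure_mono) auto
      then show ?thesis by (simp add: divide_le_eq_1 zero_less_measure_iff)
    qed
    then show "(let n = 2 * k in
           \<P>(x in hsbm_pmf m n p q (reveal_rate m t n).
              exact_recovery m n (fst x) (snd x) \<bar> balanced n (fst x))) \<le> 1"
      by (simp add: cond_prob_def Let_def)
  qed
qed real_asymp

end
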